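(* Let $D$ be a digraph and let $\omega$ be an end of $D$. (a) If $\omega$ contains infinitely many pairwise (vertex-)disjoint rays, then $D$ contains a subdivision of the bidirected quarter-grid all of whose rays belong to $\omega$. (b) If $\omega$ contains infinitely many pairwise (vertex-)disjoint anti-rays, then $D$ contains a subdivision of the reversed bidirected quarter-grid all of whose anti-rays belong to $\omega$.
   Context: Digraphs may be infinite. A dipath is a directed path. A ray is an orientation of a one-way infinite path in which every edge is oriented towards infinity (i.e. there is a starting vertex of in-degree $0$ and out-degree $1$, all other vertices have in- and out-degree $1$); an anti-ray is an orientation of a one-way infinite path in which every edge is oriented away from infinity. For rays or anti-rays $Q,R$ of $D$ write $Q\le R$ if there are infinitely many pairwise disjoint $Q$--$R$ dipaths (dipaths starting in $V(Q)$, ending in $V(R)$ and internally disjoint from $V(Q)\cup V(R)$), and $Q\sim R$ if $Q\le R$ and $R\le Q$. The ends of $D$ are the equivalence classes of $\sim$ on the set of all rays and anti-rays of $D$. Bidirected quarter-grid: take infinitely many pairwise disjoint rays $R_i=x^i_1x^i_2x^i_3\ldots$ ($i\ge 1$), add the edges $x^i_{4j+7}x^{i+1}_{4j+1}$ and $x^{i+1}_{4j+2}x^i_{4j+8}$ for all $j\ge 0$ and $i\ge 1$, and finally suppress every vertex $v\in V(R_i)$ with $d^-(v)=d^+(v)=1$ all of whose neighbours lie on $R_i$. The reversed bidirected quarter-grid is obtained from the bidirected quarter-grid by reversing the orientations of all its edges. A subdivision of a digraph $H$ is obtained by replacing every edge $uv$ of $H$ by a new $u$--$v$ dipath, these dipaths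 being internally disjoint and having no inner vertices in $V(H)$. "$D$ contains a subdivision of $H$ with all its rays (anti-rays) in $\omega$" means that some subdigraph $S$ of $D$ is isomorphic to a subdivision of $H$ and every ray (anti-ray) of $S$ belongs to $\omega$. *)

theory Defs
  imports Main
begin

text \<open>A digraph is given by a vertex set V and an arc relation A with A \<subseteq> V \<times> V.\<close>

definition ray :: "'v set \<Rightarrow> ('v \<times> 'v) set \<Rightarrow> (nat \<Rightarrow> 'v) \<Rightarrow> bool" where
  "ray V A r \<longleftrightarrow> inj r \<and> (\<forall>n. r n \<in> V) \<and> (\<forall>n. (r n, r (Suc n)) \<in> A)"

definition anti_ray :: "'v set \<Rightarrow> ('v \<times> 'v) set \<Rightarrow> (nat \<Rightarrow> 'v) \<Rightarrow> bool" where
  "anti_ray V A r \<longleftrightarrow> inj r \<and> (\<forall>n. r n \<in> V) \<and> (\<forall>n. (r (Suc n), r n) \<in> A)"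

text \<open>Rays are tagged True, anti-rays False (a bidirected path carries both).\<close>
definition rays_antirays :: "'v set \<Rightarrow> ('v \<times> 'v) set \<Rightarrow> (bool \<times> (nat \<Rightarrow> 'v)) set" where
  "rays_antirays V A = {(True, r) | r. ray V A r} \<union> {(False, r) | r. anti_ray V A r}"

definition dipath :: "'v set \<Rightarrow> ('v \<times> 'v) set \<Rightarrow> 'v list \<Rightarrow> bool" where
  "dipath V A xs \<longleftrightarrow> xs \<noteq> [] \<and> distinct xs \<and> set xs \<subseteq> V \<and>
     (\<forall>i. Suc i < length xs \<longrightarrow> (xs ! i, xs ! Suc i) \<in> A)"

definition inner :: "'v list \<Rightarrow> 'v list" where
  "inner xs = butlast (tl xs)"

definition path_arcs :: "'v list \<Rightarrow> ('v \<times> 'v) set" where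
  "path_arcs xs = set (zip xs (tl xs))"

definition linking_dipath :: "'v set \<Rightarrow> ('v \<times> 'v) set \<Rightarrow> 'v set \<Rightarrow> 'v set \<Rightarrow> 'v list \<Rightarrow> bool" where
  "linking_dipath V A X Y xs \<longleftrightarrow> dipath V A xs \<and> hd xs \<in> X \<and> last xs \<in> Y \<and>
     set (inner xs) \<inter> (X \<union> Y) = {}"

definition end_le :: "'v set \<Rightarrow> ('v \<times> 'v) set \<Rightarrow> bool \<times> (nat \<Rightarrow> 'v) \<Rightarrow> bool \<times> (nat \<Rightarrow> 'v) \<Rightarrow> bool" where
  "end_le V A Q R \<longleftrightarrow> (\<exists>P :: nat \<Rightarrow> 'v list.
     (\<forall>n. linking_dipath V A (range (snd Q)) (range (snd R)) (P n)) \<and>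
     (\<forall>m n. m \<noteq> n \<longrightarrow> set (P m) \<inter> set (P n) = {}))"

definition end_equiv :: "'v set \<Rightarrow> ('v \<times> 'v) set \<Rightarrow> bool \<times> (nat \<Rightarrow> 'v) \<Rightarrow> bool \<times> (nat \<Rightarrow> 'v) \<Rightarrow> bool" where
  "end_equiv V A Q R \<longleftrightarrow> end_le V A Q R \<and> end_le V A R Q"

definition is_end :: "'v set \<Rightarrow> ('v \<times> 'v) set \<Rightarrow> (bool \<times> (nat \<Rightarrow> 'v)) set \<Rightarrow> bool" where
  "is_end V A \<omega> \<longleftrightarrow> (\<exists>Q \<in> rays_antirays V A.
     \<omega> = {R \<in> rays_antirays V A. end_equiv V A Q R})"

text \<open>Bidirected quarter-grid before suppression: vertex (i,n) is x^i_n, i,n \<ge> 1.\<close>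
definition qgrid_V0 :: "(nat \<times> nat) set" where
  "qgrid_V0 = {(i, n). 1 \<le> i \<and> 1 \<le> n}"

definition qgrid_A0 :: "((nat \<times> nat) \<times> (nat \<times> nat)) set" where
  "qgrid_A0 = {((i, n), (i, Suc n)) | i n. 1 \<le> i \<and> 1 \<le> n}
     \<union> {((i, 4 * j + 7), (i + 1, 4 * j + 1)) | i j. 1 \<le> i}
     \<union> {((i + 1, 4 * j + 2), (i, 4 * j + 8)) | i j. 1 \<le> i}"

definition qgrid_supp :: "(nat \<times> nat) set" where
  "qgrid_supp = {v \<in> qgrid_V0. card {u. (u, v) \<in> qgrid_A0} = 1 \<and> card {w. (v, w) \<in> qgrid_A0} = 1
      \<and> (\<forall>u. (u, v) \<in> qgrid_A0 \<or> (v, u) \<in> qgrid_A0 \<longrightarrow> fst u = fst v)}"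

text \<open>Suppression: remove the suppressed vertices and join u to w whenever there is a
  u--w dipath all of whose inner vertices are suppressed.\<close>
definition qgrid_V :: "(nat \<times> nat) set" where
  "qgrid_V = qgrid_V0 - qgrid_supp"

definition qgrid_A :: "((nat \<times> nat) \<times> (nat \<times> nat)) set" where
  "qgrid_A = {(u, w). u \<in> qgrid_V \<and> w \<in> qgrid_V \<and>
      (u, w) \<in> (qgrid_A0 \<inter> (UNIV \<times> qgrid_supp))\<^sup>* O qgrid_A0}"

definition rev_qgrid_A :: "((nat \<times> nat) \<times> (nat \<times> nat)) set" where
  "rev_qgrid_A = qgrid_A\<inverse>"

definition subdivision_in :: "'v set \<Rightarrow> ('v \<times> 'v) set \<Rightarrow> 'h set \<Rightarrow> ('h \<times> 'h) set
    \<Rightarrow> ('h \<Rightarrow> 'v) \<Rightarrow> ('h \<times> 'h \<Rightarrow> 'v list) \<Rightarrow> bool" where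
  "subdivision_in V A HV HA \<phi> P \<longleftrightarrow> inj_on \<phi> HV \<and> \<phi> ` HV \<subseteq> V \<and>
     (\<forall>(a, b) \<in> HA. dipath V A (P (a, b)) \<and> 2 \<le> length (P (a, b)) \<and>
        hd (P (a, b)) = \<phi> a \<and> last (P (a, b)) = \<phi> b \<and> set (inner (P (a, b))) \<inter> \<phi> ` HV = {}) \<and>
     (\<forall>e \<in> HA. \<forall>e' \<in> HA. e \<noteq> e' \<longrightarrow> set (inner (P e)) \<inter> set (P e') = {})"

definition subdiv_V :: "'h set \<Rightarrow> ('h \<times> 'h) set \<Rightarrow> ('h \<Rightarrow> 'v) \<Rightarrow> ('h \<times> 'h \<Rightarrow> 'v list) \<Rightarrow> 'v set" where
  "subdiv_V HV HA \<phi> P = \<phi> ` HV \<union> (\<Union>e \<in> HA. set (P e))"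

definition subdiv_A :: "('h \<times> 'h) set \<Rightarrow> ('h \<times> 'h \<Rightarrow> 'v list) \<Rightarrow> ('v \<times> 'v) set" where
  "subdiv_A HA P = (\<Union>e \<in> HA. path_arcs (P e))"

end

theory Submission
  imports Defs "HOL-Library.Ramsey" "HOL-Library.Discrete_Functions"
begin

text \<open>
  For rays and anti-rays \<open>Q \<le> R\<close> means that every finite set of vertices is avoided by some walk from
  \<open>Q\<close> to \<open>R\<close>; this relation is transitive, and reversing all arcs reduces (b) to (a).

  For a finite set \<open>F\<close> of the given rays, the relation ``\<open>a\<close> is linked to \<open>b\<close> by walks that avoid every
  finite set and all other rays of \<open>F\<close>'' is strongly connected on \<open>F\<close>. By Ramsey's theorem one may assume
  that it depends only on the ranks of \<open>a\<close> and \<open>b\<close> in \<open>F\<close> (and on the size of \<open>F\<close>). Strong connectivity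
  then forces one of two patterns: either each element is always linked to its successor, or each element
  is always linked to its predecessor and the minimum to the maximum. Both patterns yield an infinite
  sequence of lanes, each linked to the next one without touching the nearby lanes.

  The rows of the grid are not among the given rays: they travel diagonally. At every time step each row
  moves to the lane of the row ahead of it. Before it moves it can send a path to the row ahead; the
  part of the lane between its exit and the arrival of the row behind is a path in the other direction.
  Thinning out these two families of paths along a potential that never decreases in the quarter-grid
  gives the subdivision.

  A ray of the subdivision either meets some row infinitely often, or it drifts to ever higher rows. In
  the latter case it is reached from the first row by descending along first possible arcs, which always
  stay behind the drifting ray.
\<close>

section \<open>Walks avoiding finite sets\<close>

text \<open>The obstacle is that a link is directed and controlled only with respect to finitely
  many other rays. Homogeneity holds for \<open>n\<close> lanes only if all of them have index at
  least \<open>n\<close>, and a link may run through any lane outside the current window. A row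
  fixed on one lane would lose this protection as the number of rows grows, and links in one
  direction offer no way back. Travelling diagonally cures both: the window drifts outwards while it
  widens, and the way back is a stretch of a lane that one row has left and the row behind has not
  yet reached.

  Crossings with lanes outside the window are harmless because of the order along each lane: a new
  path meets it only beyond the ends of older paths, and has its own ends beyond all older paths. So
  a stretch between consecutive moves is met only by events that have the lane in their windows, and
  only in their ends.

  In the second pattern the lanes cannot decrease for ever. They run down in blocks of growing
  length, and the link from minimum to maximum leads to the start of the next block.\<close>

definition avoiding :: "('v \<times> 'v) set \<Rightarrow> 'v set \<Rightarrow> ('v \<times> 'v) set" where
  "avoiding A X = {(u, v) \<in> A. u \<notin> X \<and> v \<notin> X}"

text \<open>The clause \<open>u \<notin> X\<close> is there for the walk without arcs, which
  \<open>avoiding\<close> does not restrict. Walks, unlike families of disjoint dipaths, can be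
  concatenated directly.\<close>

definition tends :: "('v \<times> 'v) set \<Rightarrow> 'v set \<Rightarrow> 'v set \<Rightarrow> bool" where
  "tends A Q R \<longleftrightarrow> (\<forall>X. finite X \<longrightarrow> (\<exists>u\<in>Q. \<exists>v\<in>R. u \<notin> X \<and> (u, v) \<in> (avoiding A X)\<^sup>*))"

lemma avoiding_avoiding: "avoiding (avoiding A X) Y = avoiding A (X \<union> Y)"
  by (auto simp: avoiding_def)

lemma avoiding_mono: "A \<subseteq> B \<Longrightarrow> Y \<subseteq> X \<Longrightarrow> avoiding A X \<subseteq> avoiding B Y"
  by (auto simp: avoiding_def)

lemma avoiding_converse: "avoiding (A\<inverse>) X = (avoiding A X)\<inverse>"
  by (auto simp: avoiding_def)

lemma avoiding_rtrancl_target: "(u, v) \<in> (avoiding A X)\<^sup>* \<Longrightarrow> u \<notin> X \<Longrightarrow> v \<notin> X"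
  by (induction rule: rtrancl_induct) (auto simp: avoiding_def)

lemma avoiding_rtrancl_mono:
  "(u, v) \<in> (avoiding A X)\<^sup>* \<Longrightarrow> A \<subseteq> B \<Longrightarrow> Y \<subseteq> X \<Longrightarrow> (u, v) \<in> (avoiding B Y)\<^sup>*"
  using rtrancl_mono[OF avoiding_mono] by blast

lemma tendsD:
  assumes "tends A Q R" "finite X"
  obtains u v where "u \<in> Q" "v \<in> R" "u \<notin> X" "v \<notin> X" "(u, v) \<in> (avoiding A X)\<^sup>*"
  using assms avoiding_rtrancl_target unfolding tends_def by metis

lemma tends_mono: "tends A Q R \<Longrightarrow> A \<subseteq> B \<Longrightarrow> Q \<subseteq> Q' \<Longrightarrow> R \<subseteq> R' \<Longrightarrow> tends B Q' R'"
  unfolding tends_def using avoiding_rtrancl_mono by (metis in_mono order_refl)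

lemma tends_converse: "tends (A\<inverse>) R Q \<longleftrightarrow> tends A Q R"
proof -
  have "tends A Q R" if "tends (A\<inverse>) R Q" for A :: "('a \<times> 'a) set" and Q R
    unfolding tends_def
  proof (intro allI impI)
    fix X :: "'a set" assume "finite X"
    with that obtain u v where "u \<in> R" "v \<in> Q" "v \<notin> X" "(u, v) \<in> (avoiding (A\<inverse>) X)\<^sup>*"
      by (rule tendsD)
    then show "\<exists>u\<in>Q. \<exists>v\<in>R. u \<notin> X \<and> (u, v) \<in> (avoiding A X)\<^sup>*"
      by (auto simp: avoiding_converse rtrancl_converse)
  qed
  from this[of A R Q] this[of "A\<inverse>" Q R] show ?thesis by auto
qed

lemma tends_infinite_Int: "infinite (Q \<inter> R) \<Longrightarrow> tends A Q R"
  unfolding tends_def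
proof (intro allI impI)
  fix X :: "'a set" assume "infinite (Q \<inter> R)" "finite X"
  then have "\<exists>u. u \<in> (Q \<inter> R) - X" by (metis Diff_infinite_finite ex_in_conv finite.emptyI)
  then show "\<exists>u\<in>Q. \<exists>v\<in>R. u \<notin> X \<and> (u, v) \<in> (avoiding A X)\<^sup>*" by blast
qed

lemma follow_ray:
  assumes "\<And>n. (m n, m (Suc n)) \<in> A" "i \<le> j" "\<And>l. i \<le> l \<Longrightarrow> l \<le> j \<Longrightarrow> m l \<notin> X"
  shows "(m i, m j) \<in> (avoiding A X)\<^sup>*"
  using assms(2,3)
proof (induction j rule: dec_induct)
  case (step n)
  have "(m i, m n) \<in> (avoiding A X)\<^sup>*" using step by simp
  moreover have "(m n, m (Suc n)) \<in> avoiding A X"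
    using step.prems[of n] step.prems[of "Suc n"] step.hyps assms(1) by (auto simp: avoiding_def)
  ultimately show ?case by (rule rtrancl_into_rtrancl)
qed simp

lemma finite_ray_bound:
  assumes "inj (m :: nat \<Rightarrow> 'v)" "finite X"
  obtains N where "\<And>n. m n \<in> X \<Longrightarrow> n < N"
proof -
  have "finite (m -` X)" using assms by (simp add: finite_vimageI)
  then obtain N where "\<forall>n\<in>m -` X. n < N" using finite_nat_set_iff_bounded by blast
  then show thesis using that[of N] by simp
qed

text \<open>\<open>X\<close> meets the ray only before some index \<open>N\<close>. Adding initial
  segments of the ray to the avoided set makes the first walk reach the ray at some
  \<open>a \<ge> N\<close> and the second one leave it at some \<open>b \<ge> a\<close>. The stretch
  from \<open>a\<close> to \<open>b\<close> then runs forwards and is free of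
  \<open>X\<close>.\<close>

lemma tends_trans_ray:
  assumes QM: "tends A Q (range m)" and MR: "tends A (range m) R"
    and inj: "inj m" and arc: "\<And>n. (m n, m (Suc n)) \<in> A"
  shows "tends A Q R"
  unfolding tends_def
proof (intro allI impI)
  fix X :: "'a set" assume X: "finite X"
  obtain N where N: "\<And>n. m n \<in> X \<Longrightarrow> n < N" using finite_ray_bound[OF inj X] by blast
  obtain u v where uv: "u \<in> Q" "v \<in> range m" "u \<notin> X \<union> m ` {..<N}"
      "v \<notin> X \<union> m ` {..<N}" "(u, v) \<in> (avoiding A (X \<union> m ` {..<N}))\<^sup>*"
    using tendsD[OF QM, of "X \<union> m ` {..<N}"] X by (metis finite_UnI finite_imageI finite_lessThan)
  then obtain a where a: "v = m a" "N \<le> a" by (auto simp: not_less[symmetric])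
  obtain u' w where u': "u' \<in> range m" "w \<in> R" "u' \<notin> X \<union> m ` {..<a}"
      "(u', w) \<in> (avoiding A (X \<union> m ` {..<a}))\<^sup>*"
    using tendsD[OF MR, of "X \<union> m ` {..<a}"] X by (metis finite_UnI finite_imageI finite_lessThan)
  then obtain b where b: "u' = m b" "a \<le> b" by (auto simp: not_less[symmetric])
  have "(m a, m b) \<in> (avoiding A X)\<^sup>*"
    using follow_ray[of m A, OF arc b(2)] N a(2) by (meson le_trans not_less)
  moreover have "(u, m a) \<in> (avoiding A X)\<^sup>*"
    using avoiding_rtrancl_mono[OF uv(5), of A X] a(1) by simp
  moreover have "(m b, w) \<in> (avoiding A X)\<^sup>*"
    using avoiding_rtrancl_mono[OF u'(4), of A X] b(1) by simp
  ultimately show "\<exists>u\<in>Q. \<exists>v\<in>R. u \<notin> X \<and> (u, v) \<in> (avoiding A X)\<^sup>*"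
    using uv(1,3) u'(2) by (meson Un_iff rtrancl_trans)
qed

lemma tends_trans_anti_ray:
  assumes "tends A Q (range m)" "tends A (range m) R" "inj m" "\<And>n. (m (Suc n), m n) \<in> A"
  shows "tends A Q R"
  using tends_trans_ray[of "A\<inverse>" R m Q] assms by (simp add: tends_converse)

lemma rtrancl_imp_successively:
  "(u, v) \<in> A\<^sup>* \<Longrightarrow> \<exists>xs. xs \<noteq> [] \<and> hd xs = u \<and> last xs = v \<and> successively (\<lambda>x y. (x, y) \<in> A) xs"
proof (induction rule: converse_rtrancl_induct)
  case base
  then show ?case by (intro exI[of _ "[v]"]) simp
next
  case (step y z)
  then obtain xs where "xs \<noteq> []" "hd xs = z" "last xs = v" "successively (\<lambda>x y. (x, y) \<in> A) xs"
    by blast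
  with step.hyps show ?case by (intro exI[of _ "y # xs"]) (simp add: successively_Cons)
qed

lemma set_inner_split:
  "x \<in> set (inner xs) \<longleftrightarrow> (\<exists>ys zs. ys \<noteq> [] \<and> zs \<noteq> [] \<and> xs = ys @ x # zs)"
proof
  assume "x \<in> set (inner xs)"
  then have *: "x \<in> set (butlast (tl xs))" by (simp add: inner_def)
  then have ne: "tl xs \<noteq> []" by auto
  obtain as bs where "butlast (tl xs) = as @ x # bs" using * by (meson split_list)
  then have "tl xs = as @ x # (bs @ [last (tl xs)])"
    using append_butlast_last_id[OF ne] by simp
  then show "\<exists>ys zs. ys \<noteq> [] \<and> zs \<noteq> [] \<and> xs = ys @ x # zs"
    using ne by (intro exI[of _ "hd xs # as"] exI[of _ "bs @ [last (tl xs)]"]) (cases xs; simp)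
next
  assume "\<exists>ys zs. ys \<noteq> [] \<and> zs \<noteq> [] \<and> xs = ys @ x # zs"
  then show "x \<in> set (inner xs)" by (auto simp: inner_def butlast_append)
qed

lemma successively_avoiding:
  assumes "successively (\<lambda>x y. (x, y) \<in> avoiding A X) xs" "xs \<noteq> []" "hd xs \<notin> X"
  shows "set xs \<inter> X = {}"
  using assms(2,1,3) by (induction xs rule: list_nonempty_induct) (auto simp: successively_Cons avoiding_def)

text \<open>A walk of minimal length from \<open>Q\<close> to \<open>R\<close> outside
  \<open>X\<close> repeats no vertex, and an inner vertex in \<open>Q\<close> or \<open>R\<close>
  would allow it to be cut short.\<close>

lemma shortest_linking:
  assumes uv: "u \<in> Q" "v \<in> R" "u \<notin> X" "(u, v) \<in> (avoiding A X)\<^sup>*"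
  obtains xs where "xs \<noteq> []" "distinct xs" "successively (\<lambda>x y. (x, y) \<in> A) xs" "hd xs \<in> Q"
    "last xs \<in> R" "set xs \<inter> X = {}" "set (inner xs) \<inter> (Q \<union> R) = {}"
proof -
  define W where "W xs \<longleftrightarrow> xs \<noteq> [] \<and> hd xs \<in> Q \<and> last xs \<in> R \<and> hd xs \<notin> X \<and>
    successively (\<lambda>x y. (x, y) \<in> avoiding A X) xs" for xs
  have "\<exists>xs. W xs" using rtrancl_imp_successively[OF uv(4)] uv unfolding W_def by blast
  then obtain xs where W: "W xs" and min: "\<And>ys. W ys \<Longrightarrow> length xs \<le> length ys"
    using ex_has_least_nat[of W] by metis
  have suc: "successively (\<lambda>x y. (x, y) \<in> avoiding A X) xs" and ne: "xs \<noteq> []" using W by (auto simp: W_def)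
  have X: "set xs \<inter> X = {}" using successively_avoiding[OF suc ne] W by (simp add: W_def)
  have dist: "distinct xs"
  proof (rule ccontr)
    assume "\<not> distinct xs"
    then obtain as bs cs y where xs: "xs = as @ [y] @ bs @ [y] @ cs" using not_distinct_decomp by blast
    have "W (as @ y # cs)"
      using W unfolding W_def xs by (auto simp: successively_append_iff successively_Cons hd_append)
    with min[of "as @ y # cs"] show False unfolding xs by simp
  qed
  have "set (inner xs) \<inter> (Q \<union> R) = {}"
  proof (rule ccontr)
    assume "set (inner xs) \<inter> (Q \<union> R) \<noteq> {}"
    then obtain x where x: "x \<in> set (inner xs)" "x \<in> Q \<union> R" by auto
    then obtain as bs where xs: "xs = as @ x # bs" "as \<noteq> []" "bs \<noteq> []"
      using set_inner_split by metis
    have nX: "x \<notin> X" using X xs by auto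
    show False
    proof (cases "x \<in> Q")
      case True
      then have "W (x # bs)" using W nX unfolding W_def xs(1) by (auto simp: successively_append_iff)
      then show False using min[of "x # bs"] xs by simp
    next
      case False
      then have "W (as @ [x])"
        using W x xs(2) unfolding W_def xs(1) by (auto simp: successively_append_iff)
      then show False using min[of "as @ [x]"] xs by simp
    qed
  qed
  moreover have "successively (\<lambda>x y. (x, y) \<in> A) xs"
    using suc by (rule successively_mono) (auto simp: avoiding_def)
  ultimately show thesis using W X dist that[of xs] by (auto simp: W_def)
qed

lemma set_subset_inner:
  assumes "xs \<noteq> []"
  shows "set xs \<subseteq> {hd xs, last xs} \<union> set (inner xs)"
proof (cases "tl xs = []")
  case True
  then show ?thesis using assms by (cases xs) auto
next
  case False
  have "set (tl xs) = insert (last (tl xs)) (set (butlast (tl xs)))"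
    by (metis False append_butlast_last_id list.simps(15) rotate1.simps(2) set_rotate1)
  then show ?thesis using assms False by (cases xs) (auto simp: inner_def)
qed

definition is_path :: "('v \<times> 'v) set \<Rightarrow> 'v list \<Rightarrow> bool" where
  "is_path A xs \<longleftrightarrow> xs \<noteq> [] \<and> distinct xs \<and> successively (\<lambda>x y. (x, y) \<in> A) xs"

lemma is_path_ends:
  assumes "is_path A xs"
  shows "v \<in> set (inner xs) \<Longrightarrow> v \<noteq> hd xs \<and> v \<noteq> last xs" "v \<in> set (butlast xs) \<Longrightarrow> v \<noteq> last xs"
proof -
  show "v \<noteq> hd xs \<and> v \<noteq> last xs" if inner: "v \<in> set (inner xs)"
  proof -
    obtain ys zs where "ys \<noteq> []" "zs \<noteq> []" "xs = ys @ v # zs" using inner set_inner_split by metis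
    then show ?thesis using assms hd_in_set[of ys] last_in_set[of zs] by (auto simp: is_path_def)
  qed
  show "v \<noteq> last xs" if "v \<in> set (butlast xs)"
  proof -
    have "distinct (butlast xs @ [last xs])" using assms by (simp add: is_path_def)
    then show ?thesis using that by auto
  qed
qed

lemma set_inner_subset: "set (inner xs) \<subseteq> set xs"
  by (auto simp: set_inner_split)

lemma inner_map_upt: "inner (map f [a..<Suc b]) = map f [Suc a..<b]"
proof (cases a b rule: linorder_cases)
  case less
  then have "[a..<Suc b] = a # [Suc a..<b] @ [b]" by (simp add: upt_conv_Cons)
  then show ?thesis by (simp add: inner_def butlast_append)
qed (simp_all add: inner_def)

lemma successively_imp_rtrancl:
  assumes "successively (\<lambda>x y. (x, y) \<in> A) xs" "xs \<noteq> []" "set xs \<inter> X = {}"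
  shows "(hd xs, last xs) \<in> (avoiding A X)\<^sup>*"
  using assms(2,1,3)
proof (induction xs rule: list_nonempty_induct)
  case (cons x xs)
  then have "hd xs \<notin> X" by (metis disjoint_iff hd_in_set list.set_intros(2))
  with cons have "(x, hd xs) \<in> avoiding A X" by (auto simp: successively_Cons avoiding_def)
  with cons show ?case by (auto simp: successively_Cons intro: converse_rtrancl_into_rtrancl)
qed simp

lemma disjoint_family_avoids_finite:
  assumes "finite X" "infinite I" "\<And>m n. m \<in> I \<Longrightarrow> n \<in> I \<Longrightarrow> m \<noteq> n \<Longrightarrow> S m \<inter> S n = {}"
  obtains n where "n \<in> I" "S n \<inter> X = {}"
proof (rule ccontr)
  assume "\<not> thesis"
  then have *: "\<forall>n\<in>I. \<exists>v. v \<in> S n \<and> v \<in> X" using that by blast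
  then obtain g where g: "\<forall>n\<in>I. g n \<in> S n \<and> g n \<in> X" by metis
  then have "inj_on g I" using assms(3) by (metis disjoint_iff inj_onI)
  then show False using g assms(1,2) by (metis finite_subset imageE inj_on_finite subsetI)
qed

lemma dipath_iff:
  "dipath V A xs \<longleftrightarrow> xs \<noteq> [] \<and> distinct xs \<and> set xs \<subseteq> V \<and> successively (\<lambda>x y. (x, y) \<in> A) xs"
  by (simp add: dipath_def successively_conv_nth)

lemma successively_subset:
  assumes "successively (\<lambda>x y. (x, y) \<in> A) xs" "A \<subseteq> V \<times> V" "hd xs \<in> V" "xs \<noteq> []"
  shows "set xs \<subseteq> V"
  using assms(4,1,3) by (induction xs rule: list_nonempty_induct) (use assms(2) in \<open>auto simp: successively_Cons\<close>)

text \<open>In one direction, a finite set cannot meet all of infinitely many disjoint dipaths. In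
  the other, dipaths are chosen one after another, each avoiding the vertices of all earlier ones. A
  common vertex of \<open>Q\<close> and \<open>R\<close> counts as a dipath of length 0.\<close>

lemma end_le_iff_tends:
  assumes A: "A \<subseteq> V \<times> V" and Q: "range (snd Q) \<subseteq> V"
  shows "end_le V A Q R \<longleftrightarrow> tends A (range (snd Q)) (range (snd R))"
proof
  assume "end_le V A Q R"
  then obtain P :: "nat \<Rightarrow> 'a list" where
    P: "\<And>n. linking_dipath V A (range (snd Q)) (range (snd R)) (P n)"
    and dj: "\<And>m n. m \<noteq> n \<Longrightarrow> set (P m) \<inter> set (P n) = {}" unfolding end_le_def by blast
  show "tends A (range (snd Q)) (range (snd R))"
    unfolding tends_def
  proof (intro allI impI)
    fix X :: "'a set" assume "finite X"
    then obtain n where n: "set (P n) \<inter> X = {}"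
      using disjoint_family_avoids_finite[of X "UNIV :: nat set" "\<lambda>n. set (P n)"] dj by auto
    have "hd (P n) \<in> range (snd Q)" "last (P n) \<in> range (snd R)" "P n \<noteq> []"
      "(hd (P n), last (P n)) \<in> (avoiding A X)\<^sup>*"
      using P[of n] successively_imp_rtrancl[of A "P n" X] n by (auto simp: linking_dipath_def dipath_iff)
    then show "\<exists>u\<in>range (snd Q). \<exists>v\<in>range (snd R). u \<notin> X \<and> (u, v) \<in> (avoiding A X)\<^sup>*"
      using n by (metis disjoint_iff hd_in_set)
  qed
next
  assume t: "tends A (range (snd Q)) (range (snd R))"
  define good where "good f n xs \<longleftrightarrow> linking_dipath V A (range (snd Q)) (range (snd R)) xs \<and>
    (\<forall>m<n. set (f m) \<inter> set xs = {})" for f :: "nat \<Rightarrow> 'a list" and n xs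
  have "\<exists>f. \<forall>n. good f n (f n)"
  proof (rule dependent_wf_choice[where R = less_than])
    fix n and f :: "nat \<Rightarrow> 'a list"
    have fin: "finite (\<Union>m<n. set (f m))" by auto
    obtain u v where uv: "u \<in> range (snd Q)" "v \<in> range (snd R)" "u \<notin> (\<Union>m<n. set (f m))"
        "(u, v) \<in> (avoiding A (\<Union>m<n. set (f m)))\<^sup>*"
      using tendsD[OF t fin] by metis
    obtain xs where xs: "xs \<noteq> []" "distinct xs" "successively (\<lambda>x y. (x, y) \<in> A) xs" "hd xs \<in> range (snd Q)"
      "last xs \<in> range (snd R)" "set xs \<inter> (\<Union>m<n. set (f m)) = {}"
      "set (inner xs) \<inter> (range (snd Q) \<union> range (snd R)) = {}"
      using shortest_linking[OF uv] .
    have "set xs \<subseteq> V" using successively_subset[OF xs(3) A _ xs(1)] xs(4) Q by blast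
    then have "good f n xs" using xs unfolding good_def linking_dipath_def dipath_iff by blast
    then show "\<exists>xs. good f n xs" ..
  qed (auto simp: good_def)
  then obtain f where f: "\<And>n. good f n (f n)" by auto
  have "set (f m) \<inter> set (f n) = {}" if "m \<noteq> n" for m n
  proof (cases "m < n")
    case True then show ?thesis using f[of n] by (auto simp: good_def)
  next
    case False
    then have "n < m" using that by simp
    then show ?thesis using f[of m] by (auto simp: good_def)
  qed
  then show "end_le V A Q R" unfolding end_le_def using f[unfolded good_def] by blast
qed

section \<open>Links between disjoint equivalent rays\<close>

text \<open>Two kinds of avoidance are combined: the other rays of \<open>F\<close> are avoided
  entirely, and on top of this \<open>tends\<close> allows any finite set to be avoided.\<close>

definition link :: "('v \<times> 'v) set \<Rightarrow> (nat \<Rightarrow> nat \<Rightarrow> 'v) \<Rightarrow> nat set \<Rightarrow> nat \<Rightarrow> nat \<Rightarrow> bool" where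
  "link A x F a b \<longleftrightarrow> tends (avoiding A (\<Union>c\<in>F - {a, b}. range (x c))) (range (x a)) (range (x b))"

lemma link_antimono: "link A x F' a b \<Longrightarrow> F \<subseteq> F' \<Longrightarrow> link A x F a b"
  unfolding link_def by (erule tends_mono[OF _ avoiding_mono]) auto

locale ray_family =
  fixes A :: "('v \<times> 'v) set" and x :: "nat \<Rightarrow> nat \<Rightarrow> 'v"
  assumes ray_inj: "x i m = x j n \<longleftrightarrow> i = j \<and> m = n"
    and ray_arc: "(x i n, x i (Suc n)) \<in> A"
    and ray_tends: "tends A (range (x i)) (range (x j))"
begin

lemma inj_ray: "inj (x i)"
  by (rule injI) (simp add: ray_inj)

text \<open>Once \<open>k\<close> is no longer among the avoided rays, it can serve as the
  intermediate ray of a transitivity step; by \<open>k \<notin> F\<close> it is disjoint from the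
  rays that are still avoided.\<close>

lemma link_bypass:
  assumes ak: "link A x (insert k F) a k" and kb: "link A x (insert k F) k b" and k: "k \<notin> F"
  shows "link A x F a b"
proof -
  let ?B = "avoiding A (\<Union>c\<in>F - {a, b}. range (x c))"
  have "tends ?B (range (x a)) (range (x k))"
    using ak k unfolding link_def by (elim tends_mono[OF _ avoiding_mono]) auto
  moreover have "tends ?B (range (x k)) (range (x b))"
    using kb k unfolding link_def by (elim tends_mono[OF _ avoiding_mono]) auto
  moreover have "(x k n, x k (Suc n)) \<in> ?B" for n
    using k ray_arc by (auto simp: avoiding_def ray_inj)
  ultimately show ?thesis unfolding link_def by (rule tends_trans_ray[OF _ _ inj_ray])
qed

text \<open>This is strong connectivity, expressed by cuts. If there were no such link, every pair
  would have a finite separator. A shortest walk from the rays of \<open>S\<close> to those of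
  \<open>F - S\<close> outside the union of these separators meets the rays of \<open>F\<close> only
  in its two ends, so it contradicts the separator of the two rays on which it begins and
  ends.\<close>

lemma link_cut:
  assumes F: "finite F" and S: "S \<subseteq> F" "S \<noteq> {}" "S \<noteq> F"
  shows "\<exists>a\<in>S. \<exists>b\<in>F - S. link A x F a b"
proof (rule ccontr)
  assume neg: "\<not> (\<exists>a\<in>S. \<exists>b\<in>F - S. link A x F a b)"
  let ?Y = "\<lambda>a b. \<Union>c\<in>F - {a, b}. range (x c)"
  have "\<exists>X. finite X \<and>
    (\<forall>u\<in>range (x a). \<forall>v\<in>range (x b). u \<notin> X \<longrightarrow> (u, v) \<notin> (avoiding A (?Y a b \<union> X))\<^sup>*)"
    if "a \<in> S" "b \<in> F - S" for a b
  proof -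
    have "\<not> link A x F a b" using neg that by blast
    then show ?thesis unfolding link_def tends_def avoiding_avoiding by blast
  qed
  then obtain X where X: "\<And>a b. a \<in> S \<Longrightarrow> b \<in> F - S \<Longrightarrow> finite (X a b)"
    "\<And>a b u v. a \<in> S \<Longrightarrow> b \<in> F - S \<Longrightarrow> u \<in> range (x a) \<Longrightarrow> v \<in> range (x b) \<Longrightarrow> u \<notin> X a b \<Longrightarrow>
      (u, v) \<notin> (avoiding A (?Y a b \<union> X a b))\<^sup>*" by metis
  define Z where "Z = (\<Union>a\<in>S. \<Union>b\<in>F - S. X a b)"
  have fin: "finite Z" unfolding Z_def
    by (intro finite_UN_I) (use X(1) F finite_subset[OF S(1) F] in auto)
  obtain a0 b0 where "a0 \<in> S" "b0 \<in> F - S" using S by auto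
  moreover obtain u v where uv: "u \<in> range (x a0)" "v \<in> range (x b0)" "u \<notin> Z" "(u, v) \<in> (avoiding A Z)\<^sup>*"
    using tendsD[OF ray_tends fin] by metis
  ultimately have "u \<in> (\<Union>a\<in>S. range (x a))" "v \<in> (\<Union>b\<in>F - S. range (x b))" by blast+
  note uv' = this uv(3,4)
  obtain xs where xs: "xs \<noteq> []" "successively (\<lambda>x y. (x, y) \<in> A) xs"
      "hd xs \<in> (\<Union>a\<in>S. range (x a))" "last xs \<in> (\<Union>b\<in>F - S. range (x b))" "set xs \<inter> Z = {}"
      "set (inner xs) \<inter> ((\<Union>a\<in>S. range (x a)) \<union> (\<Union>b\<in>F - S. range (x b))) = {}"
    using shortest_linking[OF uv'] by metis
  then obtain a b where ab: "a \<in> S" "b \<in> F - S" "hd xs \<in> range (x a)" "last xs \<in> range (x b)" by auto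
  have sub: "set xs \<subseteq> {hd xs, last xs} \<union> set (inner xs)" using xs(1) by (rule set_subset_inner)
  have "set xs \<inter> ?Y a b = {}"
  proof -
    have "hd xs \<notin> ?Y a b" "last xs \<notin> ?Y a b" using ab(3,4) by (auto simp: ray_inj)
    moreover have "set (inner xs) \<inter> ?Y a b = {}" using xs(6) by blast
    moreover have "v = hd xs \<or> v = last xs \<or> v \<in> set (inner xs)" if "v \<in> set xs" for v
      using sub that by auto
    ultimately show ?thesis by (metis (no_types, lifting) disjoint_iff)
  qed
  moreover have Xab: "set xs \<inter> X a b = {}" using xs(5) ab(1,2) unfolding Z_def by blast
  ultimately have "set xs \<inter> (?Y a b \<union> X a b) = {}" by (simp add: Int_Un_distrib)
  from successively_imp_rtrancl[OF xs(2,1) this] X(2)[OF ab] show False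
    using Xab hd_in_set[OF xs(1)] by (simp add: disjoint_iff)
qed

end

section \<open>Ramsey's theorem for the link pattern of finite sets of rays\<close>

lemma Ramsey_finite_colours:
  assumes "infinite Z" "finite C" "\<And>X. X \<subseteq> Z \<Longrightarrow> finite X \<Longrightarrow> card X = r \<Longrightarrow> c X \<in> C"
  obtains Y t where "Y \<subseteq> Z" "infinite Y" "\<And>X. X \<subseteq> Y \<Longrightarrow> finite X \<Longrightarrow> card X = r \<Longrightarrow> c X = t"
proof -
  obtain h where h: "bij_betw h C {0..<card C}" using ex_bij_betw_finite_nat[OF assms(2)] by blast
  have "\<forall>X. X \<subseteq> Z \<and> finite X \<and> card X = r \<longrightarrow> (h \<circ> c) X < card C"
    using assms(3) bij_betwE[OF h] by auto
  from Ramsey[OF assms(1) this] obtain Y t where Y: "Y \<subseteq> Z" "infinite Y"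
    "\<And>X. X \<subseteq> Y \<Longrightarrow> finite X \<Longrightarrow> card X = r \<Longrightarrow> h (c X) = t" by auto
  have "c X = inv_into C h t" if "X \<subseteq> Y" "finite X" "card X = r" for X
    using Y that assms(3)[of X] bij_betw_inv_into_left[OF h, of "c X"] by auto
  with Y that show thesis by blast
qed

text \<open>Ramsey's theorem is applied to the sizes 0, 1, 2, ... along a decreasing chain of
  infinite sets \<open>Y n\<close>, and \<open>y n\<close> is taken from \<open>Y n\<close>. So for
  size \<open>n\<close> homogeneity is known only from index \<open>n\<close> on. This is the origin
  of the condition that sets of \<open>n\<close> lanes have indices at least
  \<open>n\<close>.\<close>

lemma diagonal_Ramsey:
  fixes c :: "nat set \<Rightarrow> 'c"
  assumes "\<And>n. finite (C n)" "\<And>X. finite X \<Longrightarrow> c X \<in> C (card X)"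
  obtains y :: "nat \<Rightarrow> nat" and t
  where "strict_mono y" "\<And>X. X \<subseteq> y ` {card X..} \<Longrightarrow> finite X \<Longrightarrow> c X = t (card X)"
proof -
  define hom where "hom n Y \<longleftrightarrow> infinite Y \<and> (\<exists>t. \<forall>X. X \<subseteq> Y \<longrightarrow> finite X \<longrightarrow> card X = n \<longrightarrow> c X = t)"
    for n and Y :: "nat set"
  have step: "\<exists>Y. hom n Y \<and> Y \<subseteq> Z" if "infinite Z" for n and Z :: "nat set"
    using Ramsey_finite_colours[of Z "C n" n c] that assms unfolding hom_def by metis
  have "\<exists>Y. \<forall>n. hom n (Y n) \<and> Y (Suc n) \<subseteq> Y n"
    by (rule dependent_nat_choice) (use step in \<open>auto simp: hom_def\<close>)
  then obtain Y where Y: "\<And>n. hom n (Y n)" "\<And>n. Y (Suc n) \<subseteq> Y n" by blast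
  have "\<exists>y. \<forall>n. y n \<in> Y n \<and> y n < y (Suc n)"
  proof (rule dependent_nat_choice)
    show "\<exists>x. x \<in> Y 0" using Y(1)[of 0] by (metis ex_in_conv finite.emptyI hom_def)
    fix x n
    have "infinite (Y (Suc n))" using Y(1) by (simp add: hom_def)
    then show "\<exists>y. y \<in> Y (Suc n) \<and> x < y" by (meson infinite_nat_iff_unbounded)
  qed
  then obtain y where y: "\<And>n. y n \<in> Y n" "\<And>n. y n < y (Suc n)" by blast
  obtain t where t: "\<And>n X. X \<subseteq> Y n \<Longrightarrow> finite X \<Longrightarrow> card X = n \<Longrightarrow> c X = t n"
    using Y(1) unfolding hom_def by metis
  have "Y m \<subseteq> Y n" if "n \<le> m" for m n using lift_Suc_antimono_le[of Y, OF Y(2)] that by blast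
  then have "y ` {n..} \<subseteq> Y n" for n using y(1) by blast
  then have "c X = t (card X)" if "X \<subseteq> y ` {card X..}" "finite X" for X
    using t[of X "card X"] that by blast
  moreover have "strict_mono y" using y(2) by (simp add: strict_mono_Suc_iff)
  ultimately show thesis using that by blast
qed

text \<open>\<open>E n i j\<close> tells whether \<open>Q\<close> relates the \<open>i\<close>-th to the \<open>j\<close>-th element of an \<open>n\<close>-element subset of
  \<open>{y m | m. n \<le> m}\<close>.\<close>
definition uniform_on :: "(nat set \<Rightarrow> nat \<Rightarrow> nat \<Rightarrow> bool) \<Rightarrow> (nat \<Rightarrow> nat) \<Rightarrow> (nat \<Rightarrow> nat \<Rightarrow> nat \<Rightarrow> bool) \<Rightarrow> bool" where
  "uniform_on Q y E \<longleftrightarrow> strict_mono y \<and> (\<forall>n g i j. strict_mono_on {..<n} g \<longrightarrow> (\<forall>i<n. n \<le> g i) \<longrightarrow>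
    i < n \<longrightarrow> j < n \<longrightarrow> Q ((\<lambda>i. y (g i)) ` {..<n}) (y (g i)) (y (g j)) = E n i j)"

text \<open>The colour of a finite set is its whole relation, recorded by ranks; for
  \<open>n\<close> elements it is a subset of \<open>{..<n} \<times> {..<n}\<close>, so there are
  finitely many colours.\<close>

lemma ex_uniform_on: "\<exists>y E. uniform_on Q y E"
proof -
  define c where "c X = {(i, j). i < card X \<and> j < card X \<and>
    Q X (sorted_list_of_set X ! i) (sorted_list_of_set X ! j)}" for X
  obtain y :: "nat \<Rightarrow> nat" and t where y: "strict_mono y"
    and t: "\<And>X. X \<subseteq> y ` {card X..} \<Longrightarrow> finite X \<Longrightarrow> c X = t (card X)"
    by (rule diagonal_Ramsey[of "\<lambda>n. Pow ({..<n} \<times> {..<n})" c]) (auto simp: c_def)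
  have "uniform_on Q y (\<lambda>n i j. (i, j) \<in> t n)"
    unfolding uniform_on_def
  proof (intro conjI allI impI y)
    fix n i j :: nat and g :: "nat \<Rightarrow> nat"
    assume g: "strict_mono_on {..<n} g" "\<forall>i<n. n \<le> g i" and ij: "i < n" "j < n"
    let ?X = "(\<lambda>i. y (g i)) ` {..<n}"
    have mono: "y (g a) < y (g b)" if "a < b" "b < n" for a b
      using that g(1) y by (auto simp: strict_mono_on_def strict_mono_def)
    have "inj_on (\<lambda>i. y (g i)) {..<n}"
      using mono by (metis (mono_tags, lifting) inj_onI lessThan_iff less_irrefl linorder_neqE_nat)
    then have card: "card ?X = n" by (simp add: card_image)
    have "sorted_wrt (<) (map (\<lambda>i. y (g i)) [0..<n])"
      using mono by (auto simp: sorted_wrt_iff_nth_less)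
    then have sl: "sorted_list_of_set ?X = map (\<lambda>i. y (g i)) [0..<n]"
      by (metis atLeast_upt list.set_map strict_sorted_iff sorted_list_of_set.idem_if_sorted_distinct)
    have "?X \<subseteq> y ` {card ?X..}" unfolding card using g(2) by auto
    then have "c ?X = t n" using t[of ?X] card by simp
    moreover have "(i, j) \<in> c ?X \<longleftrightarrow> Q ?X (y (g i)) (y (g j))"
      unfolding c_def card sl using ij by simp
    ultimately show "Q ?X (y (g i)) (y (g j)) = ((i, j) \<in> t n)" by simp
  qed
  then show ?thesis by blast
qed

section \<open>Combinatorics of a homogeneous link relation on ranks\<close>

definition skip :: "nat \<Rightarrow> nat \<Rightarrow> nat" where
  "skip k i = (if i < k then i else Suc i)"

text \<open>What remains of \<open>link\<close> after Ramsey's theorem: \<open>E n i j\<close>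
  speaks of ranks in an \<open>n\<close>-element set. Deleting the element of rank \<open>k\<close>
  renumbers the others, and \<open>skip k\<close> undoes the renumbering. The three assumptions come
  from \<open>link_antimono\<close>, \<open>link_bypass\<close> and \<open>link_cut\<close>.\<close>

locale uniform_type =
  fixes E :: "nat \<Rightarrow> nat \<Rightarrow> nat \<Rightarrow> bool"
  assumes remove: "E (Suc n) (skip k i) (skip k j) \<Longrightarrow> k \<le> n \<Longrightarrow> i < n \<Longrightarrow> j < n \<Longrightarrow> E n i j"
    and bypass: "E (Suc n) (skip k i) k \<Longrightarrow> E (Suc n) k (skip k j) \<Longrightarrow> k \<le> n \<Longrightarrow> i < n \<Longrightarrow> j < n \<Longrightarrow> E n i j"
    and cut: "S \<subseteq> {..<n} \<Longrightarrow> S \<noteq> {} \<Longrightarrow> S \<noteq> {..<n} \<Longrightarrow> \<exists>i\<in>S. \<exists>j\<in>{..<n} - S. E n i j"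
begin

text \<open>The arguments count the elements below, between and above the two endpoints.\<close>
definition fwd :: "nat \<Rightarrow> nat \<Rightarrow> nat \<Rightarrow> bool" where
  "fwd p q s \<longleftrightarrow> E (p + q + s + 2) p (p + q + 1)"

definition bwd :: "nat \<Rightarrow> nat \<Rightarrow> nat \<Rightarrow> bool" where
  "bwd p q s \<longleftrightarrow> E (p + q + s + 2) (p + q + 1) p"

lemma fwd_antimono:
  assumes "fwd p q s" "p' \<le> p" "q' \<le> q" "s' \<le> s"
  shows "fwd p' q' s'"
proof -
  have 1: "fwd p q s" if "fwd (Suc p) q s" for p q s
    using that remove[of "p + q + s + 2" 0 p "p + q + 1"] by (simp add: fwd_def skip_def)
  have 2: "fwd p q s" if "fwd p (Suc q) s" for p q s
    using that remove[of "p + q + s + 2" "Suc p" p "p + q + 1"] by (simp add: fwd_def skip_def)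
  have 3: "fwd p q s" if "fwd p q (Suc s)" for p q s
    using that remove[of "p + q + s + 2" "p + q + s + 2" p "p + q + 1"] by (simp add: fwd_def skip_def)
  have "fwd p' q s" using assms(2,1) by (induction p rule: dec_induct) (auto dest: 1)
  with assms(3) have "fwd p' q' s" by (induction q rule: dec_induct) (auto dest: 2)
  with assms(4) show ?thesis by (induction s rule: dec_induct) (auto dest: 3)
qed

lemma bwd_antimono:
  assumes "bwd p q s" "p' \<le> p" "q' \<le> q" "s' \<le> s"
  shows "bwd p' q' s'"
proof -
  have 1: "bwd p q s" if "bwd (Suc p) q s" for p q s
    using that remove[of "p + q + s + 2" 0 "p + q + 1" p] by (simp add: bwd_def skip_def)
  have 2: "bwd p q s" if "bwd p (Suc q) s" for p q s
    using that remove[of "p + q + s + 2" "Suc p" "p + q + 1" p] by (simp add: bwd_def skip_def)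
  have 3: "bwd p q s" if "bwd p q (Suc s)" for p q s
    using that remove[of "p + q + s + 2" "p + q + s + 2" "p + q + 1" p] by (simp add: bwd_def skip_def)
  have "bwd p' q s" using assms(2,1) by (induction p rule: dec_induct) (auto dest: 1)
  with assms(3) have "bwd p' q' s" by (induction q rule: dec_induct) (auto dest: 2)
  with assms(4) show ?thesis by (induction s rule: dec_induct) (auto dest: 3)
qed

lemma fwdI:
  assumes "E n i j" "i < j" "j < n"
  shows "fwd i (j - i - 1) (n - 1 - j)"
proof -
  have "i + (j - i - 1) + (n - 1 - j) + 2 = n" "i + (j - i - 1) + 1 = j" using assms by auto
  then show ?thesis using assms(1) unfolding fwd_def by (simp only:)
qed

lemma bwdI:
  assumes "E n j i" "i < j" "j < n"
  shows "bwd i (j - i - 1) (n - 1 - j)"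
proof -
  have "i + (j - i - 1) + (n - 1 - j) + 2 = n" "i + (j - i - 1) + 1 = j" using assms by auto
  then show ?thesis using assms(1) unfolding bwd_def by (simp only:)
qed

text \<open>Cutting a set into two halves of size \<open>q + M + 1\<close> gives a link from the
  lower to the upper half. If it had at least \<open>p\<close> elements below and \<open>s\<close>
  above, \<open>fwd_antimono\<close> would yield the excluded link. So one endpoint is near an end
  of the set, and at least \<open>q\<close> elements lie between the two. Deleting the outer
  elements leaves a link from minimum to maximum.\<close>

lemma min_to_max:
  assumes "\<not> fwd p 0 s"
  shows "fwd 0 q 0"
proof -
  define M where "M = max p s"
  obtain i j where ij: "i < q + M + 1" "q + M + 1 \<le> j" "j < 2 * (q + M + 1)" "E (2 * (q + M + 1)) i j"
  proof -
    have "\<exists>i\<in>{..<q + M + 1}. \<exists>j\<in>{..<2 * (q + M + 1)} - {..<q + M + 1}. E (2 * (q + M + 1)) i j"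
      by (rule cut) auto
    then show thesis using that by auto
  qed
  have f: "fwd i (j - i - 1) (2 * (q + M + 1) - 1 - j)" using ij by (intro fwdI) auto
  have "\<not> (p \<le> i \<and> s \<le> 2 * (q + M + 1) - 1 - j)"
    using fwd_antimono[OF f, of p 0 s] assms by auto
  then have "q \<le> j - i - 1" using ij unfolding M_def by auto
  then show ?thesis using fwd_antimono[OF f, of 0 q 0] by simp
qed

lemma max_to_min:
  assumes "\<not> bwd p 0 s"
  shows "bwd 0 q 0"
proof -
  define M where "M = max p s"
  obtain i j where ij: "i < q + M + 1" "q + M + 1 \<le> j" "j < 2 * (q + M + 1)" "E (2 * (q + M + 1)) j i"
  proof -
    have "\<exists>j\<in>{q + M + 1..<2 * (q + M + 1)}. \<exists>i\<in>{..<2 * (q + M + 1)} - {q + M + 1..<2 * (q + M + 1)}.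
        E (2 * (q + M + 1)) j i"
    proof (rule cut)
      have "0 \<notin> {q + M + 1..<2 * (q + M + 1)}" "0 \<in> {..<2 * (q + M + 1)}" by auto
      then show "{q + M + 1..<2 * (q + M + 1)} \<noteq> {..<2 * (q + M + 1)}" by blast
    qed auto
    then obtain j i where "q + M + 1 \<le> j" "j < 2 * (q + M + 1)" "i < q + M + 1" "E (2 * (q + M + 1)) j i"
      by (auto simp: not_le)
    then show thesis using that[of i j] by simp
  qed
  have f: "bwd i (j - i - 1) (2 * (q + M + 1) - 1 - j)" using ij by (intro bwdI) auto
  have "\<not> (p \<le> i \<and> s \<le> 2 * (q + M + 1) - 1 - j)"
    using bwd_antimono[OF f, of p 0 s] assms by auto
  then have "q \<le> j - i - 1" using ij unfolding M_def by auto
  then show ?thesis using bwd_antimono[OF f, of 0 q 0] by simp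
qed

text \<open>If both fail, there is no link with at least \<open>M\<close> elements below its lower
  and at least \<open>M\<close> above its upper endpoint. The links of a middle element therefore
  end near the bottom or the top. With \<open>min_to_max\<close> and \<open>max_to_min\<close> this
  forces all elements to be linked to and from the maximum, and passing through the maximum gives
  the excluded consecutive link.\<close>

lemma consecutive_cases: "(\<forall>p s. fwd p 0 s) \<or> (\<forall>p s. bwd p 0 s)"
proof (rule ccontr)
  assume "\<not> ?thesis"
  then obtain p0 s0 p1 s1 where nf: "\<not> fwd p0 0 s0" and nb: "\<not> bwd p1 0 s1" by auto
  define M where "M = max (max p0 s0) (max p1 s1)"
  have nf': "\<not> fwd p q s" if "M \<le> p" "M \<le> s" for p q s
    using nf fwd_antimono[of p q s p0 0 s0] that unfolding M_def by auto
  have nb': "\<not> bwd p q s" if "M \<le> p" "M \<le> s" for p q s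
    using nb bwd_antimono[of p q s p1 0 s1] that unfolding M_def by auto
  have to_max: "fwd p q 0" for p q
  proof -
    \<comment> \<open>\<open>N\<close> is the rank of the middle of \<open>2 * N + 1\<close>
      elements; a link from it to one of the \<open>M\<close> outermost elements on either side
      leaves more than \<open>p + q\<close> elements between.\<close>
    define N where "N = p + q + M + 1"
    obtain j where j: "j \<noteq> N" "j < 2 * N + 1" "E (2 * N + 1) N j"
      using cut[of "{N}" "2 * N + 1"] N_def by fastforce
    show ?thesis
    proof (cases "N < j")
      case True
      have f: "fwd N (j - N - 1) (2 * N - j)" using fwdI[OF j(3) True j(2)] by simp
      then have "2 * N - j < M" using nf'[of N "2 * N - j"] by (fastforce simp: N_def)
      then show ?thesis using fwd_antimono[OF f, of p q 0] j(2) by (simp add: N_def)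
    next
      case False
      then have f: "bwd j (N - j - 1) N" using bwdI[of "2 * N + 1" N j] j by auto
      then have "j < M" using nb'[of j N] by (fastforce simp: N_def)
      \<comment> \<open>The element of rank \<open>p + 1\<close> is linked to the minimum, and the
        minimum to the maximum. Deleting the minimum turns this into a link from rank
        \<open>p\<close> to the maximum.\<close>
      then have "bwd 0 p (q + 1)" using bwd_antimono[OF f, of 0 p "q + 1"] by (simp add: N_def)
      with min_to_max[OF nf, of "p + q + 1"] show ?thesis
        using bypass[of "p + q + 2" 0 p "p + q + 1"] by (simp add: fwd_def bwd_def skip_def)
    qed
  qed
  have from_max: "bwd p q 0" for p q
  proof -
    define N where "N = p + q + M + 1"
    obtain j where j: "j \<noteq> N" "j < 2 * N + 1" "E (2 * N + 1) j N"
      using cut[of "{..<2 * N + 1} - {N}" "2 * N + 1"] N_def by fastforce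
    show ?thesis
    proof (cases "N < j")
      case True
      have f: "bwd N (j - N - 1) (2 * N - j)" using bwdI[OF j(3) True j(2)] by simp
      then have "2 * N - j < M" using nb'[of N "2 * N - j"] by (fastforce simp: N_def)
      then show ?thesis using bwd_antimono[OF f, of p q 0] j(2) by (simp add: N_def)
    next
      case False
      then have f: "fwd j (N - j - 1) N" using fwdI[of "2 * N + 1" j N] j by auto
      then have "j < M" using nf'[of j N] by (fastforce simp: N_def)
      then have "fwd 0 p (q + 1)" using fwd_antimono[OF f, of 0 p "q + 1"] by (simp add: N_def)
      with max_to_min[OF nb, of "p + q + 1"] show ?thesis
        using bypass[of "p + q + 2" 0 "p + q + 1" p] by (simp add: fwd_def bwd_def skip_def)
    qed
  qed
  have "fwd p0 0 s0"
    using to_max[of p0 "s0 + 1"] from_max[of "p0 + 1" s0]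
      bypass[of "p0 + s0 + 2" "p0 + s0 + 2" p0 "p0 + 1"] by (simp add: fwd_def bwd_def skip_def)
  with nf show False by contradiction
qed

end

section \<open>A sequence of lanes\<close>

lemma strict_mono_on_skip: "strict_mono_on A (skip k)"
  by (auto simp: strict_mono_on_def skip_def)

lemma skip_image: "k \<le> n \<Longrightarrow> insert k (skip k ` {..<n}) = {..<Suc n}"
proof (rule set_eqI)
  fix i assume "k \<le> n"
  show "i \<in> insert k (skip k ` {..<n}) \<longleftrightarrow> i \<in> {..<Suc n}"
  proof (cases i k rule: linorder_cases)
    case less
    then have "i = skip k i" by (simp add: skip_def)
    then show ?thesis using less \<open>k \<le> n\<close> by (metis imageI insertI2 lessThan_iff less_SucI less_le_trans)
  next
    case greater
    then have "i = skip k (i - 1)" by (auto simp: skip_def)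
    moreover have "i - 1 < n \<longleftrightarrow> i < Suc n" using greater by auto
    moreover have "j < n" if "i = skip k j" "i < Suc n" for j using that greater by (auto simp: skip_def split: if_splits)
    moreover have "i < Suc n" if "i = skip k j" "j < n" for j using that by (auto simp: skip_def split: if_splits)
    ultimately show ?thesis using greater by (metis image_iff insert_iff lessThan_iff less_irrefl)
  qed (use \<open>k \<le> n\<close> in simp)
qed

lemma (in ray_family) ex_uniform_type:
  obtains y E where "uniform_on (link A x) y E" "uniform_type E"
proof -
  obtain y E where yE: "uniform_on (link A x) y E" using ex_uniform_on by blast
  then have y: "strict_mono y"
    and E: "\<And>n g i j. strict_mono_on {..<n} g \<Longrightarrow> (\<And>i. i < n \<Longrightarrow> n \<le> g i) \<Longrightarrow> i < n \<Longrightarrow> j < n \<Longrightarrow>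
      link A x ((\<lambda>i. y (g i)) ` {..<n}) (y (g i)) (y (g j)) = E n i j"
    unfolding uniform_on_def by simp_all
  have inj: "y a = y b \<longleftrightarrow> a = b" for a b using y by (simp add: strict_mono_eq)
  have full: "link A x ((\<lambda>i. y (i + n)) ` {..<n}) (y (i + n)) (y (j + n)) = E n i j"
    if "i < n" "j < n" for n i j
    using E[of n "\<lambda>i. i + n" i j] that by (simp add: strict_mono_on_def)
  \<comment> \<open>The shift is \<open>Suc n\<close> for only \<open>n\<close> elements, so that
    this is the set of \<open>full\<close> for \<open>Suc n\<close> without its element of rank
    \<open>k\<close>. Its indices are still at least \<open>n\<close>, so the type
    \<open>E n\<close> applies to it.\<close>
  have sub: "link A x ((\<lambda>i. y (skip k i + Suc n)) ` {..<n}) (y (skip k i + Suc n)) (y (skip k j + Suc n)) = E n i j"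
    if "i < n" "j < n" for n i j k
    using E[of n "\<lambda>i. skip k i + Suc n" i j] that strict_mono_on_skip[of UNIV k]
    by (simp add: strict_mono_on_def)
  have img: "insert (y (k + Suc n)) ((\<lambda>i. y (skip k i + Suc n)) ` {..<n}) = (\<lambda>i. y (i + Suc n)) ` {..<Suc n}"
    if "k \<le> n" for k n
    unfolding skip_image[OF that, symmetric] by (simp add: image_image)
  have notin: "y (k + Suc n) \<notin> (\<lambda>i. y (skip k i + Suc n)) ` {..<n}" for k n
    by (auto simp: inj skip_def split: if_splits)
  have lt: "skip k i < Suc n" if "i < n" for k i n using that by (auto simp: skip_def)
  have "uniform_type E"
  proof
    fix n k i j assume *: "E (Suc n) (skip k i) (skip k j)" "k \<le> n" "i < n" "j < n"
    have "link A x ((\<lambda>i. y (i + Suc n)) ` {..<Suc n}) (y (skip k i + Suc n)) (y (skip k j + Suc n))"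
      using full[of "skip k i" "Suc n" "skip k j"] lt * by simp
    from link_antimono[OF this] img[OF *(2)] show "E n i j"
      using sub[of i n j k] *(3,4) by blast
  next
    fix n k i j assume *: "E (Suc n) (skip k i) k" "E (Suc n) k (skip k j)" "k \<le> n" "i < n" "j < n"
    have 1: "link A x ((\<lambda>i. y (i + Suc n)) ` {..<Suc n}) (y (skip k i + Suc n)) (y (k + Suc n))"
      using full[of "skip k i" "Suc n" k] lt[OF *(4)] * by simp
    have 2: "link A x ((\<lambda>i. y (i + Suc n)) ` {..<Suc n}) (y (k + Suc n)) (y (skip k j + Suc n))"
      using full[of k "Suc n" "skip k j"] lt[OF *(5)] * by simp
    show "E n i j"
      using link_bypass[OF 1[folded img[OF *(3)]] 2[folded img[OF *(3)]] notin] sub[OF *(4,5)] by simp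
  next
    fix n and S :: "nat set" assume S: "S \<subseteq> {..<n}" "S \<noteq> {}" "S \<noteq> {..<n}"
    let ?f = "\<lambda>i. y (i + n)"
    have injf: "inj_on ?f {..<n}" by (auto simp: inj_on_def inj)
    have "\<exists>a\<in>?f ` S. \<exists>b\<in>?f ` {..<n} - ?f ` S. link A x (?f ` {..<n}) a b"
      using S injf by (intro link_cut) (auto simp: inj_on_image_eq_iff)
    moreover have "?f ` {..<n} - ?f ` S = ?f ` ({..<n} - S)"
      using inj_on_image_set_diff[OF injf, of "{..<n}" S] S(1) by auto
    ultimately obtain i j where "i \<in> S" "j \<in> {..<n} - S" "link A x (?f ` {..<n}) (?f i) (?f j)" by auto
    then show "\<exists>i\<in>S. \<exists>j\<in>{..<n} - S. E n i j" using full[of i n j] S(1) by auto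
  qed
  with yE show thesis by (rule that)
qed

text \<open>The sequence of lanes \<open>z\<close> along which all rows of the grid move simultaneously.\<close>
definition lane_sequence :: "('v \<times> 'v) set \<Rightarrow> (nat \<Rightarrow> nat \<Rightarrow> 'v) \<Rightarrow> (nat \<Rightarrow> nat) \<Rightarrow> (nat \<Rightarrow> nat) \<Rightarrow> bool" where
  "lane_sequence A x z k \<longleftrightarrow> mono k \<and> (\<forall>n. \<exists>t. n \<le> k t) \<and> (\<forall>t. inj_on z {t..t + k t} \<and>
    (\<forall>s. t \<le> s \<longrightarrow> s < t + k t \<longrightarrow> link A x (z ` {t..t + k t}) (z s) (z (Suc s))))"

text \<open>If all consecutive forward links exist, the lanes are taken in increasing order.
  Otherwise they decrease in blocks, and \<open>min_to_max\<close> supplies the jump from the end of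
  one block to the start of the next.\<close>

lemma (in ray_family) ex_lane_sequence:
  obtains z k where "lane_sequence A x z k"
proof -
  obtain y E where yE: "uniform_on (link A x) y E" and "uniform_type E" using ex_uniform_type .
  then interpret uniform_type E by simp
  have y: "strict_mono y" and E: "\<And>n g i j. strict_mono_on {..<n} g \<Longrightarrow> (\<And>i. i < n \<Longrightarrow> n \<le> g i) \<Longrightarrow> i < n \<Longrightarrow> j < n \<Longrightarrow>
      link A x ((\<lambda>i. y (g i)) ` {..<n}) (y (g i)) (y (g j)) = E n i j"
    using yE unfolding uniform_on_def by simp_all
  \<comment> \<open>\<open>g\<close> lists the lanes of the window in increasing order, and
    \<open>\<rho> i\<close> is the rank of the lane used at time \<open>t + i\<close>. A window of
    \<open>n\<close> lanes has \<open>n - 1\<close> links, hence the bound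
    \<open>n - 1\<close>.\<close>
  have window: "inj_on (\<lambda>s. y (z s)) {t..t + (n - 1)} \<and> (\<forall>s. t \<le> s \<longrightarrow> s < t + (n - 1) \<longrightarrow>
      link A x ((\<lambda>s. y (z s)) ` {t..t + (n - 1)}) (y (z s)) (y (z (Suc s))))"
    if g: "strict_mono_on {..<n} g" "\<And>i. i < n \<Longrightarrow> n \<le> g i"
      and \<rho>: "bij_betw \<rho> {..<n} {..<n}" "\<And>i. i < n \<Longrightarrow> z (t + i) = g (\<rho> i)"
      and El: "\<And>i. Suc i < n \<Longrightarrow> E n (\<rho> i) (\<rho> (Suc i))"
    for n t z and g \<rho> :: "nat \<Rightarrow> nat"
  proof (cases "n = 0")
    case False
    have set: "{t..t + (n - 1)} = (\<lambda>i. t + i) ` {..<n}"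
    proof -
      have "{t..t + (n - 1)} = {t..<t + n}" using False by auto
      then show ?thesis by (metis add.commute add_0 image_add_atLeastLessThan lessThan_atLeast0)
    qed
    have lt: "\<rho> i < n" if "i < n" for i using bij_betwE[OF \<rho>(1)] that by auto
    have "inj_on (\<lambda>i. y (z (t + i))) {..<n}"
    proof (rule inj_onI)
      fix i j assume ij: "i \<in> {..<n}" "j \<in> {..<n}" "y (z (t + i)) = y (z (t + j))"
      then have "g (\<rho> i) = g (\<rho> j)" using \<rho>(2) y by (simp add: strict_mono_eq)
      then have "\<rho> i = \<rho> j" using g(1) lt ij by (metis lessThan_iff strict_mono_on_eqD)
      then show "i = j" using bij_betw_imp_inj_on[OF \<rho>(1)] ij by (simp add: inj_on_def)
    qed
    then have 1: "inj_on (\<lambda>s. y (z s)) {t..t + (n - 1)}" unfolding set by (auto simp: inj_on_def)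
    have "(\<lambda>s. y (z s)) ` {t..t + (n - 1)} = (\<lambda>i. y (g (\<rho> i))) ` {..<n}"
      unfolding set image_image using \<rho>(2) by simp
    also have "\<dots> = (\<lambda>i. y (g i)) ` \<rho> ` {..<n}" by (simp add: image_image)
    finally have 2: "(\<lambda>s. y (z s)) ` {t..t + (n - 1)} = (\<lambda>i. y (g i)) ` {..<n}"
      using bij_betw_imp_surj_on[OF \<rho>(1)] by simp
    have "link A x ((\<lambda>i. y (g i)) ` {..<n}) (y (z s)) (y (z (Suc s)))" if "t \<le> s" "s < t + (n - 1)" for s
    proof -
      define i where "i = s - t"
      have i: "s = t + i" "Suc i < n" using that i_def by auto
      have "z s = g (\<rho> i)" "z (Suc s) = g (\<rho> (Suc i))"
        using \<rho>(2)[of i] \<rho>(2)[of "Suc i"] i by auto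
      then show ?thesis using E[of n g "\<rho> i" "\<rho> (Suc i)"] g El i lt by simp
    qed
    then show ?thesis unfolding 2 using 1 by blast
  qed simp
  show thesis
  proof (cases "\<forall>p s. fwd p 0 s")
    case True
    \<comment> \<open>For \<open>t > 0\<close> the window consists of the \<open>t\<close> lanes
      with indices \<open>t\<close> to \<open>2 * t - 1\<close>, the widest one beginning at
      \<open>t\<close> whose size does not exceed its smallest index.\<close>
    have "lane_sequence A x (\<lambda>s. y s) (\<lambda>t. t - 1)"
      unfolding lane_sequence_def
    proof (intro conjI allI[of "\<lambda>t. inj_on _ _ \<and> _ t" for t])
      show "mono (\<lambda>t::nat. t - 1)" by (simp add: mono_def diff_le_mono)
      show "\<forall>n. \<exists>t. n \<le> t - (1::nat)" by (metis diff_Suc_1 order_refl)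
      show "\<forall>t. inj_on y {t..t + (t - 1)} \<and> (\<forall>s. t \<le> s \<longrightarrow> s < t + (t - 1) \<longrightarrow>
          link A x (y ` {t..t + (t - 1)}) (y s) (y (Suc s)))"
      proof
        fix t
        show "inj_on y {t..t + (t - 1)} \<and> (\<forall>s. t \<le> s \<longrightarrow> s < t + (t - 1) \<longrightarrow>
          link A x (y ` {t..t + (t - 1)}) (y s) (y (Suc s)))"
        proof (rule window[of t "\<lambda>i. t + i" id "\<lambda>s. s"])
          fix i assume "Suc i < t"
          then have "Suc (Suc (t - 2)) = t" by simp
          with \<open>Suc i < t\<close> show "E t (id i) (id (Suc i))"
            using True[rule_format, of i "t - i - 2"] by (simp add: fwd_def)
        qed (auto simp: strict_mono_on_def)
      qed
    qed
    then show thesis by (rule that)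
  next
    case False
    then obtain p s where "\<not> fwd p 0 s" by auto
    then have up: "fwd 0 q 0" for q by (rule min_to_max)
    have down: "bwd p 0 s" for p s using consecutive_cases False by blast
    \<comment> \<open>Block \<open>r\<close> occupies the times from \<open>r\<^sup>2\<close> to
      \<open>r\<^sup>2 + 2 * r\<close> and descends from lane \<open>3 * r\<close> to lane
      \<open>r\<close>. Windows starting in it have \<open>r\<close> lanes, all of index at least
      \<open>r\<close>, and run into at most one further block. The block is long enough for its end
      to stay clear of the beginning of the next block, and the jump from \<open>r\<close> to
      \<open>3 * r + 3\<close> goes from the minimum to the maximum of the window.\<close>
    define z where "z t = 3 * floor_sqrt t - (t - (floor_sqrt t)\<^sup>2)" for t
    have z: "z (r\<^sup>2 + m) = 3 * r - m" if "m \<le> 2 * r" for r m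
    proof -
      have "r\<^sup>2 + m < (Suc r)\<^sup>2" using that by (simp add: power2_eq_square)
      then have "floor_sqrt (r\<^sup>2 + m) = r" by (intro floor_sqrt_unique) auto
      then show ?thesis by (simp add: z_def)
    qed
    have "lane_sequence A x (\<lambda>s. y (z s)) (\<lambda>t. floor_sqrt t - 1)"
      unfolding lane_sequence_def
    proof (intro conjI)
      show "mono (\<lambda>t. floor_sqrt t - 1)" by (simp add: mono_def diff_le_mono mono_floor_sqrt')
      show "\<forall>n. \<exists>t. n \<le> floor_sqrt t - 1" by (metis diff_Suc_1 floor_sqrt_inverse_power2 order_refl)
      show "\<forall>t. inj_on (\<lambda>s. y (z s)) {t..t + (floor_sqrt t - 1)} \<and>
        (\<forall>s. t \<le> s \<longrightarrow> s < t + (floor_sqrt t - 1) \<longrightarrow>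
          link A x ((\<lambda>s. y (z s)) ` {t..t + (floor_sqrt t - 1)}) (y (z s)) (y (z (Suc s))))"
      proof
        fix t
        define r where "r = floor_sqrt t"
        define m where "m = t - r\<^sup>2"
        have "r\<^sup>2 \<le> t" "t < (Suc r)\<^sup>2" unfolding r_def by (auto simp: floor_sqrt_power2_le Suc_floor_sqrt_power2_gt)
        then have t: "t = r\<^sup>2 + m" and m: "m \<le> 2 * r" unfolding m_def by (auto simp: power2_eq_square)
        \<comment> \<open>\<open>c\<close> counts the times from \<open>t\<close> to the end of
          block \<open>r\<close>, including \<open>t\<close> itself.\<close>
        define c where "c = 2 * r + 1 - m"
        have z1: "z (t + i) = 3 * r - m - i" if "i < c" for i
          using z[of "m + i" r] that unfolding t c_def by (simp add: add.assoc)
        have z2: "z (t + i) = 3 * r + 3 - (i - c)" if "c \<le> i" "i < r" for i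
        proof -
          have "t + i = (r + 1)\<^sup>2 + (i - c)" using that m unfolding t c_def by (simp add: power2_eq_square)
          then show ?thesis using z[of "i - c" "r + 1"] that by simp
        qed
        show "inj_on (\<lambda>s. y (z s)) {t..t + (floor_sqrt t - 1)} \<and>
          (\<forall>s. t \<le> s \<longrightarrow> s < t + (floor_sqrt t - 1) \<longrightarrow>
            link A x ((\<lambda>s. y (z s)) ` {t..t + (floor_sqrt t - 1)}) (y (z s)) (y (z (Suc s))))"
          unfolding r_def[symmetric]
        proof (cases "r \<le> c")
          case True
          show "inj_on (\<lambda>s. y (z s)) {t..t + (r - 1)} \<and> (\<forall>s. t \<le> s \<longrightarrow> s < t + (r - 1) \<longrightarrow>
            link A x ((\<lambda>s. y (z s)) ` {t..t + (r - 1)}) (y (z s)) (y (z (Suc s))))"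
          proof (rule window[of r "\<lambda>l. c + l" "\<lambda>i. r - 1 - i"])
            show "bij_betw (\<lambda>i. r - 1 - i) {..<r} {..<r}"
              by (rule bij_betw_byWitness[where f' = "\<lambda>i. r - 1 - i"]) auto
            fix i assume "Suc i < r"
            then show "E r (r - 1 - i) (r - 1 - Suc i)"
              using down[of "r - 2 - i" i] by (simp add: bwd_def Suc_diff_Suc numeral_2_eq_2)
          next
            fix i assume "i < r"
            then show "z (t + i) = c + (r - 1 - i)" using z1[of i] True m by (auto simp: c_def)
          qed (use True in \<open>auto simp: strict_mono_on_def\<close>)
        next
          case False
          have c: "1 \<le> c" using m by (simp add: c_def)
          \<comment> \<open>The window consists of the last \<open>c\<close> lanes of block
            \<open>r\<close>, which are \<open>r\<close> to \<open>r + c - 1\<close>, and of the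
            first \<open>r - c\<close> lanes of the next block, which are \<open>3 * r + 3\<close>
            downwards and lie above all the former. Thus the ranks run from \<open>c - 1\<close>
            down to 0 and then from \<open>r - 1\<close> down to \<open>c\<close>.\<close>
          define \<rho> where "\<rho> i = (if i < c then c - 1 - i else c + r - 1 - i)" for i
          define g where "g l = (if l < c then r + l else 2 * r + 4 + l)" for l
          show "inj_on (\<lambda>s. y (z s)) {t..t + (r - 1)} \<and> (\<forall>s. t \<le> s \<longrightarrow> s < t + (r - 1) \<longrightarrow>
            link A x ((\<lambda>s. y (z s)) ` {t..t + (r - 1)}) (y (z s)) (y (z (Suc s))))"
          proof (rule window[of r g \<rho>])
            show "bij_betw \<rho> {..<r} {..<r}"
              by (rule bij_betw_byWitness[where f' = \<rho>]) (use False c in \<open>auto simp: \<rho>_def\<close>)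
            fix i assume i: "Suc i < r"
            consider "Suc i < c" | "Suc i = c" | "c \<le> i" by linarith
            then show "E r (\<rho> i) (\<rho> (Suc i))"
            proof cases
              case 1
              then have "\<rho> i = c - 2 - i + 1" "\<rho> (Suc i) = c - 2 - i" "Suc (Suc (r - 2)) = r"
                "c - 2 - i + (r - (c - i)) = r - 2" using False by (auto simp: \<rho>_def)
              then show ?thesis using down[of "c - 2 - i" "r - (c - i)"] by (simp add: bwd_def)
            next
              case 2
              then have "\<rho> i = 0" "\<rho> (Suc i) = Suc (r - 2)" "Suc (Suc (r - 2)) = r"
                using i by (auto simp: \<rho>_def)
              then show ?thesis using up[of "r - 2"] by (simp add: fwd_def)
            next
              case 3
              then have "\<rho> i = c + r - 2 - i + 1" "\<rho> (Suc i) = c + r - 2 - i" "Suc (Suc (r - 2)) = r"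
                "c + r - 2 - i + (i - c) = r - 2" using False i by (auto simp: \<rho>_def)
              then show ?thesis using down[of "c + r - 2 - i" "i - c"] by (simp add: bwd_def)
            qed
          next
            fix i assume "i < r"
            then show "z (t + i) = g (\<rho> i)"
              using z1[of i] z2[of i] False m c by (auto simp: g_def \<rho>_def c_def)
          qed (use False in \<open>auto simp: strict_mono_on_def g_def\<close>)
        qed
      qed
    qed
    then show thesis by (rule that)
  qed
qed

section \<open>Choosing disjoint links\<close>

lemma (in ray_family) finite_on_rays:
  assumes "finite U"
  shows "\<exists>N. \<forall>c i. x c i \<in> U \<longrightarrow> i < N" "finite {c. \<exists>i. x c i \<in> U}"
proof -
  let ?S = "{ci. (\<lambda>(c, i). x c i) ci \<in> U}"
  have "inj (\<lambda>(c, i). x c i)" by (auto simp: inj_def ray_inj)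
  then have fin: "finite ?S" using finite_vimageI[OF assms] by (simp add: vimage_def)
  have S: "c \<in> fst ` ?S" "i \<in> snd ` ?S" if "x c i \<in> U" for c i
    using that image_eqI[of c fst "(c, i)" ?S] image_eqI[of i snd "(c, i)" ?S] by simp_all
  then have "{c. \<exists>i. x c i \<in> U} \<subseteq> fst ` ?S" by blast
  then show "finite {c. \<exists>i. x c i \<in> U}" using finite_imageI[OF fin] by (rule finite_subset)
  obtain N where "\<forall>i\<in>snd ` ?S. i < N"
    using finite_imageI[OF fin, of snd] finite_nat_set_iff_bounded by blast
  then show "\<exists>N. \<forall>c i. x c i \<in> U \<longrightarrow> i < N" using S(2) by blast
qed

text \<open>The order along the lanes. It is vacuous for vertices without a common lane, so it can
  be demanded of all vertices of a path at once.\<close>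

definition (in ray_family) below :: "'v \<Rightarrow> 'v \<Rightarrow> bool" where
  "below u v \<longleftrightarrow> (\<forall>c i j. u = x c i \<longrightarrow> v = x c j \<longrightarrow> i < j)"

text \<open>The walks \<open>snd (f e)\<close> only serve to show that the rows of the final grid belong to the end.\<close>
lemma (in ray_family) choose_links:
  fixes a b :: "'e \<Rightarrow> nat" and W :: "'e \<Rightarrow> nat set"
  assumes wf: "wf R" and fin: "\<And>e. finite {e'. (e', e) \<in> R}"
    and link: "\<And>e. e \<in> Ev \<Longrightarrow> link A x (W e) (a e) (b e)"
  obtains f where
    "\<And>e. e \<in> Ev \<Longrightarrow> is_path A (fst (f e)) \<and> hd (fst (f e)) \<in> range (x (a e)) \<and>
      last (fst (f e)) \<in> range (x (b e)) \<and>
      (\<forall>c\<in>W e. set (inner (fst (f e))) \<inter> range (x c) = {}) \<and>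
      is_path A (snd (f e)) \<and> hd (snd (f e)) \<in> range (x 0) \<and> last (snd (f e)) \<in> range (x (a e)) \<and>
      below (last (snd (f e))) (hd (fst (f e)))"
    "\<And>e e'. e \<in> Ev \<Longrightarrow> (e', e) \<in> R \<Longrightarrow> set (fst (f e')) \<inter> set (fst (f e)) = {} \<and>
      set (snd (f e')) \<inter> set (snd (f e)) = {} \<and>
      (\<forall>u\<in>set (fst (f e')). \<forall>v\<in>{hd (fst (f e)), last (fst (f e)), last (snd (f e))}. below u v) \<and>
      (\<forall>u\<in>{hd (fst (f e')), last (fst (f e'))}. \<forall>v\<in>set (fst (f e)). below u v)"
proof -
  define own where "own e p q \<longleftrightarrow> is_path A p \<and> hd p \<in> range (x (a e)) \<and> last p \<in> range (x (b e)) \<and>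
      (\<forall>c\<in>W e. set (inner p) \<inter> range (x c) = {}) \<and> is_path A q \<and> hd q \<in> range (x 0) \<and>
      last q \<in> range (x (a e)) \<and> below (last q) (hd p)" for e p q
  define rel where "rel p' q' p q \<longleftrightarrow> set p' \<inter> set p = {} \<and> set q' \<inter> set q = {} \<and>
      (\<forall>u\<in>set p'. \<forall>v\<in>{hd p, last p, last q}. below u v) \<and>
      (\<forall>u\<in>{hd p', last p'}. \<forall>v\<in>set p. below u v)" for p' q' p q
  define good where "good f e r \<longleftrightarrow> (e \<in> Ev \<longrightarrow> own e (fst r) (snd r)) \<and> fst r \<noteq> [] \<and>
      (\<forall>e'. e \<in> Ev \<longrightarrow> (e', e) \<in> R \<longrightarrow> rel (fst (f e')) (snd (f e')) (fst r) (snd r))"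
    for f :: "'e \<Rightarrow> 'v list \<times> 'v list" and e r
  have "\<exists>f. \<forall>e. good f e (f e)"
  proof (rule dependent_wf_choice[OF wf])
    fix e and f :: "'e \<Rightarrow> 'v list \<times> 'v list"
    assume IH: "\<And>e'. (e', e) \<in> R \<Longrightarrow> good f e' (f e')"
    show "\<exists>r. good f e r"
    proof (cases "e \<in> Ev")
      case True
      define U where "U = (\<Union>e'\<in>{e'. (e', e) \<in> R}. set (fst (f e')) \<union> set (snd (f e')))"
      have "finite U" unfolding U_def using fin by auto
      then obtain N where N: "\<And>c i. x c i \<in> U \<Longrightarrow> i < N" using finite_on_rays(1) by blast
      \<comment> \<open>Earlier paths meet every lane only before index \<open>N\<close>. Blocking
        the first \<open>N\<close> vertices of the lanes that they meet puts the new paths beyond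
        them there; blocking those of lanes \<open>a e\<close> and \<open>b e\<close> does the same
        for the new ends.\<close>
      define C where "C = {c. \<exists>i. x c i \<in> U} \<union> {a e, b e}"
      define X where "X = U \<union> (\<Union>c\<in>C. x c ` {..<N})"
      have "finite C" unfolding C_def using finite_on_rays(2)[OF \<open>finite U\<close>] by simp
      then have X: "finite X" unfolding X_def using \<open>finite U\<close> by auto
      have NX: "N \<le> i" if "x c i \<notin> X" "c \<in> C" for c i
        using that unfolding X_def by (metis UN_I UnI2 imageI lessThan_iff not_le)
      obtain u v where uv: "u \<in> range (x 0)" "v \<in> range (x (a e))" "u \<notin> X" "(u, v) \<in> (avoiding A X)\<^sup>*"
        using tendsD[OF ray_tends X] by metis
      obtain q where q: "q \<noteq> []" "distinct q" "successively (\<lambda>x y. (x, y) \<in> A) q" "hd q \<in> range (x 0)"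
          "last q \<in> range (x (a e))" "set q \<inter> X = {}" using shortest_linking[OF uv] by metis
      obtain \<gamma> where \<gamma>: "last q = x (a e) \<gamma>" using q by auto
      have N\<gamma>: "N \<le> \<gamma>" using NX[of "a e" \<gamma>] q(1,6) \<gamma> last_in_set[of q] unfolding C_def by auto
      \<comment> \<open>Blocking lane \<open>a e\<close> up to the last vertex of \<open>q\<close>
        makes the link start beyond that vertex.\<close>
      define X' where "X' = X \<union> x (a e) ` {..\<gamma>}"
      have X': "finite X'" unfolding X'_def using X by simp
      let ?Y = "\<Union>c\<in>W e - {a e, b e}. range (x c)"
      obtain u v where uv: "u \<in> range (x (a e))" "v \<in> range (x (b e))" "u \<notin> X'"
          "(u, v) \<in> (avoiding (avoiding A ?Y) X')\<^sup>*"
        using tendsD[OF link[OF True, unfolded link_def] X'] by metis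
      obtain p where p: "p \<noteq> []" "distinct p" "successively (\<lambda>x y. (x, y) \<in> avoiding A ?Y) p"
          "hd p \<in> range (x (a e))" "last p \<in> range (x (b e))" "set p \<inter> X' = {}"
          "set (inner p) \<inter> (range (x (a e)) \<union> range (x (b e))) = {}"
        using shortest_linking[OF uv] by metis
      have "hd p \<notin> ?Y" using p(4) by (auto simp: ray_inj)
      then have pY: "set p \<inter> ?Y = {}" by (rule successively_avoiding[OF p(3,1)])
      have inner_sub: "set (inner p) \<subseteq> set p"
        by (auto simp: set_inner_split)
      have inner: "set (inner p) \<inter> range (x c) = {}" if "c \<in> W e" for c
      proof (cases "c \<in> {a e, b e}")
        case False
        then show ?thesis using pY inner_sub that by blast
      qed (use p(7) in blast)
      have pA: "successively (\<lambda>x y. (x, y) \<in> A) p"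
        using p(3) by (rule successively_mono) (auto simp: avoiding_def)
      have hl: "hd p \<in> set p" "last p \<in> set p" "last q \<in> set q" using p(1) q(1) by simp_all
      have pX: "v \<notin> X" if "v \<in> set p" for v using p(6) that unfolding X'_def by blast
      have "below (last q) (hd p)"
        unfolding below_def
      proof (intro allI impI)
        fix c i j assume "last q = x c i" "hd p = x c j"
        then have "c = a e" "i = \<gamma>" "x (a e) j \<notin> x (a e) ` {..\<gamma>}"
          using \<gamma> p(6) hl unfolding X'_def by (auto simp: ray_inj)
        then show "i < j" by (auto simp: not_le[symmetric])
      qed
      then have "own e p q" unfolding own_def is_path_def using p pA q inner by blast
      moreover have "rel (fst (f e')) (snd (f e')) p q" if e': "(e', e) \<in> R" for e'
      proof -
        have sub: "set (fst (f e')) \<subseteq> U" "set (snd (f e')) \<subseteq> U" using e' unfolding U_def by auto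
        have "fst (f e') \<noteq> []" using IH[OF e'] unfolding good_def by blast
        then have hl': "hd (fst (f e')) \<in> U" "last (fst (f e')) \<in> U" using sub by auto
        have "U \<subseteq> X" unfolding X_def by blast
        have b1: "below u v" if u: "u \<in> U" and v: "v \<in> {hd p, last p, last q}" for u v
          unfolding below_def
        proof (intro allI impI)
          fix c i j assume eq: "u = x c i" "v = x c j"
          have "v \<notin> X" using v hl pX q(6) by blast
          moreover have "c \<in> C" using v p(4,5) q(5) eq unfolding C_def by (auto simp: ray_inj)
          ultimately have "N \<le> j" using NX eq by blast
          then show "i < j" using N u eq by fastforce
        qed
        have b2: "below u v" if u: "u \<in> U" and v: "v \<in> set p" for u v
          unfolding below_def
        proof (intro allI impI)
          fix c i j assume eq: "u = x c i" "v = x c j"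
          then have "c \<in> C" using u unfolding C_def by blast
          then have "N \<le> j" using NX[of c j] eq pX[OF v] by blast
          then show "i < j" using N u eq by fastforce
        qed
        have d: "U \<inter> set p = {}" "U \<inter> set q = {}" using pX q(6) \<open>U \<subseteq> X\<close> by auto
        show ?thesis unfolding rel_def
        proof (intro conjI ballI)
          show "set (fst (f e')) \<inter> set p = {}" using d(1) sub(1) by blast
          show "set (snd (f e')) \<inter> set q = {}" using d(2) sub(2) by blast
        next
          fix u v assume "u \<in> set (fst (f e'))" "v \<in> {hd p, last p, last q}"
          with sub(1) show "below u v" by (intro b1) auto
        next
          fix u v assume "u \<in> {hd (fst (f e')), last (fst (f e'))}" "v \<in> set p"
          with hl' show "below u v" by (intro b2) auto
        qed
      qed
      ultimately have "good f e (p, q)" unfolding good_def using p(1) by simp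
      then show ?thesis ..
    next
      case False
      \<comment> \<open>A nonempty dummy: the head and the last vertex of an earlier path must
        belong to it, also for predecessors outside \<open>Ev\<close>.\<close>
      then have "good f e ([undefined], [])" unfolding good_def by simp
      then show ?thesis ..
    qed
  qed (auto simp: good_def)
  then obtain f where f: "\<And>e. good f e (f e)" by auto
  show thesis
  proof (rule that[of f])
    fix e assume "e \<in> Ev"
    then show "is_path A (fst (f e)) \<and> hd (fst (f e)) \<in> range (x (a e)) \<and>
      last (fst (f e)) \<in> range (x (b e)) \<and>
      (\<forall>c\<in>W e. set (inner (fst (f e))) \<inter> range (x c) = {}) \<and>
      is_path A (snd (f e)) \<and> hd (snd (f e)) \<in> range (x 0) \<and> last (snd (f e)) \<in> range (x (a e)) \<and>
      below (last (snd (f e))) (hd (fst (f e)))"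
      using f[of e] unfolding good_def own_def by simp
  next
    fix e e' assume "e \<in> Ev" "(e', e) \<in> R"
    then show "set (fst (f e')) \<inter> set (fst (f e)) = {} \<and>
      set (snd (f e')) \<inter> set (snd (f e)) = {} \<and>
      (\<forall>u\<in>set (fst (f e')). \<forall>v\<in>{hd (fst (f e)), last (fst (f e)), last (snd (f e))}. below u v) \<and>
      (\<forall>u\<in>{hd (fst (f e')), last (fst (f e'))}. \<forall>v\<in>set (fst (f e)). below u v)"
      using f[of e] unfolding good_def rel_def by blast
  qed
qed

lemma concat_ray:
  fixes L :: "nat \<Rightarrow> 'v list"
  assumes path: "\<And>n. is_path A (L n)"
    and connect: "\<And>n. (last (L n), hd (L (Suc n))) \<in> A"
    and disj: "\<And>m n. m \<noteq> n \<Longrightarrow> set (L m) \<inter> set (L n) = {}"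
  obtains r where "inj r" "\<And>n. (r n, r (Suc n)) \<in> A" "range r = (\<Union>n. set (L n))"
proof -
  have ne: "L n \<noteq> []" for n using path by (simp add: is_path_def)
  \<comment> \<open>A position in the ray is a pair of the number of a path and an index in it;
    \<open>off\<close> counts the vertices of the preceding paths and turns such pairs back into
    numbers.\<close>
  define next_pos where "next_pos = (\<lambda>(n, i). if Suc i < length (L n) then (n, Suc i) else (Suc n, 0))"
  define pos where "pos m = (next_pos ^^ m) (0, 0)" for m
  define r where "r m = L (fst (pos m)) ! snd (pos m)" for m
  define off where "off n = (\<Sum>l<n. length (L l))" for n
  have pos_Suc: "pos (Suc m) = next_pos (pos m)" for m by (simp add: pos_def)
  have valid: "snd (pos m) < length (L (fst (pos m)))" for m
    by (induction m) (use ne in \<open>auto simp: pos_Suc next_pos_def pos_def split: prod.splits\<close>)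
  have off: "off (fst (pos m)) + snd (pos m) = m" for m
  proof (induction m)
    case (Suc m)
    then show ?case using valid[of m]
      by (auto simp: pos_Suc next_pos_def off_def split: prod.splits)
  qed (simp add: pos_def off_def)
  have reach: "pos (off n + i) = (n, i)" if "i < length (L n)" for n i
    using that
  proof (induction n arbitrary: i)
    case 0
    then show ?case by (induction i) (auto simp: off_def pos_def next_pos_def)
  next
    case (Suc n)
    have last: "pos (off n + (length (L n) - 1)) = (n, length (L n) - 1)"
      using Suc.IH ne[of n] by simp
    have "off (Suc n) = Suc (off n + (length (L n) - 1))" using ne[of n] by (cases "L n") (auto simp: off_def)
    then have "pos (off (Suc n)) = (Suc n, 0)" using last by (simp add: pos_Suc next_pos_def)
    with Suc.prems show ?case by (induction i) (auto simp: pos_Suc next_pos_def)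
  qed
  have "inj r"
  proof (rule injI)
    fix m m' assume eq: "r m = r m'"
    have "r m \<in> set (L (fst (pos m)))" "r m' \<in> set (L (fst (pos m')))" using valid by (auto simp: r_def)
    then have 1: "fst (pos m) = fst (pos m')" using disj eq by (metis disjoint_iff)
    then have "snd (pos m) = snd (pos m')"
      using eq valid[of m] valid[of m'] path[of "fst (pos m)"]
      by (auto simp: r_def is_path_def nth_eq_iff_index_eq)
    then show "m = m'" using 1 off by metis
  qed
  moreover have "(r m, r (Suc m)) \<in> A" for m
  proof -
    obtain n i where ni: "pos m = (n, i)" by fastforce
    show ?thesis
    proof (cases "Suc i < length (L n)")
      case True
      then show ?thesis using path[of n]
        by (simp add: r_def pos_Suc next_pos_def ni is_path_def successively_conv_nth)
    next
      case False
      then have "i = length (L n) - 1" using valid[of m] ni by simp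
      then show ?thesis using connect[of n] ne False
        by (simp add: r_def pos_Suc next_pos_def ni last_conv_nth hd_conv_nth)
    qed
  qed
  moreover have "range r = (\<Union>n. set (L n))"
  proof
    show "range r \<subseteq> (\<Union>n. set (L n))" using nth_mem[OF valid] by (auto simp: r_def)
    show "(\<Union>n. set (L n)) \<subseteq> range r"
    proof
      fix v assume "v \<in> (\<Union>n. set (L n))"
      then obtain n i where "i < length (L n)" "v = L n ! i" by (auto simp: in_set_conv_nth)
      then have "v = r (off n + i)" using reach by (simp add: r_def)
      then show "v \<in> range r" by simp
    qed
  qed
  ultimately show thesis by (rule that)
qed

section \<open>Weaving the rows\<close>

text \<open>\<open>rungs True i\<close> lead from row \<open>i\<close> to row \<open>i + 1\<close>, \<open>rungs False i\<close> lead back.\<close>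
locale ladder =
  fixes A :: "('v \<times> 'v) set" and R :: "nat \<Rightarrow> nat \<Rightarrow> 'v" and rungs :: "bool \<Rightarrow> nat \<Rightarrow> 'v list set"
  assumes row_inj: "R i m = R j n \<longleftrightarrow> i = j \<and> m = n"
    and row_arc: "(R i m, R i (Suc m)) \<in> A"
    and rung_path: "xs \<in> rungs d i \<Longrightarrow> is_path A xs"
    and rung_inner: "xs \<in> rungs d i \<Longrightarrow> set (inner xs) \<inter> range (R j) = {}"
    and rung_disjoint: "xs \<in> rungs d i \<Longrightarrow> ys \<in> rungs d' i' \<Longrightarrow> (d, i, xs) \<noteq> (d', i', ys) \<Longrightarrow>
      set (inner xs) \<inter> set (inner ys) = {}"
    and rung_ex: "\<exists>xs\<in>rungs d i. \<exists>m n. N < m \<and> N < n \<and> hd xs = R (if d then i else Suc i) m \<and>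
      last xs = R (if d then Suc i else i) n"

text \<open>At time \<open>t\<close> row \<open>j\<close> occupies lane \<open>t + j\<close>; first it signals to row \<open>j + 1\<close>, then it moves to the next
  lane, the highest row first. Events are pairs of a doubled time (odd for moves) and a lane.\<close>
locale lanes = ray_family +
  fixes z k :: "nat \<Rightarrow> nat"
  assumes lanes: "lane_sequence A x z k"
begin

definition events :: "(nat \<times> nat) set" where
  "events = {(T, s). T div 2 \<le> s \<and> s < T div 2 + k (T div 2)}"

definition prec :: "((nat \<times> nat) \<times> (nat \<times> nat)) set" where
  "prec = {((T', s'), (T, s)). (T', s') \<in> events \<and> (T, s) \<in> events \<and> (T' < T \<or> T' = T \<and> s < s')}"

definition window :: "nat \<times> nat \<Rightarrow> nat set" where
  "window e = z ` {fst e div 2..fst e div 2 + k (fst e div 2)}"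

lemma mono_k: "t \<le> t' \<Longrightarrow> k t \<le> k t'"
  using lanes by (simp add: lane_sequence_def mono_def)

text \<open>At equal times the larger lane comes first, so well-foundedness rests on the upper bound
  that \<open>events\<close> puts on the lanes of each time.\<close>

lemma wf_prec: "wf prec"
proof (rule wf_subset)
  show "wf (inv_image (less_than <*lex*> less_than) (\<lambda>(T, s). (T, T + k (T div 2) - s)))" by auto
  show "prec \<subseteq> inv_image (less_than <*lex*> less_than) (\<lambda>(T, s). (T, T + k (T div 2) - s))"
    by (auto simp: prec_def events_def)
qed

lemma finite_prec: "finite {e'. (e', e) \<in> prec}"
proof (rule finite_subset)
  show "{e'. (e', e) \<in> prec} \<subseteq> {..fst e} \<times> {..fst e + k (fst e div 2)}"
  proof
    fix e' assume "e' \<in> {e'. (e', e) \<in> prec}"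
    then have "fst e' \<le> fst e" "snd e' < fst e' div 2 + k (fst e' div 2)"
      by (auto simp: prec_def events_def)
    moreover from this have "k (fst e' div 2) \<le> k (fst e div 2)" by (intro mono_k div_le_mono)
    ultimately show "e' \<in> {..fst e} \<times> {..fst e + k (fst e div 2)}" by (auto simp: mem_Times_iff)
  qed
qed simp

end

text \<open>\<open>before\<close> and \<open>after\<close> order the paths along every lane,
  including the lanes outside their windows that inner vertices of \<open>p\<close> may cross. They
  keep such crossings away from the stretches of lanes used by rows and rungs.\<close>

locale woven = lanes +
  fixes p q :: "nat \<times> nat \<Rightarrow> 'a list"
  assumes p_path: "e \<in> events \<Longrightarrow> is_path A (p e)"
    and p_hd: "e \<in> events \<Longrightarrow> hd (p e) \<in> range (x (z (snd e)))"
    and p_last: "e \<in> events \<Longrightarrow> last (p e) \<in> range (x (z (Suc (snd e))))"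
    and p_inner: "e \<in> events \<Longrightarrow> c \<in> window e \<Longrightarrow> set (inner (p e)) \<inter> range (x c) = {}"
    and q_path: "e \<in> events \<Longrightarrow> is_path A (q e)"
    and q_hd: "e \<in> events \<Longrightarrow> hd (q e) \<in> range (x 0)"
    and q_last: "e \<in> events \<Longrightarrow> last (q e) \<in> range (x (z (snd e)))"
    and q_below: "e \<in> events \<Longrightarrow> below (last (q e)) (hd (p e))"
    and p_disjoint: "(e', e) \<in> prec \<Longrightarrow> set (p e') \<inter> set (p e) = {}"
    and q_disjoint: "(e', e) \<in> prec \<Longrightarrow> set (q e') \<inter> set (q e) = {}"
    and before: "(e', e) \<in> prec \<Longrightarrow> u \<in> set (p e') \<Longrightarrow> v \<in> {hd (p e), last (p e), last (q e)} \<Longrightarrow> below u v"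
    and after: "(e', e) \<in> prec \<Longrightarrow> u \<in> {hd (p e'), last (p e')} \<Longrightarrow> v \<in> set (p e) \<Longrightarrow> below u v"

lemma (in lanes) ex_woven: "\<exists>p q. woven A x z k p q"
proof -
  have "link A x (window e) (z (snd e)) (z (Suc (snd e)))" if "e \<in> events" for e
    using lanes that unfolding lane_sequence_def window_def events_def by (cases e) auto
  from choose_links[where Ev = events and W = window, OF wf_prec finite_prec this]
  obtain f where f: "\<And>e. e \<in> events \<Longrightarrow> is_path A (fst (f e)) \<and> hd (fst (f e)) \<in> range (x (z (snd e))) \<and>
      last (fst (f e)) \<in> range (x (z (Suc (snd e)))) \<and>
      (\<forall>c\<in>window e. set (inner (fst (f e))) \<inter> range (x c) = {}) \<and>
      is_path A (snd (f e)) \<and> hd (snd (f e)) \<in> range (x 0) \<and> last (snd (f e)) \<in> range (x (z (snd e))) \<and>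
      below (last (snd (f e))) (hd (fst (f e)))"
    and g: "\<And>e e'. e \<in> events \<Longrightarrow> (e', e) \<in> prec \<Longrightarrow> set (fst (f e')) \<inter> set (fst (f e)) = {} \<and>
      set (snd (f e')) \<inter> set (snd (f e)) = {} \<and>
      (\<forall>u\<in>set (fst (f e')). \<forall>v\<in>{hd (fst (f e)), last (fst (f e)), last (snd (f e))}. below u v) \<and>
      (\<forall>u\<in>{hd (fst (f e')), last (fst (f e'))}. \<forall>v\<in>set (fst (f e)). below u v)"
    by metis
  have "e \<in> events" if "(e', e) \<in> prec" for e e' using that by (auto simp: prec_def)
  note g = g[OF this]
  have "woven A x z k (fst \<circ> f) (snd \<circ> f)"
  proof (unfold_locales, unfold comp_def, goal_cases)
    case (4 e c) then show ?case using f by blast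
  next
    case (9 e' e) then show ?case using g by blast
  next
    case (10 e' e) then show ?case using g by blast
  next
    case (11 e' e u v) then show ?case using g by blast
  next
    case (12 e' e u v) then show ?case using g by blast
  qed (use f in simp_all)
  then show ?thesis by blast
qed

context woven
begin

definition move :: "nat \<Rightarrow> nat \<Rightarrow> nat \<times> nat" where
  "move t j = (2 * t + 1, t + j)"

definition signal :: "nat \<Rightarrow> nat \<Rightarrow> nat \<times> nat" where
  "signal t j = (2 * t, t + j)"

lemma events_iff [simp]: "move t j \<in> events \<longleftrightarrow> j < k t" "signal t j \<in> events \<longleftrightarrow> j < k t"
  by (auto simp: events_def move_def signal_def)

lemma prec_iff [simp]:
  "(move t j, move t' j') \<in> prec \<longleftrightarrow> j < k t \<and> j' < k t' \<and> (t < t' \<or> t = t' \<and> j' < j)"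
  "(signal t j, signal t' j') \<in> prec \<longleftrightarrow> j < k t \<and> j' < k t' \<and> (t < t' \<or> t = t' \<and> j' < j)"
  "(move t j, signal t' j') \<in> prec \<longleftrightarrow> j < k t \<and> j' < k t' \<and> t < t'"
  "(signal t j, move t' j') \<in> prec \<longleftrightarrow> j < k t \<and> j' < k t' \<and> t \<le> t'"
  by (auto simp: prec_def events_def move_def signal_def)

lemma move_signal_simps [simp]:
  "move t j = move t' j' \<longleftrightarrow> t = t' \<and> j = j'" "signal t j = signal t' j' \<longleftrightarrow> t = t' \<and> j = j'"
  "odd (fst (move t j))" "even (fst (signal t j))" "snd (move t j) = t + j" "snd (signal t j) = t + j"
  "window (move t j) = z ` {t..t + k t}" "window (signal t j) = z ` {t..t + k t}"
  by (auto simp: move_def signal_def window_def)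

lemma event_cases:
  assumes "e \<in> events"
  obtains (move) t j where "e = move t j" "j < k t" | (signal) t j where "e = signal t j" "j < k t"
proof -
  obtain T s where e: "e = (T, s)" by (cases e)
  define t where "t = T div 2"
  have s: "t \<le> s" "s < t + k t" using assms e by (auto simp: events_def t_def)
  show thesis
  proof (cases "even T")
    case True
    then show thesis using signal[of t "s - t"] s e by (simp add: signal_def t_def)
  next
    case False
    then show thesis using move[of t "s - t"] s e by (simp add: move_def t_def)
  qed
qed

lemma prec_events: "(e', e) \<in> prec \<Longrightarrow> e' \<in> events \<and> e \<in> events"
  by (auto simp: prec_def)

lemma prec_total: "e \<in> events \<Longrightarrow> e' \<in> events \<Longrightarrow> e \<noteq> e' \<Longrightarrow> (e, e') \<in> prec \<or> (e', e) \<in> prec"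
  by (auto simp: prec_def)

lemma p_disjoint': "e \<in> events \<Longrightarrow> e' \<in> events \<Longrightarrow> e \<noteq> e' \<Longrightarrow> set (p e) \<inter> set (p e') = {}"
  using prec_total[of e e'] p_disjoint by (metis Int_commute)

lemma lane_eq: "z s = z s' \<longleftrightarrow> s = s'" if "s \<in> {t..t + k t}" "s' \<in> {t..t + k t}"
  using lanes that unfolding lane_sequence_def by (meson inj_onD)

lemma p_ends: "e \<in> events \<Longrightarrow> hd (p e) \<in> set (p e) \<and> last (p e) \<in> set (p e)"
  using p_path by (auto simp: is_path_def)

definition touches :: "nat \<times> nat \<Rightarrow> nat \<Rightarrow> nat \<Rightarrow> bool" where
  "touches e c i \<longleftrightarrow> e \<in> events \<and> x c i \<in> {hd (p e), last (p e)}"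

lemma touches_lane:
  assumes "touches e c i"
  shows "c = z (snd e) \<and> x c i = hd (p e) \<or> c = z (Suc (snd e)) \<and> x c i = last (p e)"
  using assms p_hd[of e] p_last[of e] unfolding touches_def by (auto simp: ray_inj)

lemma touches_window:
  assumes "e \<in> events" "c \<in> window e" "x c i \<in> set (p e)"
  shows "touches e c i"
proof -
  have "x c i \<notin> set (inner (p e))" using p_inner[OF assms(1,2)] by blast
  then show ?thesis
    using assms set_subset_inner[of "p e"] p_path[of e] by (auto simp: touches_def is_path_def)
qed

lemma touches_unique:
  assumes "touches e c i" "touches e c j"
  shows "i = j"
proof -
  have e: "e \<in> events" using assms by (simp add: touches_def)
  then have "z (snd e) \<noteq> z (Suc (snd e))"
  proof (cases rule: event_cases)
    case (move t j)
    then show ?thesis using lane_eq[of "t + j" t "Suc (t + j)"] by simp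
  next
    case (signal t j)
    then show ?thesis using lane_eq[of "t + j" t "Suc (t + j)"] by simp
  qed
  then have "x c i = x c j" using assms[THEN touches_lane] by auto
  then show ?thesis by (simp add: ray_inj)
qed

lemma touches_before: "(e', e) \<in> prec \<Longrightarrow> x c i \<in> set (p e') \<Longrightarrow> touches e c j \<Longrightarrow> i < j"
  using before[of e' e "x c i" "x c j"] unfolding below_def touches_def by blast

lemma touches_after: "(e', e) \<in> prec \<Longrightarrow> touches e' c i \<Longrightarrow> x c j \<in> set (p e) \<Longrightarrow> i < j"
  using after[of e' e "x c i" "x c j"] unfolding below_def touches_def by blast

lemma touches_in: "touches e c i \<Longrightarrow> x c i \<in> set (p e)"
  using p_ends[of e] unfolding touches_def by auto

text \<open>A stretch of lane \<open>c\<close> between two moves touching it, with at most signals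
  touching it in between. Events in between have \<open>c\<close> in their windows, so their paths
  meet the lane in their ends only; earlier and later events are kept off the stretch by
  \<open>before\<close> and \<open>after\<close>.\<close>

definition piece :: "nat \<Rightarrow> nat \<times> nat \<Rightarrow> nat \<Rightarrow> nat \<times> nat \<Rightarrow> nat \<Rightarrow> bool" where
  "piece c e1 i1 e2 i2 \<longleftrightarrow> (e1, e2) \<in> prec \<and> odd (fst e1) \<and> odd (fst e2) \<and>
    touches e1 c i1 \<and> touches e2 c i2 \<and> c \<in> window e1 \<and> c \<in> window e2 \<and>
    (\<forall>e. (e1, e) \<in> prec \<longrightarrow> (e, e2) \<in> prec \<longrightarrow> c \<in> window e \<and> (\<forall>i. touches e c i \<longrightarrow> even (fst e)))"

lemma piece_less: "piece c e1 i1 e2 i2 \<Longrightarrow> i1 < i2"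
  using touches_before[OF _ touches_in] unfolding piece_def by blast

lemma piece_path:
  assumes P: "piece c e1 i1 e2 i2" and e: "e \<in> events" "x c i \<in> set (p e)" and i: "i1 \<le> i" "i \<le> i2"
  shows "touches e c i \<and> (e = e1 \<and> i = i1 \<or> e = e2 \<and> i = i2 \<or> even (fst e))"
proof -
  have ev: "e1 \<in> events" "e2 \<in> events" using P prec_events[of e1 e2] unfolding piece_def by auto
  have "(e, e1) \<notin> prec" using touches_before[of e e1 c i i1] P e i unfolding piece_def by auto
  moreover have "(e2, e) \<notin> prec" using touches_after[of e2 e c i2 i] P e i unfolding piece_def by auto
  ultimately consider "e = e1" | "e = e2" | "(e1, e) \<in> prec" "(e, e2) \<in> prec"
    using prec_total[OF e(1) ev(1)] prec_total[OF e(1) ev(2)] by auto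
  then show ?thesis
  proof cases
    case 1
    then have "touches e c i" using touches_window[OF e(1) _ e(2)] P by (simp add: piece_def)
    then show ?thesis using 1 P touches_unique unfolding piece_def by blast
  next
    case 2
    then have "touches e c i" using touches_window[OF e(1) _ e(2)] P by (simp add: piece_def)
    then show ?thesis using 2 P touches_unique unfolding piece_def by blast
  next
    case 3
    then have "c \<in> window e" "\<forall>i. touches e c i \<longrightarrow> even (fst e)" using P unfolding piece_def by blast+
    then show ?thesis using touches_window[OF e(1) _ e(2)] by blast
  qed
qed

text \<open>If overlapping pieces differed, a move bounding one of them would lie in
  \<open>prec\<close> strictly between the two moves of the other, where only signals touch the
  lane.\<close>

lemma piece_piece:
  assumes P: "piece c e1 i1 e2 i2" and P': "piece c e1' i1' e2' i2'" and i: "i1' < i2" "i1 < i2'"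
  shows "e1 = e1' \<and> e2 = e2'"
proof -
  have 1: "False" if "piece c e1 i1 e2 i2" "piece c e1' i1' e2' i2'" "i1' < i2" "(e1, e1') \<in> prec"
    for e1 i1 e2 i2 e1' i1' e2' i2'
  proof -
    have t: "touches e1' c i1'" "touches e2 c i2" "odd (fst e1')" using that unfolding piece_def by auto
    have "e1' \<noteq> e2" using t that(3) touches_unique by blast
    moreover have "(e2, e1') \<notin> prec" using touches_after[OF _ t(2) touches_in[OF t(1)]] that(3) by auto
    ultimately have "(e1', e2) \<in> prec" using prec_total t unfolding touches_def by blast
    then show False using that t unfolding piece_def by blast
  qed
  have 2: "False" if "piece c e1 i1 e2 i2" "piece c e1' i1' e2' i2'" "i1' < i2" "(e2, e2') \<in> prec"
    for e1 i1 e2 i2 e1' i1' e2' i2'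
  proof -
    have t: "touches e1' c i1'" "touches e2 c i2" "odd (fst e2)" using that unfolding piece_def by auto
    have "e1' \<noteq> e2" using t that(3) touches_unique by blast
    moreover have "(e2, e1') \<notin> prec" using touches_after[OF _ t(2) touches_in[OF t(1)]] that(3) by auto
    ultimately have "(e1', e2) \<in> prec" using prec_total t unfolding touches_def by blast
    then show False using that t unfolding piece_def by blast
  qed
  have ev: "e1 \<in> events" "e2 \<in> events" "e1' \<in> events" "e2' \<in> events"
    using P P' unfolding piece_def touches_def by auto
  show ?thesis
    using 1[OF P P' i(1)] 1[OF P' P i(2)] 2[OF P P' i(1)] 2[OF P' P i(2)]
      prec_total[OF ev(1,3)] prec_total[OF ev(2,4)] by blast
qed

text \<open>\<open>enter j t\<close> and \<open>leave j t\<close> are the indices at which row \<open>j\<close> enters and leaves lane \<open>t + j + 1\<close>.\<close>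
definition enter :: "nat \<Rightarrow> nat \<Rightarrow> nat" where
  "enter j t = inv (x (z (Suc (t + j)))) (last (p (move t j)))"

definition leave :: "nat \<Rightarrow> nat \<Rightarrow> nat" where
  "leave j t = inv (x (z (Suc (t + j)))) (hd (p (move (Suc t) j)))"

lemma enter: "j < k t \<Longrightarrow> x (z (Suc (t + j))) (enter j t) = last (p (move t j))"
  using p_last[of "move t j"] by (simp add: enter_def f_inv_into_f)

lemma active_Suc: "j < k t \<Longrightarrow> j < k (Suc t)"
  using mono_k[of t "Suc t"] by simp

lemma leave: "j < k t \<Longrightarrow> x (z (Suc (t + j))) (leave j t) = hd (p (move (Suc t) j))"
  using p_hd[of "move (Suc t) j"] active_Suc[of j t] by (simp add: leave_def f_inv_into_f)

text \<open>Since higher rows move first, the moves between these two are those of lower rows at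
  time \<open>t\<close> and of higher rows at time \<open>t + 1\<close>. The former end before lane
  \<open>t + j + 1\<close>, the latter start beyond it.\<close>

lemma row_piece:
  assumes j: "j < k t"
  shows "piece (z (Suc (t + j))) (move t j) (enter j t) (move (Suc t) j) (leave j t)"
  unfolding piece_def
proof (intro conjI allI impI)
  let ?c = "z (Suc (t + j))"
  show "touches (move t j) ?c (enter j t)" "touches (move (Suc t) j) ?c (leave j t)"
    using enter[OF j] leave[OF j] j active_Suc[OF j] by (auto simp: touches_def)
  have c: "Suc (t + j) \<in> {t..t + k t}" "Suc (t + j) \<in> {Suc t..Suc t + k (Suc t)}"
    using j active_Suc[OF j] by auto
  then show "?c \<in> window (move t j)" "?c \<in> window (move (Suc t) j)" by auto
  fix e assume e: "(move t j, e) \<in> prec" "(e, move (Suc t) j) \<in> prec"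
  then have ev: "e \<in> events" using prec_events by blast
  then show "?c \<in> window e"
  proof (cases rule: event_cases)
    case (move t' j')
    then have "t' = t \<or> t' = Suc t" using e by auto
    then show ?thesis using c move by auto
  next
    case (signal t' j')
    then have "t' = Suc t" using e by auto
    then show ?thesis using c signal by auto
  qed
  fix i assume t: "touches e ?c i"
  from ev show "even (fst e)"
  proof (cases rule: event_cases)
    case (move t' j')
    then have tj: "t' = t \<and> j' < j \<or> t' = Suc t \<and> j < j'" using e by auto
    have "?c = z (t' + j') \<or> ?c = z (Suc (t' + j'))" using touches_lane[OF t] move by auto
    then have "Suc (t + j) = t' + j' \<or> Suc (t + j) = Suc (t' + j')"
      using lane_eq[of "Suc (t + j)" t' "t' + j'"] lane_eq[of "Suc (t + j)" t' "Suc (t' + j')"] c tj move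
      by (elim disjE) auto
    then show ?thesis using tj by auto
  qed simp
qed (use j active_Suc[OF j] in auto)

text \<open>The two moves are consecutive in \<open>prec\<close>, so nothing happens between them.
  The stretch begins where row \<open>j + 1\<close> leaves the lane and ends where row
  \<open>j\<close> arrives on it: a path back from row \<open>j + 1\<close> to row
  \<open>j\<close>.\<close>

lemma up_piece:
  assumes j: "Suc j < k (Suc t)" "Suc j < k t"
  shows "piece (z (Suc (Suc t + j))) (move (Suc t) (Suc j)) (leave (Suc j) t) (move (Suc t) j) (enter j (Suc t))"
  unfolding piece_def
proof (intro conjI allI impI)
  let ?c = "z (Suc (Suc t + j))"
  show "touches (move (Suc t) (Suc j)) ?c (leave (Suc j) t)" "touches (move (Suc t) j) ?c (enter j (Suc t))"
    using enter[of j "Suc t"] leave[of "Suc j" t] j by (auto simp: touches_def)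
  show "?c \<in> window (move (Suc t) (Suc j))" "?c \<in> window (move (Suc t) j)" using j by auto
  fix e assume e: "(move (Suc t) (Suc j), e) \<in> prec" "(e, move (Suc t) j) \<in> prec"
  then have "e \<in> events" using prec_events by blast
  then have False by (cases rule: event_cases) (use e in auto)
  then show "?c \<in> window e" ..
  show "\<And>i. even (fst e)" using \<open>False\<close> ..
qed (use j in auto)

text \<open>The last vertex of the move is left to the next part, where it is the point of entry
  into the next lane. So consecutive parts are disjoint and joined by an arc.\<close>

definition row_part :: "nat \<Rightarrow> nat \<Rightarrow> 'a list" where
  "row_part j t = map (x (z (Suc (t + j)))) [enter j t..<leave j t] @ butlast (p (move (Suc t) j))"

lemma enter_less_leave: "j < k t \<Longrightarrow> enter j t < leave j t"
  by (rule piece_less[OF row_piece])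

lemma p_length:
  assumes "e \<in> events"
  shows "2 \<le> length (p e)"
proof -
  have "hd (p e) \<noteq> last (p e)"
  proof
    assume eq: "hd (p e) = last (p e)"
    obtain i j where "hd (p e) = x (z (snd e)) i" "last (p e) = x (z (Suc (snd e))) j"
      using p_hd[OF assms] p_last[OF assms] by auto
    then have "z (snd e) = z (Suc (snd e))" using eq by (simp add: ray_inj)
    with assms show False
    proof (cases rule: event_cases)
      case (move t j)
      then show ?thesis using lane_eq[of "t + j" t "Suc (t + j)"] \<open>z (snd e) = _\<close> by simp
    next
      case (signal t j)
      then show ?thesis using lane_eq[of "t + j" t "Suc (t + j)"] \<open>z (snd e) = _\<close> by simp
    qed
  qed
  then show ?thesis using p_path[OF assms] by (cases "p e"; cases "tl (p e)") (auto simp: is_path_def)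
qed

lemma set_row_part:
  "set (row_part j t) = x (z (Suc (t + j))) ` {enter j t..<leave j t} \<union> set (butlast (p (move (Suc t) j)))"
  by (simp add: row_part_def)

text \<open>Among the moves, only \<open>move t j\<close> meets the half-open stretch, and only in
  its last vertex, which \<open>butlast\<close> removes.\<close>

lemma row_part_lane_disjoint:
  assumes j: "j < k t" and j': "j' < k t'" and i: "enter j t \<le> i" "i < leave j t"
  shows "x (z (Suc (t + j))) i \<notin> set (butlast (p (move (Suc t') j')))"
proof
  assume v: "x (z (Suc (t + j))) i \<in> set (butlast (p (move (Suc t') j')))"
  have ev: "move (Suc t') j' \<in> events" using active_Suc[OF j'] by simp
  have "touches (move (Suc t') j') (z (Suc (t + j))) i \<and> (move (Suc t') j' = move t j \<and> i = enter j t \<or>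
      move (Suc t') j' = move (Suc t) j \<and> i = leave j t \<or> even (fst (move (Suc t') j')))"
    by (rule piece_path[OF row_piece[OF j] ev]) (use in_set_butlastD[OF v] i in auto)
  then have eq: "move (Suc t') j' = move t j" "i = enter j t" using i by auto
  have "x (z (Suc (t + j))) i = last (p (move t j))" using enter[OF j] eq(2) by simp
  then show False using is_path_ends(2)[OF p_path[OF ev] v] eq(1) by simp
qed

lemma row_part_disjoint:
  assumes j: "j < k t" and j': "j' < k t'" and ne: "(j, t) \<noteq> (j', t')"
  shows "set (row_part j t) \<inter> set (row_part j' t') = {}"
proof -
  have "x (z (Suc (t + j))) ` {enter j t..<leave j t} \<inter> x (z (Suc (t' + j'))) ` {enter j' t'..<leave j' t'} = {}"
  proof (rule ccontr)
    assume "\<not> ?thesis"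
    then obtain i where c: "z (Suc (t + j)) = z (Suc (t' + j'))" and
      "enter j t \<le> i" "i < leave j t" "enter j' t' \<le> i" "i < leave j' t'" by (auto simp: ray_inj)
    then have "move t j = move t' j'"
      using piece_piece[OF row_piece[OF j] row_piece[OF j', folded c]] by linarith
    with ne show False by simp
  qed
  moreover have "set (butlast (p (move (Suc t) j))) \<inter> set (butlast (p (move (Suc t') j'))) = {}"
  proof -
    have "set (p (move (Suc t) j)) \<inter> set (p (move (Suc t') j')) = {}"
      by (rule p_disjoint') (use active_Suc[OF j] active_Suc[OF j'] ne in auto)
    then show ?thesis by (meson disjoint_iff in_set_butlastD)
  qed
  moreover have "x (z (Suc (t + j))) ` {enter j t..<leave j t} \<inter> set (butlast (p (move (Suc t') j'))) = {}"
    using row_part_lane_disjoint[OF j j'] by auto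
  moreover have "x (z (Suc (t' + j'))) ` {enter j' t'..<leave j' t'} \<inter> set (butlast (p (move (Suc t) j))) = {}"
    using row_part_lane_disjoint[OF j' j] by auto
  ultimately show ?thesis unfolding set_row_part by blast
qed

lemma hd_row_part: "j < k t \<Longrightarrow> hd (row_part j t) = last (p (move t j))"
  using enter_less_leave[of j t] enter[of j t] by (simp add: row_part_def hd_append hd_map)

lemma row_part_path:
  assumes j: "j < k t"
  shows "is_path A (row_part j t)"
proof -
  let ?c = "z (Suc (t + j))" and ?p = "p (move (Suc t) j)"
  have lt: "enter j t < leave j t" using enter_less_leave[OF j] .
  have ev: "move (Suc t) j \<in> events" using active_Suc[OF j] by simp
  have path: "is_path A ?p" using p_path[OF ev] .
  have bl: "butlast ?p \<noteq> []" using p_length[OF ev] by (cases ?p) auto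
  have hd: "hd (butlast ?p) = x ?c (leave j t)"
    using leave[OF j] bl by (cases ?p) auto
  have "distinct (row_part j t)"
    unfolding row_part_def using row_part_lane_disjoint[OF j j] path inj_ray
    by (auto simp: distinct_map is_path_def distinct_butlast inj_on_def)
  moreover have "successively (\<lambda>x y. (x, y) \<in> A) (map (x ?c) [enter j t..<leave j t])"
    unfolding successively_map successively_conv_nth by (simp add: ray_arc)
  moreover have "successively (\<lambda>x y. (x, y) \<in> A) (butlast ?p)"
    using path bl by (metis append_butlast_last_id butlast.simps(1) is_path_def successively_append_iff)
  moreover have "last (map (x ?c) [enter j t..<leave j t]) = x ?c (leave j t - 1)"
    using lt by (simp add: last_map)
  moreover have "(x ?c (leave j t - 1), x ?c (leave j t)) \<in> A"
    using ray_arc[of ?c "leave j t - 1"] lt by simp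
  ultimately show ?thesis
    using bl lt hd unfolding is_path_def row_part_def by (simp add: successively_append_iff)
qed

lemma row_part_connect:
  assumes j: "j < k t"
  shows "(last (row_part j t), hd (row_part j (Suc t))) \<in> A"
proof -
  let ?p = "p (move (Suc t) j)"
  have ev: "move (Suc t) j \<in> events" using active_Suc[OF j] by simp
  have bl: "butlast ?p \<noteq> []" using p_length[OF ev] by (cases ?p) auto
  have "successively (\<lambda>x y. (x, y) \<in> A) (butlast ?p @ [last ?p])"
    using p_path[OF ev] by (simp add: is_path_def)
  then have "(last (butlast ?p), last ?p) \<in> A" using bl by (simp add: successively_append_iff)
  then show ?thesis using bl hd_row_part[OF active_Suc[OF j]] by (simp add: row_part_def)
qed

lemma ex_active: "\<exists>t. j < k t"
proof -
  obtain t where "Suc j \<le> k t" using lanes unfolding lane_sequence_def by blast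
  then show ?thesis by (auto simp: Suc_le_eq)
qed

definition start :: "nat \<Rightarrow> nat" where
  "start j = (LEAST t. j < k t)"

lemma start_le_iff: "start j \<le> t \<longleftrightarrow> j < k t"
proof
  assume "start j \<le> t"
  moreover have "j < k (start j)" unfolding start_def using ex_active by (rule LeastI_ex)
  ultimately show "j < k t" using mono_k[of "start j" t] by simp
qed (simp add: start_def Least_le)

lemma ex_row: "\<exists>r. inj r \<and> (\<forall>n. (r n, r (Suc n)) \<in> A) \<and> range r = (\<Union>t\<in>{t. j < k t}. set (row_part j t))"
proof -
  define L where "L n = row_part j (start j + n)" for n
  have act: "j < k (start j + n)" for n using start_le_iff[of j "start j + n"] by simp
  have "is_path A (L n)" "(last (L n), hd (L (Suc n))) \<in> A" for n
    unfolding L_def using row_part_path[OF act[of n]] row_part_connect[OF act[of n]] by simp_all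
  moreover have "set (L m) \<inter> set (L n) = {}" if "m \<noteq> n" for m n
    unfolding L_def using row_part_disjoint[OF act[of m] act[of n]] that by simp
  ultimately obtain r where r: "inj r" "\<And>n. (r n, r (Suc n)) \<in> A" "range r = (\<Union>n. set (L n))"
    using concat_ray[of A L] by metis
  have "t \<in> range (\<lambda>n. start j + n)" if "j < k t" for t
  proof -
    have "start j \<le> t" using that by (simp add: start_le_iff)
    then have "t = start j + (t - start j)" by simp
    then show ?thesis by blast
  qed
  then have "{t. j < k t} = range (\<lambda>n. start j + n)" using act by blast
  then have "range r = (\<Union>t\<in>{t. j < k t}. set (row_part j t))" using r(3) by (simp add: L_def)
  with r show ?thesis by blast
qed

definition row :: "nat \<Rightarrow> nat \<Rightarrow> 'a" where
  "row j = (SOME r. inj r \<and> (\<forall>n. (r n, r (Suc n)) \<in> A) \<and>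
    range r = (\<Union>t\<in>{t. j < k t}. set (row_part j t)))"

lemma row: "inj (row j)" "(row j n, row j (Suc n)) \<in> A"
    "range (row j) = (\<Union>t\<in>{t. j < k t}. set (row_part j t))"
proof -
  have "inj (row j) \<and> (\<forall>n. (row j n, row j (Suc n)) \<in> A) \<and>
      range (row j) = (\<Union>t\<in>{t. j < k t}. set (row_part j t))"
    unfolding row_def by (rule someI_ex[OF ex_row])
  then show "inj (row j)" "(row j n, row j (Suc n)) \<in> A"
    "range (row j) = (\<Union>t\<in>{t. j < k t}. set (row_part j t))" by simp_all
qed

lemma row_eq_iff: "row i m = row j n \<longleftrightarrow> i = j \<and> m = n"
proof
  assume eq: "row i m = row j n"
  obtain t where t: "i < k t" "row i m \<in> set (row_part i t)" using row(3)[of i] by blast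
  obtain t' where t': "j < k t'" "row j n \<in> set (row_part j t')" using row(3)[of j] by blast
  have "i = j" using row_part_disjoint[OF t(1) t'(1)] t(2) t'(2) eq by auto
  then show "i = j \<and> m = n" using row(1)[of j] eq by (simp add: inj_eq)
qed simp

lemma lane_in_row:
  assumes j: "j < k t" and e: "(move t j, e) \<in> prec" "(e, move (Suc t) j) \<in> prec"
    and i: "x (z (Suc (t + j))) i \<in> set (p e)"
  shows "x (z (Suc (t + j))) i \<in> set (row_part j t)"
proof -
  have t: "touches (move t j) (z (Suc (t + j))) (enter j t)" "touches (move (Suc t) j) (z (Suc (t + j))) (leave j t)"
    using row_piece[OF j] unfolding piece_def by blast+
  have "enter j t < i" "i < leave j t" using touches_after[OF e(1) t(1) i] touches_before[OF e(2) i t(2)] .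
  then show ?thesis by (auto simp: set_row_part)
qed

definition up_rung :: "nat \<Rightarrow> nat \<Rightarrow> 'a list" where
  "up_rung j t = map (x (z (Suc (Suc t + j)))) [leave (Suc j) t..<Suc (enter j (Suc t))]"

text \<open>With \<open>Suc j < k t\<close> both rows move at time \<open>t\<close>, so the signal
  of time \<open>Suc t\<close> runs between lanes that they have already entered.\<close>

definition rungs :: "bool \<Rightarrow> nat \<Rightarrow> 'a list set" where
  "rungs d j = (if d then {p (signal (Suc t) j) | t. Suc j < k t} else {up_rung j t | t. Suc j < k t})"

lemma up_piece': "Suc j < k t \<Longrightarrow>
    piece (z (Suc (Suc t + j))) (move (Suc t) (Suc j)) (leave (Suc j) t) (move (Suc t) j) (enter j (Suc t))"
  by (rule up_piece) (auto dest: active_Suc)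

lemma set_inner_up_rung:
  "set (inner (up_rung j t)) = x (z (Suc (Suc t + j))) ` {leave (Suc j) t<..<enter j (Suc t)}"
  unfolding up_rung_def inner_map_upt by (auto simp: image_iff Suc_le_eq)

lemma up_rung_ends:
  assumes "Suc j < k t"
  shows "hd (up_rung j t) = hd (p (move (Suc t) (Suc j)))" "last (up_rung j t) = last (p (move (Suc t) j))"
proof -
  have lt: "leave (Suc j) t < enter j (Suc t)" using piece_less[OF up_piece'[OF assms]] .
  show "hd (up_rung j t) = hd (p (move (Suc t) (Suc j)))"
    using leave[OF assms] lt by (simp add: up_rung_def hd_map del: upt_Suc)
  have "j < k (Suc t)" using active_Suc[OF assms] by simp
  then show "last (up_rung j t) = last (p (move (Suc t) j))"
    using enter[of j "Suc t"] lt by (simp add: up_rung_def)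
qed

lemma inner_up_rung_disjoint:
  assumes j: "Suc j < k t" and v: "v \<in> set (inner (up_rung j t))" and e: "e \<in> events"
  shows "v \<in> set (p e) \<Longrightarrow> even (fst e) \<and> v \<notin> set (inner (p e))"
proof -
  obtain i where i: "v = x (z (Suc (Suc t + j))) i" "leave (Suc j) t < i" "i < enter j (Suc t)"
    using v unfolding set_inner_up_rung by auto
  assume vp: "v \<in> set (p e)"
  have "touches e (z (Suc (Suc t + j))) i \<and> (e = move (Suc t) (Suc j) \<and> i = leave (Suc j) t \<or>
      e = move (Suc t) j \<and> i = enter j (Suc t) \<or> even (fst e))"
    by (rule piece_path[OF up_piece'[OF j] e]) (use vp i in auto)
  then have "touches e (z (Suc (Suc t + j))) i" "even (fst e)" using i by auto
  then show "even (fst e) \<and> v \<notin> set (inner (p e))"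
    using is_path_ends(1)[OF p_path[OF e], of v] i(1) unfolding touches_def by auto
qed

text \<open>Event paths are pairwise disjoint, and a signal meets a piece only in its ends. The
  remaining conflicts, between lane stretches of rows and of backward rungs, are excluded by
  \<open>piece_piece\<close>.\<close>

lemma ladder_row: "ladder A row rungs"
proof
  fix i j m n
  show "row i m = row j n \<longleftrightarrow> i = j \<and> m = n" by (rule row_eq_iff)
  show "(row i m, row i (Suc m)) \<in> A" by (rule row(2))
next
  fix xs d j
  assume "xs \<in> rungs d j"
  then obtain t where t: "Suc j < k t" "xs = (if d then p (signal (Suc t) j) else up_rung j t)"
    unfolding rungs_def by (auto split: if_splits)
  have ev: "signal (Suc t) j \<in> events" using active_Suc[OF t(1)] by simp
  show "is_path A xs"
  proof (cases d)
    case True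
    then show ?thesis using p_path[OF ev] t(2) by simp
  next
    case False
    have "leave (Suc j) t < enter j (Suc t)" using piece_less[OF up_piece'[OF t(1)]] .
    moreover have "successively (\<lambda>x y. (x, y) \<in> A) (up_rung j t)"
      unfolding up_rung_def successively_map successively_conv_nth by (auto simp: ray_arc simp del: upt_Suc)
    moreover have "distinct (up_rung j t)"
      unfolding up_rung_def distinct_map using inj_on_subset[OF inj_ray subset_UNIV] by (simp del: upt_Suc)
    ultimately show ?thesis using t(2) False by (simp add: is_path_def up_rung_def del: upt_Suc)
  qed
next
  fix xs d j j'
  assume "xs \<in> rungs d j"
  then obtain t where t: "Suc j < k t" "xs = (if d then p (signal (Suc t) j) else up_rung j t)"
    unfolding rungs_def by (auto split: if_splits)
  have ev: "signal (Suc t) j \<in> events" using active_Suc[OF t(1)] by simp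
  show "set (inner xs) \<inter> range (row j') = {}"
  proof (rule ccontr)
    assume "set (inner xs) \<inter> range (row j') \<noteq> {}"
    then obtain v t' where v: "v \<in> set (inner xs)" "v \<in> set (row_part j' t')" and j': "j' < k t'"
      using row(3) by fastforce
    have ev': "move (Suc t') j' \<in> events" using active_Suc[OF j'] by simp
    from v(2) consider (path) "v \<in> set (p (move (Suc t') j'))"
      | (lane) i where "v = x (z (Suc (t' + j'))) i" "enter j' t' \<le> i" "i < leave j' t'"
      unfolding set_row_part by (auto dest: in_set_butlastD)
    then show False
    proof cases
      case path
      show False
      proof (cases d)
        case True
        have "signal (Suc t) j \<noteq> move (Suc t') j'" using move_signal_simps(3,4) by metis
        then have "v \<notin> set (p (signal (Suc t) j))" using p_disjoint'[OF ev ev'] path by blast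
        then show False using v(1) t(2) True set_inner_subset by fastforce
      next
        case False
        then show False using inner_up_rung_disjoint[OF t(1) _ ev' path] v(1) t(2) by simp
      qed
    next
      case lane
      show False
      proof (cases d)
        case True
        then have vi: "v \<in> set (inner (p (signal (Suc t) j)))" using v(1) t(2) by simp
        have "touches (signal (Suc t) j) (z (Suc (t' + j'))) i \<and> (signal (Suc t) j = move t' j' \<and> i = enter j' t' \<or>
            signal (Suc t) j = move (Suc t') j' \<and> i = leave j' t' \<or> even (fst (signal (Suc t) j)))"
          by (rule piece_path[OF row_piece[OF j'] ev]) (use subsetD[OF set_inner_subset vi] lane in auto)
        then show False using is_path_ends(1)[OF p_path[OF ev] vi] lane(1) by (auto simp: touches_def)
      next
        case False
        then obtain i' where i': "v = x (z (Suc (Suc t + j))) i'" "leave (Suc j) t < i'" "i' < enter j (Suc t)"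
          using v(1) t(2) unfolding set_inner_up_rung by (auto simp: set_inner_up_rung)
        then have c: "z (Suc (Suc t + j)) = z (Suc (t' + j'))" "i' = i" using lane(1) by (auto simp: ray_inj)
        have "move (Suc t) (Suc j) = move t' j' \<and> move (Suc t) j = move (Suc t') j'"
          by (rule piece_piece[OF up_piece'[OF t(1)] row_piece[OF j', folded c(1)]]) (use c i' lane in auto)
        then show False by auto
      qed
    qed
  qed
next
  fix xs d j ys d' j'
  assume "xs \<in> rungs d j" "ys \<in> rungs d' j'" and ne: "(d, j, xs) \<noteq> (d', j', ys)"
  then obtain t t' where t: "Suc j < k t" "xs = (if d then p (signal (Suc t) j) else up_rung j t)"
      and t': "Suc j' < k t'" "ys = (if d' then p (signal (Suc t') j') else up_rung j' t')"
    unfolding rungs_def by (auto split: if_splits)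
  have ev: "signal (Suc t) j \<in> events" "signal (Suc t') j' \<in> events"
    using active_Suc[OF t(1)] active_Suc[OF t'(1)] by simp_all
  consider "d" "d'" | "d" "\<not> d'" | "\<not> d" "d'" | "\<not> d" "\<not> d'" by blast
  then show "set (inner xs) \<inter> set (inner ys) = {}"
  proof cases
    case 1
    then have "signal (Suc t) j \<noteq> signal (Suc t') j'" using ne t(2) t'(2) by auto
    from p_disjoint'[OF ev this] show ?thesis using 1 t(2) t'(2) set_inner_subset by fastforce
  next
    case 2
    then show ?thesis using inner_up_rung_disjoint[OF t'(1) _ ev(1)] t(2) t'(2) set_inner_subset by fastforce
  next
    case 3
    then show ?thesis using inner_up_rung_disjoint[OF t(1) _ ev(2)] t(2) t'(2) set_inner_subset by fastforce
  next
    case 4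
    show ?thesis
    proof (rule ccontr)
      assume "\<not> ?thesis"
      then obtain i where c: "z (Suc (Suc t + j)) = z (Suc (Suc t' + j'))"
        and i: "leave (Suc j) t < i" "i < enter j (Suc t)" "leave (Suc j') t' < i" "i < enter j' (Suc t')"
        using 4 t(2) t'(2) by (auto simp: set_inner_up_rung ray_inj)
      have "move (Suc t) j = move (Suc t') j'"
        using piece_piece[OF up_piece'[OF t(1)] up_piece'[OF t'(1), folded c]] i by linarith
      then show False using ne t(2) t'(2) 4 by auto
    qed
  qed
next
  fix d j N
  obtain t0 where t0: "Suc j < k t0" using ex_active by blast
  \<comment> \<open>\<open>S t\<close> contains both ends of the rung with parameter
    \<open>t\<close>. From \<open>t0\<close> on these sets are pairwise disjoint, so one of them
    avoids the vertices of both rows up to index \<open>N\<close>.\<close>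
  define S where "S t = (if d then set (p (signal (Suc t) j))
    else set (p (move (Suc t) (Suc j))) \<union> set (p (move (Suc t) j)))" for t
  have act: "Suc j < k t" if "t0 \<le> t" for t using mono_k[OF that] t0 by simp
  have act': "Suc j < k (Suc t)" "j < k (Suc t)" if "t0 \<le> t" for t using active_Suc[OF act[OF that]] by simp_all
  have dj: "S m \<inter> S n = {}" if "t0 \<le> m" "t0 \<le> n" "m \<noteq> n" for m n
  proof -
    have 1: "set (p (signal (Suc m) j)) \<inter> set (p (signal (Suc n) j)) = {}"
      by (rule p_disjoint') (use act' that in auto)
    have 2: "set (p (move (Suc m) a)) \<inter> set (p (move (Suc n) b)) = {}" if "a \<le> Suc j" "b \<le> Suc j" for a b
      by (rule p_disjoint') (use act'(1)[OF \<open>t0 \<le> m\<close>] act'(1)[OF \<open>t0 \<le> n\<close>] that \<open>m \<noteq> n\<close> in auto)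
    show ?thesis using 1 2[of j j] 2[of j "Suc j"] 2[of "Suc j" j] 2[of "Suc j" "Suc j"] unfolding S_def by auto
  qed
  have fin: "finite (row j ` {..N} \<union> row (Suc j) ` {..N})" by simp
  obtain t where t: "t0 \<le> t" "S t \<inter> (row j ` {..N} \<union> row (Suc j) ` {..N}) = {}"
    using disjoint_family_avoids_finite[OF fin, of "{t0..}" S] dj by (auto simp: infinite_Ici)
  let ?xs = "if d then p (signal (Suc t) j) else up_rung j t"
  have xs: "?xs \<in> rungs d j" using act[OF t(1)] by (auto simp: rungs_def)
  have ev: "signal (Suc t) j \<in> events" using act'[OF t(1)] by simp
  have in_range: "hd ?xs \<in> range (row (if d then j else Suc j)) \<and> last ?xs \<in> range (row (if d then Suc j else j))"
  proof (cases d)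
    case True
    have j: "j < k t" "Suc j < k t" using act[OF t(1)] by simp_all
    obtain i where i: "hd (p (signal (Suc t) j)) = x (z (Suc (t + j))) i" using p_hd[OF ev] by auto
    obtain i' where i': "last (p (signal (Suc t) j)) = x (z (Suc (t + Suc j))) i'" using p_last[OF ev] by auto
    have "x (z (Suc (t + j))) i \<in> set (row_part j t)"
      by (rule lane_in_row[OF j(1), of "signal (Suc t) j"]) (use j act'[OF t(1)] p_ends[OF ev] i in auto)
    moreover have "x (z (Suc (t + Suc j))) i' \<in> set (row_part (Suc j) t)"
      by (rule lane_in_row[OF j(2), of "signal (Suc t) j"]) (use j act'[OF t(1)] p_ends[OF ev] i' in auto)
    ultimately show ?thesis using True i i' j row(3)[of j] row(3)[of "Suc j"] by auto
  next
    case False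
    have "move (Suc t) (Suc j) \<in> events" using act'[OF t(1)] by simp
    from p_length[OF this] have "hd (p (move (Suc t) (Suc j))) \<in> set (butlast (p (move (Suc t) (Suc j))))"
      by (cases "p (move (Suc t) (Suc j))") auto
    then have "hd (up_rung j t) \<in> range (row (Suc j))"
      using up_rung_ends(1)[OF act[OF t(1)]] act[OF t(1)] row(3)[of "Suc j"] unfolding set_row_part by auto
    moreover have "row_part j (Suc t) \<noteq> []"
      using row_part_path[OF act'(2)[OF t(1)]] by (simp add: is_path_def)
    then have "last (p (move (Suc t) j)) \<in> set (row_part j (Suc t))"
      using hd_row_part[OF act'(2)[OF t(1)]] hd_in_set by metis
    then have "last (up_rung j t) \<in> range (row j)"
      using up_rung_ends(2)[OF act[OF t(1)]] act'(2)[OF t(1)] row(3)[of j] by auto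
    ultimately show ?thesis using False by simp
  qed
  then obtain m n where mn: "hd ?xs = row (if d then j else Suc j) m" "last ?xs = row (if d then Suc j else j) n"
    by auto
  have "hd ?xs \<in> S t \<and> last ?xs \<in> S t"
  proof (cases d)
    case True
    then show ?thesis using p_ends[OF ev] by (simp add: S_def)
  next
    case False
    then show ?thesis using up_rung_ends[OF act[OF t(1)]] p_ends[of "move (Suc t) (Suc j)"] p_ends[of "move (Suc t) j"]
        act'[OF t(1)] by (simp add: S_def)
  qed
  then have "N < m \<and> N < n" using t(2) mn by (auto simp: not_le[symmetric] split: if_splits)
  with xs mn show "\<exists>xs\<in>rungs d j. \<exists>m n. N < m \<and> N < n \<and> hd xs = row (if d then j else Suc j) m \<and>
      last xs = row (if d then Suc j else j) n" by blast
qed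

text \<open>The walk \<open>q\<close> of a move ends on the lane that the row is about to leave,
  beyond the point of entry by \<open>before\<close> and below the point of departure by
  \<open>q_below\<close>. Hence it ends on the row.\<close>

lemma tends_to_row: "tends A (range (x 0)) (range (row j))"
  unfolding tends_def
proof (intro allI impI)
  fix X :: "'a set" assume X: "finite X"
  have act: "j < k t" if "start j \<le> t" for t using that by (simp add: start_le_iff)
  have dj: "set (q (move (Suc m) j)) \<inter> set (q (move (Suc n) j)) = {}"
    if "start j \<le> m" "start j \<le> n" "m \<noteq> n" for m n
    using q_disjoint[of "move (Suc m) j" "move (Suc n) j"] q_disjoint[of "move (Suc n) j" "move (Suc m) j"]
      act[OF that(1), THEN active_Suc] act[OF that(2), THEN active_Suc] that(3) by (cases "m < n") auto
  obtain t where t: "start j \<le> t" "set (q (move (Suc t) j)) \<inter> X = {}"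
    using disjoint_family_avoids_finite[OF X, of "{start j..}" "\<lambda>t. set (q (move (Suc t) j))"] dj
    by (auto simp: infinite_Ici)
  have j: "j < k t" and ev: "move (Suc t) j \<in> events" using act[OF t(1)] active_Suc by auto
  let ?q = "q (move (Suc t) j)"
  have q: "?q \<noteq> []" "successively (\<lambda>x y. (x, y) \<in> A) ?q" using q_path[OF ev] by (auto simp: is_path_def)
  obtain i where i: "last ?q = x (z (Suc (t + j))) i" using q_last[OF ev] by auto
  have "enter j t < i"
  proof -
    have "below (last (p (move t j))) (last ?q)"
      by (rule before) (use j active_Suc[OF j] p_ends[of "move t j"] in auto)
    then show ?thesis using enter[OF j, symmetric] i unfolding below_def by blast
  qed
  moreover have "i < leave j t" using q_below[OF ev] leave[OF j] i by (auto simp: below_def)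
  ultimately have "last ?q \<in> range (row j)" using row(3)[of j] i j by (auto simp: set_row_part)
  then show "\<exists>u\<in>range (x 0). \<exists>v\<in>range (row j). u \<notin> X \<and> (u, v) \<in> (avoiding A X)\<^sup>*"
    using successively_imp_rtrancl[OF q(2,1) t(2)] q_hd[OF ev] t(2) hd_in_set[OF q(1)] by blast
qed

text \<open>The lanes of a large window are distinct and the row passes through all but the first
  few of them, whereas \<open>X\<close> meets finitely many lanes. On a lane free of
  \<open>X\<close> the row can be abandoned: the lane itself leads on to the ray
  \<open>x 0\<close>.\<close>

lemma row_tends_to: "tends A (range (row j)) (range (x 0))"
  unfolding tends_def
proof (intro allI impI)
  fix X :: "'a set" assume X: "finite X"
  define C where "C = {c. \<exists>i. x c i \<in> X}"
  have C: "finite C" unfolding C_def by (rule finite_on_rays(2)[OF X])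
  have "\<exists>t. j < k t \<and> z (Suc (t + j)) \<notin> C"
  proof (rule ccontr)
    assume "\<not> ?thesis"
    then have all: "z (Suc (t + j)) \<in> C" if "j < k t" for t using that by blast
    obtain t where t: "card C + j + 2 \<le> k t" using lanes unfolding lane_sequence_def by blast
    have "z ` {Suc (t + j)..t + k t} \<subseteq> C"
    proof
      fix c assume "c \<in> z ` {Suc (t + j)..t + k t}"
      then obtain s where s: "c = z s" "Suc (t + j) \<le> s" by auto
      have "t \<le> s - j - 1" using s(2) by linarith
      then have "j < k (s - j - 1)" using mono_k[of t "s - j - 1"] t by simp
      moreover have "Suc (s - j - 1 + j) = s" using s(2) by simp
      ultimately show "c \<in> C" using all[of "s - j - 1"] s(1) by simp
    qed
    moreover have "inj_on z {Suc (t + j)..t + k t}"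
      by (rule inj_onI) (use lane_eq[of _ t] in auto)
    ultimately have "card {Suc (t + j)..t + k t} \<le> card C" using C card_inj_on_le by blast
    then show False using t by simp
  qed
  then obtain t where t: "j < k t" "z (Suc (t + j)) \<notin> C" by blast
  let ?c = "z (Suc (t + j))"
  have nX: "x ?c i \<notin> X" for i using t(2) by (auto simp: C_def)
  have "finite (X \<union> x ?c ` {..<enter j t})" using X by simp
  from tendsD[OF ray_tends this, of ?c 0] obtain u v where uv: "u \<in> range (x ?c)" "v \<in> range (x 0)"
    "u \<notin> X \<union> x ?c ` {..<enter j t}" "(u, v) \<in> (avoiding A (X \<union> x ?c ` {..<enter j t}))\<^sup>*" by metis
  then obtain m where m: "u = x ?c m" "enter j t \<le> m" by (auto simp: not_less[symmetric])
  have "(x ?c (enter j t), x ?c m) \<in> (avoiding A X)\<^sup>*"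
    by (rule follow_ray[of "x ?c" A]) (use ray_arc m nX in auto)
  moreover have "(x ?c m, v) \<in> (avoiding A X)\<^sup>*"
    using avoiding_rtrancl_mono[OF uv(4), of A X] m(1) by simp
  moreover have "x ?c (enter j t) \<in> range (row j)"
    using row(3)[of j] t(1) enter_less_leave[OF t(1)] by (auto simp: set_row_part)
  ultimately show "\<exists>u\<in>range (row j). \<exists>v\<in>range (x 0). u \<notin> X \<and> (u, v) \<in> (avoiding A X)\<^sup>*"
    using uv(2) nX by (meson rtrancl_trans)
qed

end

lemma (in ray_family) ex_ladder:
  obtains R rungs where "ladder A R rungs"
    "\<And>j. tends A (range (x 0)) (range (R j))" "\<And>j. tends A (range (R j)) (range (x 0))"
proof -
  obtain z k where "lane_sequence A x z k" by (rule ex_lane_sequence)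
  then interpret lanes A x z k by unfold_locales
  obtain p q where "woven A x z k p q" using ex_woven by blast
  then interpret woven A x z k p q .
  show thesis using that ladder_row tends_to_row row_tends_to by blast
qed

section \<open>Subdividing the quarter-grid\<close>

text \<open>The ends of the arcs between rows, and the start \<open>(1, 1)\<close>. The residues 3
  and 2 modulo 4 belong to the tails \<open>4 * j + 7\<close> and \<open>4 * j + 2\<close>, the
  residues 1 and 0 to the heads \<open>4 * j + 1\<close> and \<open>4 * j + 8\<close>.\<close>

definition cross_vertices :: "(nat \<times> nat) set" where
  "cross_vertices = {(i, n). 1 \<le> i \<and> 1 \<le> n \<and> (n mod 4 = 1 \<and> (2 \<le> i \<or> n = 1) \<or> n mod 4 = 2 \<and> 2 \<le> i \<or>
    n mod 4 = 3 \<and> 7 \<le> n \<or> n mod 4 = 0 \<and> 8 \<le> n)}"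

lemma qgrid_V_subset: "qgrid_V \<subseteq> cross_vertices"
proof
  fix v assume v: "v \<in> qgrid_V"
  show "v \<in> cross_vertices"
  proof (rule ccontr)
    assume nv: "v \<notin> cross_vertices"
    obtain i n where vin: "v = (i, n)" by (cases v)
    have V0: "1 \<le> i" "1 \<le> n" using v vin by (auto simp: qgrid_V_def qgrid_V0_def)
    have no_in: "\<not> (\<exists>j. i \<ge> 2 \<and> n = 4 * j + 1)" "\<not> (\<exists>j. n = 4 * j + 8)" and n1: "n \<noteq> 1"
      and no_out: "\<not> (\<exists>j. i \<ge> 2 \<and> n = 4 * j + 2)" "\<not> (\<exists>j. n = 4 * j + 7)"
      using nv V0 unfolding cross_vertices_def vin by (auto, presburger+)
    have ins: "{u. (u, v) \<in> qgrid_A0} = {(i, n - 1)}"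
      using no_in n1 V0 unfolding vin qgrid_A0_def by (auto simp: numeral_2_eq_2)
    have outs: "{w. (v, w) \<in> qgrid_A0} = {(i, n + 1)}"
      using no_out V0 unfolding vin qgrid_A0_def by (auto simp: numeral_2_eq_2)
    have "fst u = i" if "(u, v) \<in> qgrid_A0 \<or> (v, u) \<in> qgrid_A0" for u
      using that ins outs by (metis (mono_tags, lifting) fst_conv mem_Collect_eq singletonD)
    then have "v \<in> qgrid_supp"
      unfolding qgrid_supp_def using ins outs V0 by (auto simp: vin qgrid_V0_def)
    with v show False by (simp add: qgrid_V_def)
  qed
qed

lemma qgrid_supp_neighbour: "v \<in> qgrid_supp \<Longrightarrow> (u, v) \<in> qgrid_A0 \<or> (v, u) \<in> qgrid_A0 \<Longrightarrow> fst u = fst v"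
  unfolding qgrid_supp_def by (elim CollectE conjE allE[of _ u]) (erule mp)

text \<open>All neighbours of a suppressed vertex lie in its row, so a walk through suppressed
  vertices stays in one row, and an arc between rows survives suppression unchanged.\<close>

lemma qgrid_A_cases:
  assumes "(u, w) \<in> qgrid_A"
  obtains (row) i n n' where "u = (i, n)" "w = (i, n')" "1 \<le> i" "n < n'" "\<And>m. n < m \<Longrightarrow> m < n' \<Longrightarrow> (i, m) \<in> qgrid_supp"
    | (down) i j where "1 \<le> i" "u = (i, 4 * j + 7)" "w = (Suc i, 4 * j + 1)"
    | (up) i j where "1 \<le> i" "u = (Suc i, 4 * j + 2)" "w = (i, 4 * j + 8)"
proof -
  obtain y where y: "(u, y) \<in> (qgrid_A0 \<inter> (UNIV \<times> qgrid_supp))\<^sup>*" "(y, w) \<in> qgrid_A0"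
    using assms by (auto simp: qgrid_A_def)
  have arc: "snd b = Suc (snd a) \<and> 1 \<le> fst a" if "(a, b) \<in> qgrid_A0" "fst a = fst b" for a b
    using that by (auto simp: qgrid_A0_def)
  from y(1) have "y = u \<or> fst y = fst u \<and> y \<in> qgrid_supp \<and> snd u < snd y \<and>
      (\<forall>m. snd u < m \<longrightarrow> m < snd y \<longrightarrow> (fst u, m) \<in> qgrid_supp)"
  proof (induction rule: rtrancl_induct)
    case (step a b)
    then have ab: "(a, b) \<in> qgrid_A0" "b \<in> qgrid_supp" by auto
    then have "fst a = fst b" using qgrid_supp_neighbour by blast
    then have "snd b = Suc (snd a)" using arc ab by auto
    with step.IH \<open>fst a = fst b\<close> ab(2) show ?case by (metis less_Suc_eq not_less_eq prod.collapse)
  qed simp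
  then consider "y = u" | "fst y = fst u" "y \<in> qgrid_supp" "snd u < snd y"
      "\<And>m. snd u < m \<Longrightarrow> m < snd y \<Longrightarrow> (fst u, m) \<in> qgrid_supp" by blast
  then show thesis
  proof cases
    case 1
    with y(2) consider i n where "u = (i, n)" "w = (i, Suc n)" "1 \<le> i"
      | i j where "1 \<le> i" "u = (i, 4 * j + 7)" "w = (i + 1, 4 * j + 1)"
      | i j where "1 \<le> i" "u = (i + 1, 4 * j + 2)" "w = (i, 4 * j + 8)"
      unfolding qgrid_A0_def by blast
    then show thesis
    proof cases
      case 1
      show thesis by (rule row[OF 1(1,2,3)]) auto
    next
      case 2
      then show thesis using down by simp
    next
      case 3
      then show thesis using up by simp
    qed
  next
    case 2
    have eq: "fst y = fst w" using qgrid_supp_neighbour[OF 2(2)] y(2) by metis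
    have w: "snd w = Suc (snd y)" "1 \<le> fst y" using arc[OF y(2) eq] by auto
    show thesis
    proof (rule row[of "fst u" "snd u" "snd w"])
      fix m assume m: "snd u < m" "m < snd w"
      show "(fst u, m) \<in> qgrid_supp"
      proof (cases "m = snd y")
        case True
        then show ?thesis using 2(1,2) by (metis prod.collapse)
      qed (use m w 2(4) in auto)
    qed (use 2 w eq in \<open>auto simp: prod_eq_iff\<close>)
  qed
qed

context ladder
begin

definition is_rung :: "bool \<Rightarrow> nat \<Rightarrow> nat \<Rightarrow> 'v list \<times> nat \<times> nat \<Rightarrow> bool" where
  "is_rung d i N r \<longleftrightarrow> fst r \<in> rungs d i \<and> N < fst (snd r) \<and> N < snd (snd r) \<and>
    hd (fst r) = R (if d then i else Suc i) (fst (snd r)) \<and> last (fst r) = R (if d then Suc i else i) (snd (snd r))"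

definition pick :: "bool \<Rightarrow> nat \<Rightarrow> nat \<Rightarrow> 'v list \<times> nat \<times> nat" where
  "pick d i N = (SOME r. is_rung d i N r)"

lemma pick: "is_rung d i N (pick d i N)"
proof -
  obtain xs m n where "xs \<in> rungs d i" "N < m" "N < n" "hd xs = R (if d then i else Suc i) m"
      "last xs = R (if d then Suc i else i) n" using rung_ex by metis
  then have "is_rung d i N (xs, m, n)" by (simp add: is_rung_def)
  then show ?thesis unfolding pick_def by (rule someI)
qed

text \<open>The vertex \<open>(i, n)\<close> of the grid has potential \<open>n + 6 * i\<close>: arcs between rows preserve it.\<close>
definition potential :: "bool \<Rightarrow> nat \<Rightarrow> nat \<Rightarrow> nat" where
  "potential d i j = 4 * j + 6 * i + (if d then 7 else 8)"

lemma finite_potential: "finite {(d, i, j). potential d i j = c}"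
proof (rule finite_subset)
  show "{(d, i, j). potential d i j = c} \<subseteq> UNIV \<times> {..c} \<times> {..c}"
    by (auto simp: potential_def split: if_splits)
qed simp

text \<open>The rungs of potential \<open>c\<close> are picked beyond \<open>bound c\<close>, and
  \<open>bound (Suc c)\<close> is at least all their indices; the maximum exists by
  \<open>finite_potential\<close>. Rungs of equal potential can be picked independently, because in
  a given row the potential \<open>n + 6 * i\<close> determines \<open>n\<close>.\<close>

primrec bound :: "nat \<Rightarrow> nat" where
  "bound 0 = 0"
| "bound (Suc c) = Max (insert (bound c) ((\<lambda>(d, i, j). max (fst (snd (pick d i (bound c))))
    (snd (snd (pick d i (bound c))))) ` {(d, i, j). potential d i j = c}))"

definition cross :: "bool \<Rightarrow> nat \<Rightarrow> nat \<Rightarrow> 'v list" where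
  "cross d i j = fst (pick d i (bound (potential d i j)))"

definition src :: "bool \<Rightarrow> nat \<Rightarrow> nat \<Rightarrow> nat" where
  "src d i j = fst (snd (pick d i (bound (potential d i j))))"

definition dst :: "bool \<Rightarrow> nat \<Rightarrow> nat \<Rightarrow> nat" where
  "dst d i j = snd (snd (pick d i (bound (potential d i j))))"

lemma cross_rung: "cross d i j \<in> rungs d i"
  and cross_hd: "hd (cross d i j) = R (if d then i else Suc i) (src d i j)"
  and cross_last: "last (cross d i j) = R (if d then Suc i else i) (dst d i j)"
  and bound_less: "bound (potential d i j) < src d i j" "bound (potential d i j) < dst d i j"
  using pick[of d i "bound (potential d i j)"] by (simp_all add: cross_def src_def dst_def is_rung_def)

lemma bound_mono: "c \<le> c' \<Longrightarrow> bound c \<le> bound c'"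
proof (rule lift_Suc_mono_le[of bound])
  show "bound n \<le> bound (Suc n)" for n using finite_potential by simp
qed

lemma le_bound: "src d i j \<le> bound (Suc (potential d i j))" "dst d i j \<le> bound (Suc (potential d i j))"
proof -
  have "max (src d i j) (dst d i j) = (\<lambda>(d', i', j'). max (fst (snd (pick d' i' (bound (potential d i j)))))
    (snd (snd (pick d' i' (bound (potential d i j)))))) (d, i, j)" by (simp add: src_def dst_def)
  then have "max (src d i j) (dst d i j) \<le> bound (Suc (potential d i j))"
    unfolding bound.simps using finite_potential[of "potential d i j"]
    by (intro Max_ge finite.insertI finite_imageI insertI2) (auto intro!: image_eqI[of _ _ "(d, i, j)"])
  then show "src d i j \<le> bound (Suc (potential d i j))" "dst d i j \<le> bound (Suc (potential d i j))" by auto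
qed

lemma potential_less:
  assumes "potential d i j < potential d' i' j'"
  shows "src d i j < src d' i' j'" "src d i j < dst d' i' j'" "dst d i j < src d' i' j'" "dst d i j < dst d' i' j'"
  using le_bound[of d i j] bound_less[of d' i' j'] bound_mono[of "Suc (potential d i j)" "potential d' i' j'"] assms
  by simp_all

text \<open>The index on \<open>R i\<close> at which the grid vertex \<open>(i, n)\<close> is
  placed. The residue of \<open>n\<close> tells which end of which rung it is, and the offsets after
  \<open>n div 4\<close> undo the summands 7 and 8. The value 0 is for
  \<open>(1, 1)\<close>.\<close>

definition pos :: "nat \<times> nat \<Rightarrow> nat" where
  "pos = (\<lambda>(i, n). if n mod 4 = 1 then (if 2 \<le> i then dst True (i - 1) (n div 4) else 0)
    else if n mod 4 = 2 then src False (i - 1) (n div 4)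
    else if n mod 4 = 3 then src True i (n div 4 - 1)
    else dst False i (n div 4 - 2))"

lemma pos_simps:
  "pos (i, 4 * j + 7) = src True i j" "1 \<le> i \<Longrightarrow> pos (Suc i, 4 * j + 1) = dst True i j"
  "pos (Suc i, 4 * j + 2) = src False i j" "pos (i, 4 * j + 8) = dst False i j"
proof -
  have "(4 * j + 7) mod 4 = 3" "(4 * j + 7) div 4 = j + 1" "(4 * j + 1) mod 4 = 1" "(4 * j + 1) div 4 = j"
    "(4 * j + 2) mod 4 = 2" "(4 * j + 2) div 4 = j" "(4 * j + 8) mod 4 = 0" "(4 * j + 8) div 4 = j + 2"
    by presburger+
  then show "pos (i, 4 * j + 7) = src True i j" "1 \<le> i \<Longrightarrow> pos (Suc i, 4 * j + 1) = dst True i j"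
    "pos (Suc i, 4 * j + 2) = src False i j" "pos (i, 4 * j + 8) = dst False i j"
    unfolding pos_def by auto
qed

lemma cross_vertices_cases:
  assumes "v \<in> cross_vertices" "v \<noteq> (1, 1)"
  obtains i j where "v = (i, 4 * j + 7)" | i j where "1 \<le> i" "v = (Suc i, 4 * j + 1)"
    | i j where "v = (Suc i, 4 * j + 2)" | i j where "v = (i, 4 * j + 8)"
proof -
  obtain i n where v: "v = (i, n)" by (cases v)
  have n: "n = 4 * (n div 4) + n mod 4" by simp
  from assms v consider "n mod 4 = 1" "2 \<le> i" | "n mod 4 = 2" "2 \<le> i" | "n mod 4 = 3" "7 \<le> n" | "n mod 4 = 0" "8 \<le> n"
    by (auto simp: cross_vertices_def)
  then show thesis
  proof cases
    case 1
    then show thesis using that(2)[of "i - 1" "n div 4"] n v by simp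
  next
    case 2
    then show thesis using that(3)[of "i - 1" "n div 4"] n v by simp
  next
    case 3
    then have "n = 4 * (n div 4 - 1) + 7" by presburger
    then show thesis using that(1)[of i "n div 4 - 1"] v by metis
  next
    case 4
    then have "n = 4 * (n div 4 - 2) + 8" by presburger
    then show thesis using that(4)[of i "n div 4 - 2"] v by metis
  qed
qed

lemma pos_bounds:
  assumes "v \<in> cross_vertices" "v \<noteq> (1, 1)"
  shows "bound (snd v + 6 * fst v) < pos v" "pos v \<le> bound (Suc (snd v + 6 * fst v))"
proof -
  from assms have "bound (snd v + 6 * fst v) < pos v \<and> pos v \<le> bound (Suc (snd v + 6 * fst v))"
  proof (cases rule: cross_vertices_cases)
    case (1 i j)
    then have "snd v + 6 * fst v = potential True i j" by (simp add: potential_def)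
    then show ?thesis using 1 bound_less[of True i j] le_bound[of True i j] by (simp only: pos_simps simp_thms)
  next
    case (2 i j)
    then have "snd v + 6 * fst v = potential True i j" by (simp add: potential_def)
    then show ?thesis using 2 bound_less[of True i j] le_bound[of True i j] by (simp only: pos_simps simp_thms)
  next
    case (3 i j)
    then have "snd v + 6 * fst v = potential False i j" by (simp add: potential_def)
    then show ?thesis using 3 bound_less[of False i j] le_bound[of False i j] by (simp only: pos_simps simp_thms)
  next
    case (4 i j)
    then have "snd v + 6 * fst v = potential False i j" by (simp add: potential_def)
    then show ?thesis using 4 bound_less[of False i j] le_bound[of False i j] by (simp only: pos_simps simp_thms)
  qed
  then show "bound (snd v + 6 * fst v) < pos v" "pos v \<le> bound (Suc (snd v + 6 * fst v))" by auto
qed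

text \<open>Within a row the potential grows with \<open>n\<close>, and by \<open>pos_bounds\<close>
  positions of potential \<open>c\<close> lie above \<open>bound c\<close> and not above
  \<open>bound (Suc c)\<close>; these intervals follow one another. The vertex \<open>(1, 1)\<close>
  comes first because the lower bound is strict.\<close>

lemma pos_mono:
  assumes "(i, n) \<in> qgrid_V" "(i, n') \<in> qgrid_V" "n < n'"
  shows "pos (i, n) < pos (i, n')"
proof -
  have cv: "(i, n) \<in> cross_vertices" "(i, n') \<in> cross_vertices" using assms qgrid_V_subset by auto
  have n': "(i, n') \<noteq> (1, 1)" using assms(3) cv by (auto simp: cross_vertices_def)
  show ?thesis
  proof (cases "(i, n) = (1, 1)")
    case True
    then show ?thesis using pos_bounds(1)[OF cv(2) n'] by (simp add: pos_def)
  next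
    case False
    have "bound (Suc (n + 6 * i)) \<le> bound (n' + 6 * i)" by (rule bound_mono) (use assms(3) in simp)
    then show ?thesis using pos_bounds(1)[OF cv(2) n'] pos_bounds(2)[OF cv(1) False] by simp
  qed
qed

lemma pos_less_iff:
  assumes "(i, n) \<in> qgrid_V" "(i, n') \<in> qgrid_V"
  shows "pos (i, n) < pos (i, n') \<longleftrightarrow> n < n'"
  using pos_mono[OF assms] pos_mono[OF assms(2,1)] by (cases n n' rule: linorder_cases) auto

definition branch :: "nat \<times> nat \<Rightarrow> 'v" where
  "branch v = R (fst v) (pos v)"

definition route :: "(nat \<times> nat) \<times> (nat \<times> nat) \<Rightarrow> 'v list" where
  "route e = (let (u, w) = e in if fst u = fst w then map (R (fst u)) [pos u..<Suc (pos w)]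
    else if fst u < fst w then cross True (fst u) (snd w div 4) else cross False (fst w) (snd u div 4))"

lemma route_cases:
  assumes "e \<in> qgrid_A"
  obtains (row) i n n' where "e = ((i, n), (i, n'))" "1 \<le> i" "(i, n) \<in> qgrid_V" "(i, n') \<in> qgrid_V" "n < n'"
      "\<And>m. (i, m) \<in> qgrid_V \<Longrightarrow> m \<le> n \<or> n' \<le> m" "route e = map (R i) [pos (i, n)..<Suc (pos (i, n'))]"
    | (cross) d i j where "1 \<le> i" "route e = cross d i j"
      "e = (if d then ((i, 4 * j + 7), (Suc i, 4 * j + 1)) else ((Suc i, 4 * j + 2), (i, 4 * j + 8)))"
      "branch (fst e) = hd (cross d i j)" "branch (snd e) = last (cross d i j)"
proof -
  obtain u w where e: "e = (u, w)" by (cases e)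
  have V: "u \<in> qgrid_V" "w \<in> qgrid_V" using assms by (auto simp: e qgrid_A_def)
  have div: "(4 * j + 1) div 4 = j" "(4 * j + 2) div 4 = j" for j :: nat by presburger+
  from assms[unfolded e] show thesis
  proof (cases rule: qgrid_A_cases)
    case (row i n n')
    have "m \<le> n \<or> n' \<le> m" if "(i, m) \<in> qgrid_V" for m
      using row(5)[of m] that unfolding qgrid_V_def by (meson DiffD2 not_le)
    then show thesis using row V by (intro that(1)[of i n n']) (auto simp: e route_def)
  next
    case (down i j)
    then have "route e = cross True i j" using div(1)[of j] by (simp add: e route_def)
    then show thesis
      using down pos_simps(1)[of i j] pos_simps(2)[of i j] cross_hd[of True i j] cross_last[of True i j]
      by (intro that(2)[of i True j]) (simp_all add: e branch_def)
  next
    case (up i j)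
    then have "route e = cross False i j" using div(2)[of j] by (simp add: e route_def)
    then show thesis
      using up pos_simps(3)[of i j] pos_simps(4)[of i j] cross_hd[of False i j] cross_last[of False i j]
      by (intro that(2)[of i False j]) (simp_all add: e branch_def)
  qed
qed

lemma cross_inner_row: "set (inner (cross d i j)) \<inter> range (R i') = {}"
  by (rule rung_inner[OF cross_rung])

lemma src_inj: "src d i j = src d i j' \<longleftrightarrow> j = j'"
  using potential_less(1)[of d i j d i j'] potential_less(1)[of d i j' d i j]
  by (cases j j' rule: linorder_cases) (simp_all add: potential_def)

lemma cross_eq_iff: "cross d i j = cross d i j' \<longleftrightarrow> j = j'"
proof
  assume "cross d i j = cross d i j'"
  then have "R (if d then i else Suc i) (src d i j) = R (if d then i else Suc i) (src d i j')"
    by (simp add: cross_hd[symmetric])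
  then show "j = j'" by (simp add: row_inj src_inj)
qed simp

lemma cross_inner_disjoint:
  assumes "(d, i, j) \<noteq> (d', i', j')"
  shows "set (inner (cross d i j)) \<inter> set (inner (cross d' i' j')) = {}"
proof (rule rung_disjoint[OF cross_rung cross_rung], rule notI)
  assume eq: "(d, i, cross d i j) = (d', i', cross d' i' j')"
  then have "d' = d" "i' = i" by simp_all
  with eq assms show False by (simp add: cross_eq_iff)
qed

lemma cross_path: "is_path A (cross d i j)"
  by (rule rung_path[OF cross_rung])

lemma cross_length: "2 \<le> length (cross d i j)"
proof -
  have "hd (cross d i j) \<noteq> last (cross d i j)" by (simp add: cross_hd cross_last row_inj)
  then show ?thesis using cross_path[of d i j]
    by (cases "cross d i j"; cases "tl (cross d i j)") (auto simp: is_path_def)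
qed

lemma route_path:
  assumes "e \<in> qgrid_A"
  shows "is_path A (route e)" "2 \<le> length (route e)" "hd (route e) = branch (fst e)" "last (route e) = branch (snd e)"
    "set (inner (route e)) \<inter> branch ` qgrid_V = {}"
proof -
  from assms have "is_path A (route e) \<and> 2 \<le> length (route e) \<and> hd (route e) = branch (fst e) \<and>
    last (route e) = branch (snd e) \<and> set (inner (route e)) \<inter> branch ` qgrid_V = {}"
  proof (cases rule: route_cases)
    case (row i n n')
    have lt: "pos (i, n) < pos (i, n')" using pos_mono row by blast
    have "inj_on (R i) S" for S by (auto simp: inj_on_def row_inj)
    then have "distinct (route e)" unfolding row(7) distinct_map by simp
    moreover have "successively (\<lambda>x y. (x, y) \<in> A) (route e)"
      unfolding row(7) successively_map successively_conv_nth by (auto simp: row_arc simp del: upt_Suc)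
    moreover have "set (inner (route e)) \<inter> branch ` qgrid_V = {}"
    proof (rule ccontr)
      assume "\<not> ?thesis"
      then obtain l v where l: "pos (i, n) < l" "l < pos (i, n')" and v: "v \<in> qgrid_V" "R i l = branch v"
        unfolding row(7) inner_map_upt by (auto simp: Suc_le_eq)
      then obtain m where "v = (i, m)" "l = pos (i, m)" by (cases v) (auto simp: branch_def row_inj)
      then have "(i, m) \<in> qgrid_V" "n < m" "m < n'" using l v pos_less_iff row(3,4) by auto
      then show False using row(6)[of m] by simp
    qed
    moreover have "route e \<noteq> []" "hd (route e) = R i (pos (i, n))"
      unfolding row(7) using lt by (simp_all add: hd_map del: upt_Suc)
    moreover have "2 \<le> length (route e)" "last (route e) = R i (pos (i, n'))"
      unfolding row(7) using lt by simp_all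
    ultimately show ?thesis using row(1) by (simp add: is_path_def branch_def)
  next
    case (cross d i j)
    have "branch v \<notin> set (inner (cross d i j))" for v
      unfolding branch_def using cross_inner_row[of d i j "fst v"] by blast
    then have "set (inner (cross d i j)) \<inter> branch ` qgrid_V = {}" by blast
    then show ?thesis unfolding cross(2,4,5) using cross_path[of d i j] cross_length[of d i j] by blast
  qed
  then show "is_path A (route e)" "2 \<le> length (route e)" "hd (route e) = branch (fst e)"
    "last (route e) = branch (snd e)" "set (inner (route e)) \<inter> branch ` qgrid_V = {}" by auto
qed

lemma route_inner_disjoint:
  assumes e: "e \<in> qgrid_A" "e' \<in> qgrid_A" "e \<noteq> e'"
  shows "set (inner (route e)) \<inter> set (inner (route e')) = {}"
  using e(1)
proof (cases rule: route_cases)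
  case row: (row i n n')
  have sub: "set (inner (route e)) = R i ` {pos (i, n)<..<pos (i, n')}"
    unfolding row(7) inner_map_upt by (auto simp: image_iff Suc_le_eq)
  from e(2) show ?thesis
  proof (cases rule: route_cases)
    case row': (row a m m')
    have sub': "set (inner (route e')) = R a ` {pos (a, m)<..<pos (a, m')}"
      unfolding row'(7) inner_map_upt by (auto simp: image_iff Suc_le_eq)
    show ?thesis
    proof (rule ccontr)
      assume "\<not> ?thesis"
      then obtain l l' where "R i l = R a l'" and l: "pos (i, n) < l" "l < pos (i, n')" "pos (a, m) < l'" "l' < pos (a, m')"
        unfolding sub sub' by (smt (verit, del_insts) disjoint_iff greaterThanLessThan_iff imageE)
      then have a: "a = i" and l: "pos (i, n) < l" "l < pos (i, n')" "pos (i, m) < l" "l < pos (i, m')"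
        by (simp_all add: row_inj)
      \<comment> \<open>Both segments join consecutive grid vertices of the row. If they overlapped
        without being equal, an end of one would lie strictly inside the other.\<close>
      have "n < m'" "m < n'" using l pos_less_iff row(3,4) row'(3,4) a by (meson less_trans)+
      then have "n = m" "n' = m'"
        using row(6)[of m] row(6)[of m'] row'(6)[of n] row'(6)[of n'] row(3,4) row'(3,4) a by auto
      with e(3) row(1) row'(1) a show False by simp
    qed
  next
    case (cross d a j)
    then show ?thesis using cross_inner_row[of d a j i] unfolding sub by auto
  qed
next
  case cross: (cross d i j)
  from e(2) show ?thesis
  proof (cases rule: route_cases)
    case (row a m m')
    have "set (inner (route e')) \<subseteq> range (R a)" unfolding row(7) inner_map_upt by auto
    then show ?thesis using cross_inner_row[of d i j a] cross(2) by auto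
  next
    case cross': (cross d' i' j')
    have "(d, i, j) \<noteq> (d', i', j')"
    proof
      assume "(d, i, j) = (d', i', j')"
      then have "e = e'" unfolding cross(3) cross'(3) by simp
      with e(3) show False by contradiction
    qed
    then show ?thesis using cross_inner_disjoint cross(2) cross'(2) by simp
  qed
qed

lemma subdivision_route:
  assumes "A \<subseteq> V \<times> V"
  shows "subdivision_in V A qgrid_V qgrid_A branch route"
proof -
  have RV: "R i m \<in> V" for i m using row_arc[of i m] assms by auto
  have inj: "inj_on branch qgrid_V"
  proof (rule inj_onI)
    fix v w assume v: "v \<in> qgrid_V" "w \<in> qgrid_V" "branch v = branch w"
    then obtain i n m where "v = (i, n)" "w = (i, m)" "pos (i, n) = pos (i, m)"
      by (cases v; cases w) (auto simp: branch_def row_inj)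
    then show "v = w" using v pos_mono by (metis linorder_neqE_nat less_irrefl)
  qed
  have ends: "u \<in> qgrid_V \<and> w \<in> qgrid_V" if "(u, w) \<in> qgrid_A" for u w using that by (simp add: qgrid_A_def)
  have disj: "set (inner (route e)) \<inter> set (route e') = {}" if e: "e \<in> qgrid_A" "e' \<in> qgrid_A" "e \<noteq> e'" for e e'
  proof -
    have "route e' \<noteq> []" using route_path(1)[OF e(2)] by (simp add: is_path_def)
    then have "set (route e') \<subseteq> {branch (fst e'), branch (snd e')} \<union> set (inner (route e'))"
      using set_subset_inner route_path(3,4)[OF e(2)] by metis
    moreover have "{branch (fst e'), branch (snd e')} \<subseteq> branch ` qgrid_V"
      using ends[of "fst e'" "snd e'"] e(2) by simp
    ultimately show ?thesis using route_inner_disjoint[OF e] route_path(5)[OF e(1)] by blast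
  qed
  have path: "dipath V A (route e)" if "e \<in> qgrid_A" for e
  proof -
    have p: "is_path A (route e)" using route_path(1)[OF that] .
    have "hd (route e) \<in> V" using route_path(3)[OF that] RV by (simp add: branch_def)
    then have "set (route e) \<subseteq> V" using successively_subset[OF _ assms] p by (simp add: is_path_def)
    then show ?thesis using p by (simp add: dipath_iff is_path_def)
  qed
  show ?thesis
    unfolding subdivision_in_def
  proof (intro conjI ballI impI)
    show "branch ` qgrid_V \<subseteq> V" using RV by (auto simp: branch_def)
  next
    fix e assume e: "e \<in> qgrid_A"
    obtain u w where uw: "e = (u, w)" by (cases e)
    show "case e of (a, b) \<Rightarrow> dipath V A (route (a, b)) \<and> 2 \<le> length (route (a, b)) \<and>
        hd (route (a, b)) = branch a \<and> last (route (a, b)) = branch b \<and>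
        set (inner (route (a, b))) \<inter> branch ` qgrid_V = {}"
      using path[OF e] route_path(2-5)[OF e] unfolding uw by simp
  qed (use inj disj in simp_all)
qed

end

section \<open>Rays of the subdivision\<close>

lemma path_arcs_iff: "(u, v) \<in> path_arcs xs \<longleftrightarrow> (\<exists>q. Suc q < length xs \<and> u = xs ! q \<and> v = xs ! Suc q)"
  by (auto simp: path_arcs_def set_zip nth_tl less_diff_conv)

lemma nth_in_inner:
  assumes "0 < q" "Suc q < length xs"
  shows "xs ! q \<in> set (inner xs)"
proof -
  have "xs = take q xs @ xs ! q # drop (Suc q) xs" using assms by (simp add: id_take_nth_drop)
  moreover have "take q xs \<noteq> []" "drop (Suc q) xs \<noteq> []" using assms by auto
  ultimately show ?thesis unfolding set_inner_split by blast
qed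

context ladder
begin

lemma set_cross: "set (cross d i j) \<subseteq> {R (if d then i else Suc i) (src d i j), R (if d then Suc i else i) (dst d i j)} \<union>
    set (inner (cross d i j))"
  using set_subset_inner[of "cross d i j"] cross_path[of d i j] cross_hd[of d i j] cross_last[of d i j]
  unfolding is_path_def by simp

lemma dst_inj: "dst d i j = dst d i j' \<longleftrightarrow> j = j'"
  using potential_less(4)[of d i j d i j'] potential_less(4)[of d i j' d i j]
  by (cases j j' rule: linorder_cases) (simp_all add: potential_def)

lemma cross_disjoint:
  assumes "j \<noteq> j'"
  shows "set (cross d i j) \<inter> set (cross d i j') = {}"
proof -
  have "set (inner (cross d i j)) \<inter> set (inner (cross d i j')) = {}"
    by (rule cross_inner_disjoint) (use assms in simp)
  moreover have "R a m \<notin> set (inner (cross d i j))" "R a m \<notin> set (inner (cross d i j'))" for a m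
    using cross_inner_row by blast+
  moreover have "src d i j \<noteq> src d i j'" "dst d i j \<noteq> dst d i j'" using assms by (simp_all add: src_inj dst_inj)
  ultimately have "({R (if d then i else Suc i) (src d i j), R (if d then Suc i else i) (dst d i j)} \<union>
      set (inner (cross d i j))) \<inter> ({R (if d then i else Suc i) (src d i j'), R (if d then Suc i else i) (dst d i j')} \<union>
      set (inner (cross d i j'))) = {}" by (auto simp: row_inj)
  then show ?thesis using set_cross[of d i j] set_cross[of d i j'] by blast
qed

lemma cross_avoid:
  assumes "finite X"
  obtains j where "set (cross d i j) \<inter> X = {}" "N \<le> src d i j" "N \<le> dst d i j"
proof -
  let ?Y = "X \<union> R (if d then i else Suc i) ` {..<N} \<union> R (if d then Suc i else i) ` {..<N}"
  have "finite ?Y" using assms by simp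
  then obtain j where j: "set (cross d i j) \<inter> ?Y = {}"
    using disjoint_family_avoids_finite[of ?Y "UNIV :: nat set" "\<lambda>j. set (cross d i j)"] cross_disjoint by auto
  have ne: "cross d i j \<noteq> []" using cross_path by (simp add: is_path_def)
  have "R (if d then i else Suc i) (src d i j) \<notin> ?Y" "R (if d then Suc i else i) (dst d i j) \<notin> ?Y"
    using hd_in_set[OF ne] last_in_set[OF ne] j cross_hd[of d i j] cross_last[of d i j] by auto
  then have "N \<le> src d i j" "N \<le> dst d i j" by (auto simp: not_less[symmetric])
  with j show thesis using that by blast
qed

lemma reach_cross:
  assumes "set (cross d i j) \<inter> X = {}"
  shows "(R (if d then i else Suc i) (src d i j), R (if d then Suc i else i) (dst d i j)) \<in> (avoiding A X)\<^sup>*"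
  using successively_imp_rtrancl[of A "cross d i j" X] assms cross_path[of d i j]
  by (simp add: is_path_def cross_hd cross_last)

lemma reach_row:
  assumes "m \<le> n" "\<And>l. R i l \<notin> X"
  shows "(R i m, R i n) \<in> (avoiding A X)\<^sup>*"
  using follow_ray[of "R i" A m n X, OF row_arc assms(1)] assms(2) by blast

lemma inj_row: "inj (R i)"
  by (simp add: inj_def row_inj)

lemma tends_neighbours: "tends A (range (R (if d then i else Suc i))) (range (R (if d then Suc i else i)))"
  unfolding tends_def
proof (intro allI impI)
  fix X :: "'v set" assume "finite X"
  then obtain j where j: "set (cross d i j) \<inter> X = {}" using cross_avoid[where N = 0] by metis
  have "cross d i j \<noteq> []" using cross_path by (simp add: is_path_def)
  then have "R (if d then i else Suc i) (src d i j) \<notin> X" using j cross_hd[of d i j] hd_in_set by fastforce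
  then show "\<exists>u\<in>range (R (if d then i else Suc i)). \<exists>v\<in>range (R (if d then Suc i else i)).
      u \<notin> X \<and> (u, v) \<in> (avoiding A X)\<^sup>*" using reach_cross[OF j] by (meson rangeI)
qed

lemma tends_rows: "tends A (range (R i)) (range (R j))"
proof (cases "i \<le> j")
  case True
  then show ?thesis
  proof (induction j rule: dec_induct)
    case base
    show ?case by (rule tends_infinite_Int) (simp add: range_inj_infinite[OF inj_row])
  next
    case (step n)
    show ?case by (rule tends_trans_ray[OF step.IH _ inj_row row_arc]) (use tends_neighbours[of True n] in simp)
  qed
next
  case False
  then have "j \<le> i" by simp
  then show ?thesis
  proof (induction i rule: dec_induct)
    case base
    show ?case by (rule tends_infinite_Int) (simp add: range_inj_infinite[OF inj_row])
  next
    case (step n)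
    show ?case by (rule tends_trans_ray[OF _ step.IH inj_row row_arc]) (use tends_neighbours[of False n] in simp)
  qed
qed

text \<open>A vertex lies on at most one row or else inside at most one rung, and the rungs
  \<open>cross d i j\<close> have their ends in the rows \<open>i\<close> and \<open>Suc i\<close>.
  So every single vertex is missed by all sufficiently high rows and rungs.\<close>

lemma finite_rows_bound:
  assumes "finite X"
  obtains i0 where "\<And>i l. i0 < i \<Longrightarrow> R i l \<notin> X" "\<And>d i j. i0 < i \<Longrightarrow> set (cross d i j) \<inter> X = {}"
proof -
  have "\<exists>b. \<forall>i>b. (\<forall>l. R i l \<noteq> v) \<and> (\<forall>d j. v \<notin> set (cross d i j))" for v
  proof (cases "\<exists>a m. v = R a m")
    case True
    then obtain a m where v: "v = R a m" by auto
    have "v \<notin> set (cross d i j)" if "a < i" for d i j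
    proof
      assume "v \<in> set (cross d i j)"
      then have "R a m = R (if d then i else Suc i) (src d i j) \<or> R a m = R (if d then Suc i else i) (dst d i j) \<or>
          R a m \<in> set (inner (cross d i j))" using set_cross[of d i j] unfolding v by blast
      moreover have "R a m \<notin> set (inner (cross d i j))" using cross_inner_row[of d i j a] by blast
      ultimately show False using that by (auto simp: row_inj split: if_splits)
    qed
    then show ?thesis using v by (intro exI[of _ a]) (auto simp: row_inj)
  next
    case False
    show ?thesis
    proof (cases "\<exists>d i j. v \<in> set (cross d i j)")
      case True
      then obtain d i j where v: "v \<in> set (cross d i j)" by auto
      have in_inner: "v \<in> set (inner (cross d i j))" if "v \<in> set (cross d i j)" for d i j
        using set_cross[of d i j] that False by auto
      have "v \<notin> set (cross d' i' j')" if "i < i'" for d' i' j'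
        using cross_inner_disjoint[of d i j d' i' j'] in_inner v that by blast
      then show ?thesis using False by (intro exI[of _ i]) auto
    qed (use False in metis)
  qed
  then obtain b where b: "\<And>v i. b v < i \<Longrightarrow> (\<forall>l. R i l \<noteq> v) \<and> (\<forall>d j. v \<notin> set (cross d i j))" by metis
  have "b v \<le> Max (insert 0 (b ` X))" if "v \<in> X" for v using assms that by (intro Max_ge) auto
  then have *: "(\<forall>l. R i l \<noteq> v) \<and> (\<forall>d j. v \<notin> set (cross d i j))" if "Max (insert 0 (b ` X)) < i" "v \<in> X" for v i
    using b that le_less_trans by blast
  show thesis
  proof (rule that[of "Max (insert 0 (b ` X))"])
    show "R i l \<notin> X" if "Max (insert 0 (b ` X)) < i" for i l using *[OF that] by blast
    show "set (cross d i j) \<inter> X = {}" if "Max (insert 0 (b ` X)) < i" for d i j using *[OF that] by blast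
  qed
qed

lemma reach_from_row:
  assumes "finite X" "\<And>l. R i l \<notin> X" "tends A (range (R i)) Q"
  obtains v where "v \<in> Q" "(R i m, v) \<in> (avoiding A X)\<^sup>*"
proof -
  have "finite (X \<union> R i ` {..<m})" using assms(1) by simp
  then obtain u v where uv: "u \<in> range (R i)" "v \<in> Q" "u \<notin> X \<union> R i ` {..<m}"
      "(u, v) \<in> (avoiding A (X \<union> R i ` {..<m}))\<^sup>*" using tendsD[OF assms(3)] by metis
  then obtain n where n: "u = R i n" "m \<le> n" by (auto simp: not_less[symmetric])
  have "(R i n, v) \<in> (avoiding A X)\<^sup>*" using avoiding_rtrancl_mono[OF uv(4), of A X] n(1) by simp
  with reach_row[OF n(2) assms(2)] uv(2) show thesis using that rtrancl_trans by metis
qed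

definition grid_arcs :: "('v \<times> 'v) set" where
  "grid_arcs = subdiv_A qgrid_A route"

lemma grid_arcs_cases:
  assumes "(u, v) \<in> grid_arcs"
  obtains (row) i m where "1 \<le> i" "u = R i m" "v = R i (Suc m)"
    | (cross) d i j q where "1 \<le> i" "Suc q < length (cross d i j)" "u = cross d i j ! q" "v = cross d i j ! Suc q"
proof -
  obtain e where e: "e \<in> qgrid_A" "(u, v) \<in> path_arcs (route e)"
    using assms by (auto simp: grid_arcs_def subdiv_A_def)
  then obtain q where q: "Suc q < length (route e)" "u = route e ! q" "v = route e ! Suc q"
    by (auto simp: path_arcs_iff)
  from e(1) show thesis
  proof (cases rule: route_cases)
    case (row i n n')
    show thesis by (rule that(1)[of i "pos (i, n) + q"]) (use q row(2) in \<open>auto simp: row(7) simp del: upt_Suc\<close>)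
  next
    case (cross d i j)
    show thesis by (rule that(2)[of i q d j]) (use q cross(1,2) in simp_all)
  qed
qed

end

locale grid_ray = ladder +
  fixes r :: "nat \<Rightarrow> 'a"
  assumes r_inj: "inj r" and r_arc: "(r n, r (Suc n)) \<in> grid_arcs"
begin

definition visits :: "nat \<Rightarrow> nat \<Rightarrow> nat \<Rightarrow> bool" where
  "visits n i m \<longleftrightarrow> 1 \<le> i \<and> r n = R i m"

text \<open>An inner vertex of a rung lies on no row and inside no other rung, so the only arc of
  the subdivision leaving it continues along the rung.\<close>

lemma follow_cross:
  assumes "1 \<le> i" "0 < q" "q < length (cross d i j)" "r n = cross d i j ! q"
  shows "\<exists>n'\<ge>n. r n' = last (cross d i j)"
  using assms(2-)
proof (induction "length (cross d i j) - 1 - q" arbitrary: n q)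
  case 0
  then have "q = length (cross d i j) - 1" by simp
  then have "r n = last (cross d i j)" using 0 by (metis last_conv_nth length_0_conv not_less_zero)
  then show ?case by blast
next
  case (Suc k)
  then have inner: "r n \<in> set (inner (cross d i j))" using nth_in_inner[of q "cross d i j"] by simp
  from r_arc[of n] have "r (Suc n) = cross d i j ! Suc q"
  proof (cases rule: grid_arcs_cases)
    case (row a m)
    then show ?thesis using inner cross_inner_row[of d i j a] by auto
  next
    case (cross d' i' j' q')
    have "0 < q'"
    proof (rule ccontr)
      assume "\<not> 0 < q'"
      then have "cross d' i' j' \<noteq> []" "q' = 0" using cross by auto
      then have "r n = hd (cross d' i' j')" using cross by (simp add: hd_conv_nth)
      then have "r n \<in> range (R (if d' then i' else Suc i'))" using cross_hd by simp
      then show False using inner cross_inner_row[of d i j] by blast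
    qed
    then have inner': "r n \<in> set (inner (cross d' i' j'))" using nth_in_inner cross by simp
    then have eq: "(d, i, j) = (d', i', j')" using inner cross_inner_disjoint by blast
    moreover have "q = q'" using cross(2,3) eq Suc.prems cross_path[of d i j]
      by (simp add: is_path_def nth_eq_iff_index_eq)
    ultimately show ?thesis using cross by simp
  qed
  moreover have "k = length (cross d i j) - 1 - Suc q" "Suc q < length (cross d i j)" using Suc.hyps(2) by simp_all
  ultimately obtain n' where "Suc n \<le> n'" "r n' = last (cross d i j)"
    using Suc.hyps(1)[of "Suc q" "Suc n"] by auto
  then show ?case by (metis Suc_leD)
qed

text \<open>When the row changes, the index of arrival is recorded as the end
  \<open>dst d a j\<close> of a rung; the argument for drifting rays compares these indices.\<close>

lemma next_visit:
  assumes "visits n i m"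
  shows "\<exists>n' i' m'. n < n' \<and> visits n' i' m' \<and> (i' = i \<or>
    (\<exists>d a j. i = (if d then a else Suc a) \<and> i' = (if d then Suc a else a) \<and> m' = dst d a j))"
  using r_arc[of n]
proof (cases rule: grid_arcs_cases)
  case (row a l)
  then have "visits (Suc n) i (Suc l)" using assms by (simp add: visits_def row_inj)
  then show ?thesis by blast
next
  case (cross d a j q)
  have ne: "cross d a j \<noteq> []" using cross(2) by auto
  have "q = 0"
  proof (rule ccontr)
    assume "q \<noteq> 0"
    then have "r n \<in> set (inner (cross d a j))" using nth_in_inner cross by simp
    then show False using assms cross_inner_row[of d a j i] by (auto simp: visits_def)
  qed
  then have "r n = hd (cross d a j)" using cross ne by (simp add: hd_conv_nth)
  then have i: "i = (if d then a else Suc a)" using assms cross_hd[of d a j] by (simp add: visits_def row_inj)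
  obtain n' where n': "Suc n \<le> n'" "r n' = last (cross d a j)"
    using follow_cross[of a "Suc q" d j "Suc n"] cross by auto
  then have "visits n' (if d then Suc a else a) (dst d a j)" using cross(1) by (simp add: visits_def cross_last)
  with n'(1) i show ?thesis by (metis Suc_le_eq)
qed

lemma ex_visit: "\<exists>n i m. visits n i m"
  using r_arc[of 0]
proof (cases rule: grid_arcs_cases)
  case (row a l)
  then show ?thesis unfolding visits_def by blast
next
  case (cross d a j q)
  then obtain n' where "r n' = last (cross d a j)" using follow_cross[of a "Suc q" d j "Suc 0"] by auto
  then have "visits n' (if d then Suc a else a) (dst d a j)" using cross(1) by (simp add: visits_def cross_last)
  then show ?thesis by blast
qed

lemma visit_sequence:
  obtains \<nu> \<rho> \<mu> where "\<And>l. visits (\<nu> l) (\<rho> l) (\<mu> l)" "strict_mono \<nu>"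
    "\<And>l. \<rho> (Suc l) = \<rho> l \<or> (\<exists>d a j. \<rho> l = (if d then a else Suc a) \<and> \<rho> (Suc l) = (if d then Suc a else a) \<and>
      \<mu> (Suc l) = dst d a j)"
proof -
  define P where "P v \<longleftrightarrow> (case v of (n, i, m) \<Rightarrow> visits n i m)" for v
  define S where "S v v' \<longleftrightarrow> (case v of (n, i, m) \<Rightarrow> case v' of (n', i', m') \<Rightarrow> n < n' \<and> (i' = i \<or>
    (\<exists>d a j. i = (if d then a else Suc a) \<and> i' = (if d then Suc a else a) \<and> m' = dst d a j)))"
    for v v' :: "nat \<times> nat \<times> nat"
  have "\<exists>f. \<forall>l. P (f l) \<and> S (f l) (f (Suc l))"
  proof (rule dependent_nat_choice)
    show "\<exists>v. P v" using ex_visit by (auto simp: P_def)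
    fix v and l :: nat assume "P v"
    then obtain n i m where v: "v = (n, i, m)" "visits n i m" by (cases v) (auto simp: P_def)
    from next_visit[OF v(2)] obtain n' i' m' where "n < n'" "visits n' i' m'" "i' = i \<or>
      (\<exists>d a j. i = (if d then a else Suc a) \<and> i' = (if d then Suc a else a) \<and> m' = dst d a j)" by blast
    then have "P (n', i', m') \<and> S v (n', i', m')" unfolding P_def S_def v(1) by simp
    then show "\<exists>v'. P v' \<and> S v v'" by blast
  qed
  then obtain f where f: "\<And>l. P (f l)" "\<And>l. S (f l) (f (Suc l))" by blast
  show thesis
  proof (rule that[of "\<lambda>l. fst (f l)" "\<lambda>l. fst (snd (f l))" "\<lambda>l. snd (snd (f l))"])
    show "visits (fst (f l)) (fst (snd (f l))) (snd (snd (f l)))" for l using f(1)[of l] by (simp add: P_def case_prod_beta)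
    show "strict_mono (\<lambda>l. fst (f l))" unfolding strict_mono_Suc_iff using f(2) by (simp add: S_def case_prod_beta)
    show "fst (snd (f (Suc l))) = fst (snd (f l)) \<or> (\<exists>d a j. fst (snd (f l)) = (if d then a else Suc a) \<and>
        fst (snd (f (Suc l))) = (if d then Suc a else a) \<and> snd (snd (f (Suc l))) = dst d a j)" for l
      using f(2)[of l] by (simp add: S_def case_prod_beta)
  qed
qed

text \<open>From the landing point of rung \<open>j + 1\<close> the start of rung \<open>j\<close>
  in the next row lies ahead: one row adds 6 to the potential, one rung less subtracts 4. So
  \<open>j\<close> drops by one with each row until the first rungs are reached.\<close>

lemma reach_first_descent:
  assumes "\<And>i l. i0 < i \<Longrightarrow> R i l \<notin> X" "\<And>d i j. i0 < i \<Longrightarrow> set (cross d i j) \<inter> X = {}" "i0 < i"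
  shows "\<exists>i'\<ge>i. (R (Suc i) (dst True i j), R (Suc i') (dst True i' 0)) \<in> (avoiding A X)\<^sup>*"
  using assms(3)
proof (induction j arbitrary: i)
  case (Suc j)
  have lt: "dst True i (Suc j) < src True (Suc i) j" by (rule potential_less) (simp add: potential_def)
  have 1: "(R (Suc i) (dst True i (Suc j)), R (Suc i) (src True (Suc i) j)) \<in> (avoiding A X)\<^sup>*"
    using reach_row lt assms(1) Suc.prems by simp
  have 2: "(R (Suc i) (src True (Suc i) j), R (Suc (Suc i)) (dst True (Suc i) j)) \<in> (avoiding A X)\<^sup>*"
    using reach_cross[of True "Suc i" j X] assms(2) Suc.prems by simp
  obtain i' where "Suc i \<le> i'" "(R (Suc (Suc i)) (dst True (Suc i) j), R (Suc i') (dst True i' 0)) \<in> (avoiding A X)\<^sup>*"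
    using Suc.IH[of "Suc i"] Suc.prems by auto
  with 1 2 show ?case by (meson Suc_leD rtrancl_trans)
qed blast

lemma reach_descents:
  assumes "\<And>i l. i0 < i \<Longrightarrow> R i l \<notin> X" "\<And>d i j. i0 < i \<Longrightarrow> set (cross d i j) \<inter> X = {}" "i0 < i" "i \<le> i'"
  shows "(R (Suc i) (dst True i 0), R (Suc i') (dst True i' 0)) \<in> (avoiding A X)\<^sup>*"
  using assms(4)
proof (induction i' rule: dec_induct)
  case (step n)
  have lt: "dst True n 0 < src True (Suc n) 0" by (rule potential_less) (simp add: potential_def)
  have "(R (Suc n) (dst True n 0), R (Suc n) (src True (Suc n) 0)) \<in> (avoiding A X)\<^sup>*"
    using reach_row lt assms(1,3) step.hyps by simp
  moreover have "(R (Suc n) (src True (Suc n) 0), R (Suc (Suc n)) (dst True (Suc n) 0)) \<in> (avoiding A X)\<^sup>*"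
    using reach_cross[of True "Suc n" 0 X] assms(2,3) step.hyps by simp
  ultimately show ?case using step.IH by (meson rtrancl_trans)
qed simp

lemma climb:
  assumes "\<And>i l. i0 < i \<Longrightarrow> R i l \<notin> X" "\<And>d i j. i0 < i \<Longrightarrow> set (cross d i j) \<inter> X = {}" "i0 < i"
  shows "\<exists>m'. (R i m, R (Suc i0) m') \<in> (avoiding A X)\<^sup>*"
proof -
  from assms(3) have "Suc i0 \<le> i" by simp
  then show ?thesis
  proof (induction i arbitrary: m rule: dec_induct)
    case (step n)
    obtain j where j: "m \<le> src False n j" using cross_avoid[of "{}" False n m] by auto
    have "(R (Suc n) m, R (Suc n) (src False n j)) \<in> (avoiding A X)\<^sup>*"
      using reach_row[OF j] assms(1) step.hyps by simp
    moreover have "(R (Suc n) (src False n j), R n (dst False n j)) \<in> (avoiding A X)\<^sup>*"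
      using reach_cross[of False n j X] assms(2) step.hyps by simp
    ultimately show ?case using step.IH[of "dst False n j"] by (meson rtrancl_trans)
  qed blast
qed

lemma ray_tends_rows: "tends A (range r) (range (R 1)) \<and> tends A (range (R 1)) (range r)"
proof -
  obtain \<nu> \<rho> \<mu> where vis: "\<And>l. visits (\<nu> l) (\<rho> l) (\<mu> l)" and \<nu>: "strict_mono \<nu>"
    and step: "\<And>l. \<rho> (Suc l) = \<rho> l \<or> (\<exists>d a j. \<rho> l = (if d then a else Suc a) \<and>
      \<rho> (Suc l) = (if d then Suc a else a) \<and> \<mu> (Suc l) = dst d a j)"
    using visit_sequence by metis
  have r_vis: "r (\<nu> l) = R (\<rho> l) (\<mu> l)" for l using vis by (simp add: visits_def)
  show ?thesis
  proof (cases "\<exists>i. infinite {l. \<rho> l = i}")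
    case True
    then obtain i where i: "infinite {l. \<rho> l = i}" by auto
    have "inj (\<lambda>l. r (\<nu> l))"
      using inj_compose[OF r_inj strict_mono_imp_inj_on[OF \<nu>]] by (simp add: comp_def)
    then have "infinite ((\<lambda>l. r (\<nu> l)) ` {l. \<rho> l = i})" using i by (metis finite_imageD inj_on_subset subset_UNIV)
    moreover have "(\<lambda>l. r (\<nu> l)) ` {l. \<rho> l = i} \<subseteq> range r \<inter> range (R i)"
    proof (rule image_subsetI)
      fix l assume "l \<in> {l. \<rho> l = i}"
      then have "r (\<nu> l) = R i (\<mu> l)" using r_vis by simp
      then show "r (\<nu> l) \<in> range r \<inter> range (R i)" by (metis IntI rangeI)
    qed
    ultimately have inf: "infinite (range r \<inter> range (R i))" using finite_subset by blast
    have "tends A (range r) (range (R i))" using inf by (rule tends_infinite_Int)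
    moreover have "tends A (range (R i)) (range r)" using inf by (intro tends_infinite_Int) (simp add: Int_commute)
    ultimately show ?thesis using tends_trans_ray[OF _ _ inj_row row_arc] tends_rows by blast
  next
    case False
    have fin: "finite {l. \<rho> l \<le> i}" for i
    proof -
      have "{l. \<rho> l \<le> i} = (\<Union>a\<le>i. {l. \<rho> l = a})" by auto
      then show ?thesis using False by simp
    qed
    have beyond: "\<exists>l. i < \<rho> l" for i
    proof (rule ccontr)
      assume "\<nexists>l. i < \<rho> l"
      then have "{l. \<rho> l \<le> i} = UNIV" by (auto simp: not_less)
      with fin[of i] show False by simp
    qed
    \<comment> \<open>Visits change the row by at most one. So the first visit beyond row
      \<open>i\<close> arrives by a forward rung from row \<open>i\<close> to row
      \<open>Suc i\<close>.\<close>
    have descent: "\<exists>l j. r l = R (Suc i) (dst True i j)" if i: "\<rho> 0 \<le> i" for i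
    proof -
      define l where "l = (LEAST l. i < \<rho> l)"
      have l: "i < \<rho> l" unfolding l_def using beyond by (rule LeastI_ex)
      then obtain l' where l': "l = Suc l'" using i by (cases l) simp_all
      have "\<rho> l' \<le> i" using not_less_Least[of l' "\<lambda>l. i < \<rho> l"] l' unfolding l_def by (simp add: not_less)
      with step[of l'] l l' obtain d a j where "\<rho> l' = (if d then a else Suc a)" "\<rho> l = (if d then Suc a else a)"
        "\<mu> l = dst d a j" by auto
      moreover from this have "d" "a = i" using \<open>\<rho> l' \<le> i\<close> l by (auto split: if_splits)
      ultimately have "\<rho> l = Suc i" "\<mu> l = dst True i j" by simp_all
      then show ?thesis using r_vis[of l] by metis
    qed
    have 1: "\<exists>u\<in>range r. \<exists>v\<in>range (R 1). u \<notin> X \<and> (u, v) \<in> (avoiding A X)\<^sup>*" if X: "finite X" for X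
    proof -
      obtain i0 where i0: "\<And>i l. i0 < i \<Longrightarrow> R i l \<notin> X" "\<And>d i j. i0 < i \<Longrightarrow> set (cross d i j) \<inter> X = {}"
        using finite_rows_bound[OF X] by metis
      \<comment> \<open>Rows and rungs beyond \<open>i0\<close> are free of \<open>X\<close>. From
        there backward rungs lead to row \<open>Suc i0\<close>, which is linked to row 1.\<close>
      obtain l where l: "i0 < \<rho> l" using beyond by blast
      obtain m' where m': "(R (\<rho> l) (\<mu> l), R (Suc i0) m') \<in> (avoiding A X)\<^sup>*" using climb[of i0 X "\<rho> l" "\<mu> l", OF i0 l] by blast
      obtain v where "v \<in> range (R 1)" "(R (Suc i0) m', v) \<in> (avoiding A X)\<^sup>*"
        using reach_from_row[OF X i0(1) tends_rows, of "Suc i0" 1 m'] by auto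
      moreover have "R (\<rho> l) (\<mu> l) \<notin> X" using i0(1) l by blast
      ultimately show ?thesis using m' r_vis[of l] by (metis rangeI rtrancl_trans)
    qed
    have 2: "\<exists>u\<in>range (R 1). \<exists>v\<in>range r. u \<notin> X \<and> (u, v) \<in> (avoiding A X)\<^sup>*" if X: "finite X" for X
    proof -
      obtain i0 where i0: "\<And>i l. i0 < i \<Longrightarrow> R i l \<notin> X" "\<And>d i j. i0 < i \<Longrightarrow> set (cross d i j) \<inter> X = {}"
        using finite_rows_bound[OF X] by metis
      obtain u m where u: "u \<in> range (R 1)" "u \<notin> X" "(u, R (Suc i0) m) \<in> (avoiding A X)\<^sup>*"
        using tendsD[OF tends_rows[of 1 "Suc i0"] X] by (metis rangeE)
      obtain j where j: "m \<le> src True (Suc i0) j" using cross_avoid[of "{}" True "Suc i0" m] by auto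
      have a: "(R (Suc i0) m, R (Suc i0) (src True (Suc i0) j)) \<in> (avoiding A X)\<^sup>*"
        by (rule reach_row[OF j]) (use i0 in simp)
      have b: "(R (Suc i0) (src True (Suc i0) j), R (Suc (Suc i0)) (dst True (Suc i0) j)) \<in> (avoiding A X)\<^sup>*"
        using reach_cross[of True "Suc i0" j X] i0(2) by simp
      obtain i' where i': "Suc i0 \<le> i'"
        and c: "(R (Suc (Suc i0)) (dst True (Suc i0) j), R (Suc i') (dst True i' 0)) \<in> (avoiding A X)\<^sup>*"
        using reach_first_descent[of i0 X "Suc i0" j, OF i0 lessI] by blast
      define i'' where "i'' = max i' (\<rho> 0)"
      have d: "(R (Suc i') (dst True i' 0), R (Suc i'') (dst True i'' 0)) \<in> (avoiding A X)\<^sup>*"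
        by (rule reach_descents[of i0 X i' i'', OF i0]) (use i' in \<open>simp_all add: i''_def\<close>)
      obtain l j' where l: "r l = R (Suc i'') (dst True i'' j')" using descent[of i''] by (auto simp: i''_def)
      \<comment> \<open>The first rung from row \<open>i''\<close> lands no later than the rung used
        by the ray, so following row \<open>Suc i''\<close> forwards from there meets the
        ray.\<close>
      have "dst True i'' 0 \<le> dst True i'' j'"
        using potential_less(4)[of True i'' 0 True i'' j'] by (cases j') (simp_all add: potential_def)
      then have e: "(R (Suc i'') (dst True i'' 0), r l) \<in> (avoiding A X)\<^sup>*"
        unfolding l by (rule reach_row) (use i0 i' in \<open>simp add: i''_def\<close>)
      have "(u, r l) \<in> (avoiding A X)\<^sup>*" using u(3) a b c d e by (meson rtrancl_trans)
      then show ?thesis using u by blast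
    qed
    show ?thesis using 1 2 unfolding tends_def by blast
  qed
qed

end

section \<open>From disjoint rays of an end to part (a)\<close>

lemma (in ray_family) ex_subdivision:
  assumes "A \<subseteq> V \<times> V"
  shows "\<exists>\<phi> P. subdivision_in V A qgrid_V qgrid_A \<phi> P \<and>
    (\<forall>r. inj r \<longrightarrow> (\<forall>n. (r n, r (Suc n)) \<in> subdiv_A qgrid_A P) \<longrightarrow>
      tends A (range r) (range (x 0)) \<and> tends A (range (x 0)) (range r))"
proof -
  obtain R rungs where L: "ladder A R rungs" and R: "\<And>j. tends A (range (x 0)) (range (R j))"
    "\<And>j. tends A (range (R j)) (range (x 0))" using ex_ladder by metis
  interpret ladder A R rungs by (rule L)
  have "tends A (range r) (range (x 0)) \<and> tends A (range (x 0)) (range r)"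
    if r: "inj r" "\<forall>n. (r n, r (Suc n)) \<in> subdiv_A qgrid_A route" for r
  proof -
    interpret grid_ray A R rungs r by unfold_locales (use r in \<open>simp_all add: grid_arcs_def\<close>)
    show ?thesis using ray_tends_rows R[of 1] tends_trans_ray[OF _ _ inj_row row_arc] by blast
  qed
  then show ?thesis using subdivision_route[OF assms] by blast
qed

lemma subdiv_A_subset:
  assumes "subdivision_in V A HV HA \<phi> P"
  shows "subdiv_A HA P \<subseteq> A"
proof
  fix a assume "a \<in> subdiv_A HA P"
  then obtain e u v where e: "e \<in> HA" "a = (u, v)" "(u, v) \<in> path_arcs (P e)" by (cases a) (auto simp: subdiv_A_def)
  moreover have "dipath V A (P e)" using assms e(1) unfolding subdivision_in_def by (cases e) fast
  ultimately show "a \<in> A" by (auto simp: path_arcs_iff dipath_def)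
qed

lemma qgrid_part:
  fixes f :: "nat \<Rightarrow> nat \<Rightarrow> 'v"
  assumes A: "A \<subseteq> V \<times> V" and \<omega>: "is_end V A \<omega>"
    and f: "\<And>i. (True, f i) \<in> \<omega>" "\<And>i j. i \<noteq> j \<Longrightarrow> range (f i) \<inter> range (f j) = {}"
  shows "\<exists>\<phi> P. subdivision_in V A qgrid_V qgrid_A \<phi> P \<and>
    (\<forall>r. ray (subdiv_V qgrid_V qgrid_A \<phi> P) (subdiv_A qgrid_A P) r \<longrightarrow> (True, r) \<in> \<omega>)"
proof -
  obtain Q where Q: "Q \<in> rays_antirays V A" and \<omega>_eq: "\<omega> = {S \<in> rays_antirays V A. end_equiv V A Q S}"
    using \<omega> unfolding is_end_def by blast
  have sub: "range (snd S) \<subseteq> V" if "S \<in> rays_antirays V A" for S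
    using that by (auto simp: rays_antirays_def ray_def anti_ray_def)
  have in_\<omega>: "S \<in> \<omega> \<longleftrightarrow> S \<in> rays_antirays V A \<and> tends A (range (snd Q)) (range (snd S)) \<and>
      tends A (range (snd S)) (range (snd Q))" for S
  proof (cases "S \<in> rays_antirays V A")
    case True
    show ?thesis
      unfolding \<omega>_eq end_equiv_def end_le_iff_tends[OF A sub[OF Q], of S] end_le_iff_tends[OF A sub[OF True], of Q]
        mem_Collect_eq ..
  qed (simp add: \<omega>_eq)
  \<comment> \<open>The representative \<open>Q\<close> of the end may be a ray or an anti-ray, so
    transitivity through either kind is used.\<close>
  have through_Q: "tends A X Y" if "tends A X (range (snd Q))" "tends A (range (snd Q)) Y" for X Y
  proof -
    from Q consider "ray V A (snd Q)" | "anti_ray V A (snd Q)" by (auto simp: rays_antirays_def)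
    then show ?thesis
      using tends_trans_ray[OF that] tends_trans_anti_ray[OF that] by cases (auto simp: ray_def anti_ray_def)
  qed
  have f_ray: "ray V A (f i)" for i using f(1)[of i] in_\<omega> by (auto simp: rays_antirays_def)
  have f_tends: "tends A (range (snd Q)) (range (f i))" "tends A (range (f i)) (range (snd Q))" for i
    using f(1)[of i] in_\<omega> by simp_all
  have "ray_family A f"
  proof
    fix i j m n
    show "f i m = f j n \<longleftrightarrow> i = j \<and> m = n"
    proof
      assume eq: "f i m = f j n"
      then have "i = j" using f(2)[of i j] by auto
      then show "i = j \<and> m = n" using eq f_ray[of j] by (auto simp: ray_def inj_eq)
    qed simp
    show "(f i n, f i (Suc n)) \<in> A" using f_ray by (simp add: ray_def)
    show "tends A (range (f i)) (range (f j))" by (rule through_Q[OF f_tends(2) f_tends(1)])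
  qed
  then interpret ray_family A f .
  obtain \<phi> P where P: "subdivision_in V A qgrid_V qgrid_A \<phi> P"
    and t: "\<And>r. inj r \<Longrightarrow> \<forall>n. (r n, r (Suc n)) \<in> subdiv_A qgrid_A P \<Longrightarrow>
      tends A (range r) (range (f 0)) \<and> tends A (range (f 0)) (range r)"
    using ex_subdivision[OF A] by blast
  have "(True, r) \<in> \<omega>" if r: "ray (subdiv_V qgrid_V qgrid_A \<phi> P) (subdiv_A qgrid_A P) r" for r
  proof -
    have arcs: "(r n, r (Suc n)) \<in> A" for n using r subdiv_A_subset[OF P] by (auto simp: ray_def)
    then have "ray V A r" using r A by (auto simp: ray_def)
    moreover have "tends A (range r) (range (f 0)) \<and> tends A (range (f 0)) (range r)"
      using t[of r] r by (simp add: ray_def)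
    ultimately show ?thesis
      using tends_trans_ray[OF _ _ inj_ray ray_arc, of _ 0] f_tends[of 0] unfolding in_\<omega>
      by (auto simp: rays_antirays_def)
  qed
  with P show ?thesis by blast
qed

section \<open>Reversing all arcs\<close>

definition flip :: "bool \<times> (nat \<Rightarrow> 'v) \<Rightarrow> bool \<times> (nat \<Rightarrow> 'v)" where
  "flip S = (\<not> fst S, snd S)"

lemma flip_flip [simp]: "flip (flip S) = S" "snd (flip S) = snd S" "flip (b, r) = (\<not> b, r)"
  by (simp_all add: flip_def)

lemma flip_rays_antirays: "flip S \<in> rays_antirays V (A\<inverse>) \<longleftrightarrow> S \<in> rays_antirays V A"
  by (cases S) (auto simp: rays_antirays_def ray_def anti_ray_def)

text \<open>Reversal exchanges the tags of rays and anti-rays and turns \<open>tends\<close> around.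
  Equivalence demands both directions, so the classes are preserved.\<close>

lemma is_end_flip:
  assumes A: "A \<subseteq> V \<times> V" and "is_end V A \<omega>"
  shows "is_end V (A\<inverse>) (flip ` \<omega>)"
proof -
  obtain Q where Q: "Q \<in> rays_antirays V A" and \<omega>: "\<omega> = {S \<in> rays_antirays V A. end_equiv V A Q S}"
    using assms(2) unfolding is_end_def by blast
  have A': "A\<inverse> \<subseteq> V \<times> V" using A by auto
  have sub: "range (snd S) \<subseteq> V" if "S \<in> rays_antirays V A" for S
    using that by (auto simp: rays_antirays_def ray_def anti_ray_def)
  have eq: "end_equiv V (A\<inverse>) (flip Q) (flip S) \<longleftrightarrow> end_equiv V A Q S" if "S \<in> rays_antirays V A" for S
    using sub[OF Q] sub[OF that] by (auto simp: end_equiv_def end_le_iff_tends A A' tends_converse)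
  have "flip ` \<omega> = {S \<in> rays_antirays V (A\<inverse>). end_equiv V (A\<inverse>) (flip Q) S}"
  proof (rule set_eqI)
    fix S
    have "S \<in> flip ` \<omega> \<longleftrightarrow> flip S \<in> \<omega>" by (metis flip_flip(1) image_iff)
    also have "\<dots> \<longleftrightarrow> S \<in> {S \<in> rays_antirays V (A\<inverse>). end_equiv V (A\<inverse>) (flip Q) S}"
      using eq[of "flip S"] flip_rays_antirays[of "flip S" V A] unfolding \<omega> by auto
    finally show "S \<in> flip ` \<omega> \<longleftrightarrow> S \<in> {S \<in> rays_antirays V (A\<inverse>). end_equiv V (A\<inverse>) (flip Q) S}" .
  qed
  moreover have "flip Q \<in> rays_antirays V (A\<inverse>)" using Q by (simp add: flip_rays_antirays)
  ultimately show ?thesis unfolding is_end_def by blast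
qed

lemma inner_rev: "set (inner (rev xs)) = set (inner xs)"
proof -
  have sub: "set (inner xs) \<subseteq> set (inner (rev xs))" for xs :: "'a list"
  proof
    fix v assume "v \<in> set (inner xs)"
    then obtain ys zs where "ys \<noteq> []" "zs \<noteq> []" "xs = ys @ v # zs" using set_inner_split by metis
    then have "rev zs \<noteq> [] \<and> rev ys \<noteq> [] \<and> rev xs = rev zs @ v # rev ys" by simp
    then show "v \<in> set (inner (rev xs))" unfolding set_inner_split by blast
  qed
  from sub[of xs] sub[of "rev xs"] show ?thesis by auto
qed

lemma dipath_rev: "dipath V A (rev xs) \<longleftrightarrow> dipath V (A\<inverse>) xs"
  by (auto simp: dipath_iff)

lemma path_arcs_rev: "path_arcs (rev xs) = (path_arcs xs)\<inverse>"
proof -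
  have sub: "(path_arcs xs)\<inverse> \<subseteq> path_arcs (rev xs)" for xs :: "'a list"
  proof
    fix a assume "a \<in> (path_arcs xs)\<inverse>"
    then obtain u v where a: "a = (v, u)" and "(u, v) \<in> path_arcs xs" by auto
    then obtain q where q: "Suc q < length xs" "u = xs ! q" "v = xs ! Suc q" unfolding path_arcs_iff by blast
    then have "Suc (length xs - q - 2) < length (rev xs) \<and> v = rev xs ! (length xs - q - 2) \<and>
        u = rev xs ! Suc (length xs - q - 2)"
      by (auto simp: rev_nth Suc_diff_Suc)
    then show "a \<in> path_arcs (rev xs)" unfolding a path_arcs_iff by blast
  qed
  from sub[of xs] sub[of "rev xs"] show ?thesis by auto
qed

lemma subdivision_converse:
  assumes "subdivision_in V (A\<inverse>) HV HA \<phi> P"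
  defines "P' \<equiv> \<lambda>(a, b). rev (P (b, a))"
  shows "subdivision_in V A HV (HA\<inverse>) \<phi> P'" "subdiv_A (HA\<inverse>) P' = (subdiv_A HA P)\<inverse>"
    "subdiv_V HV (HA\<inverse>) \<phi> P' = subdiv_V HV HA \<phi> P"
proof -
  have P: "dipath V (A\<inverse>) (P (a, b))" "2 \<le> length (P (a, b))" "hd (P (a, b)) = \<phi> a" "last (P (a, b)) = \<phi> b"
      "set (inner (P (a, b))) \<inter> \<phi> ` HV = {}" if "(a, b) \<in> HA" for a b
    using assms(1) that unfolding subdivision_in_def by blast+
  have disj: "set (inner (P e)) \<inter> set (P e') = {}" if "e \<in> HA" "e' \<in> HA" "e \<noteq> e'" for e e'
    using assms(1) that unfolding subdivision_in_def by blast
  show "subdivision_in V A HV (HA\<inverse>) \<phi> P'"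
    unfolding subdivision_in_def
  proof (intro conjI ballI impI)
    fix e assume "e \<in> HA\<inverse>"
    then obtain a b where e: "e = (a, b)" "(b, a) \<in> HA" by auto
    show "case e of (a, b) \<Rightarrow> dipath V A (P' (a, b)) \<and> 2 \<le> length (P' (a, b)) \<and> hd (P' (a, b)) = \<phi> a \<and>
        last (P' (a, b)) = \<phi> b \<and> set (inner (P' (a, b))) \<inter> \<phi> ` HV = {}"
      using P[OF e(2)] unfolding e(1) P'_def by (simp add: dipath_rev inner_rev hd_rev last_rev)
  next
    fix e e' assume "e \<in> HA\<inverse>" "e' \<in> HA\<inverse>" and ne: "e \<noteq> e'"
    then obtain a b a' b' where e: "e = (a, b)" "(b, a) \<in> HA" "e' = (a', b')" "(b', a') \<in> HA" by auto
    have "set (inner (P (b, a))) \<inter> set (P (b', a')) = {}" by (rule disj[OF e(2,4)]) (use ne e in auto)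
    then show "set (inner (P' e)) \<inter> set (P' e') = {}" unfolding P'_def e(1,3) by (simp add: inner_rev)
  qed (use assms(1) in \<open>simp_all add: subdivision_in_def\<close>)
  show "subdiv_A (HA\<inverse>) P' = (subdiv_A HA P)\<inverse>"
    unfolding subdiv_A_def P'_def by (auto simp: path_arcs_rev; force simp: path_arcs_rev)
  show "subdiv_V HV (HA\<inverse>) \<phi> P' = subdiv_V HV HA \<phi> P"
    unfolding subdiv_V_def P'_def by force
qed

theorem theorem1p2:
  fixes V :: "'v set" and A :: "('v \<times> 'v) set" and \<omega> :: "(bool \<times> (nat \<Rightarrow> 'v)) set"
  assumes "A \<subseteq> V \<times> V"
    and "is_end V A \<omega>"
  shows "((\<exists>f :: nat \<Rightarrow> nat \<Rightarrow> 'v. (\<forall>i. (True, f i) \<in> \<omega>) \<and>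
             (\<forall>i j. i \<noteq> j \<longrightarrow> range (f i) \<inter> range (f j) = {}))
          \<longrightarrow> (\<exists>\<phi> P. subdivision_in V A qgrid_V qgrid_A \<phi> P \<and>
                 (\<forall>r. ray (subdiv_V qgrid_V qgrid_A \<phi> P) (subdiv_A qgrid_A P) r
                        \<longrightarrow> (True, r) \<in> \<omega>)))
       \<and> ((\<exists>f :: nat \<Rightarrow> nat \<Rightarrow> 'v. (\<forall>i. (False, f i) \<in> \<omega>) \<and>
             (\<forall>i j. i \<noteq> j \<longrightarrow> range (f i) \<inter> range (f j) = {}))
          \<longrightarrow> (\<exists>\<phi> P. subdivision_in V A qgrid_V rev_qgrid_A \<phi> P \<and>
                 (\<forall>r. anti_ray (subdiv_V qgrid_V rev_qgrid_A \<phi> P) (subdiv_A rev_qgrid_A P) r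
                        \<longrightarrow> (False, r) \<in> \<omega>)))"
proof (intro conjI impI)
  assume "\<exists>f :: nat \<Rightarrow> nat \<Rightarrow> 'v. (\<forall>i. (True, f i) \<in> \<omega>) \<and> (\<forall>i j. i \<noteq> j \<longrightarrow> range (f i) \<inter> range (f j) = {})"
  then show "\<exists>\<phi> P. subdivision_in V A qgrid_V qgrid_A \<phi> P \<and>
      (\<forall>r. ray (subdiv_V qgrid_V qgrid_A \<phi> P) (subdiv_A qgrid_A P) r \<longrightarrow> (True, r) \<in> \<omega>)"
    using qgrid_part[OF assms] by metis
next
  assume "\<exists>f :: nat \<Rightarrow> nat \<Rightarrow> 'v. (\<forall>i. (False, f i) \<in> \<omega>) \<and> (\<forall>i j. i \<noteq> j \<longrightarrow> range (f i) \<inter> range (f j) = {})"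
  then obtain f :: "nat \<Rightarrow> nat \<Rightarrow> 'v" where f: "\<And>i. (False, f i) \<in> \<omega>"
    "\<And>i j. i \<noteq> j \<Longrightarrow> range (f i) \<inter> range (f j) = {}" by blast
  have A': "A\<inverse> \<subseteq> V \<times> V" using assms(1) by auto
  have flip_mem: "(b, r) \<in> flip ` \<omega> \<longleftrightarrow> (\<not> b, r) \<in> \<omega>" for b r
    using flip_flip(1,3) by (metis image_iff)
  have "\<exists>\<phi> P. subdivision_in V (A\<inverse>) qgrid_V qgrid_A \<phi> P \<and>
      (\<forall>r. ray (subdiv_V qgrid_V qgrid_A \<phi> P) (subdiv_A qgrid_A P) r \<longrightarrow> (True, r) \<in> flip ` \<omega>)"
    by (rule qgrid_part[OF A' is_end_flip[OF assms], of f]) (use f flip_mem in simp_all)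
  then obtain \<phi> P where P: "subdivision_in V (A\<inverse>) qgrid_V qgrid_A \<phi> P"
    and r: "\<And>r. ray (subdiv_V qgrid_V qgrid_A \<phi> P) (subdiv_A qgrid_A P) r \<Longrightarrow> (False, r) \<in> \<omega>"
    using flip_mem by auto
  have "anti_ray W (B\<inverse>) s \<longleftrightarrow> ray W B s" for W B and s :: "nat \<Rightarrow> 'v" by (simp add: ray_def anti_ray_def)
  then show "\<exists>\<phi> P. subdivision_in V A qgrid_V rev_qgrid_A \<phi> P \<and>
      (\<forall>r. anti_ray (subdiv_V qgrid_V rev_qgrid_A \<phi> P) (subdiv_A rev_qgrid_A P) r \<longrightarrow> (False, r) \<in> \<omega>)"
    using subdivision_converse[OF P] r unfolding rev_qgrid_A_def by metis
qed

end
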